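(* Let $n\in\mathbb{N}$, $p\ge1$, and suppose that the cutoff function $g$ is Riemann integrable. Let $(f_m)_{m\in\mathbb{N}}\in\mathscr{L}^p(\mathfrak{H})$ be given by $$f_m(\mathbf{z})=\frac1{2^{2m}}\sum_{\ell\in\mathfrak{N}_m}{:}z_\ell^k{:}\,g(\ell),\qquad \mathbf{z}=(z_\ell)_{\ell\in\mathfrak{N}_m}\equiv\sum_{\ell\in\mathfrak{N}_m}z_\ell\,\delta_{n,\ell}^a\in H_{m,n}^a$$ (that this sequence belongs to $\mathscr{L}^p(\mathfrak{H})$ is part of the assertion). Then the following identities hold: $$\mathfrak{F}_{p,n}\big((f_m)_{m\in\mathbb{N}}\big)=\int_{\mathbb{R}^2}{:}\phi^k(\delta_{n,x}){:}\,g(x)\,\mathrm{d}x,$$ $$\mathfrak{F}_{p,n}\big((\exp(-f_m))_{m\in\mathbb{N}}\big)=\exp\Big(-\int_{\mathbb{R}^2}{:}\phi^k(\delta_{n,x}){:}\,g(x)\,\mathrm{d}x\Big).$$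
   Context: $\mathscr{S}(\mathbb{R}^2)$ is the space of real Schwartz functions, $\mathscr{S}'(\mathbb{R}^2)$ its dual with the $\sigma$-algebra generated by the evaluations. $\mathfrak{C}(f,g)=\int_{\mathbb{R}^2}f(x)(-\Delta+1)^{-1}g(x)\,\mathrm{d}x$ and $\mu_{\mathfrak{C}}$ is the Gaussian measure on $\mathscr{S}'(\mathbb{R}^2)$ with $\int e^{i\phi(f)}\mathrm{d}\mu_{\mathfrak{C}}(\phi)=e^{-\frac12\mathfrak{C}(f,f)}$. Fix $k\in\mathbb{N}$ and a compactly supported cutoff function $g\in L^s(\mathbb{R}^2)$ for some $s>1$. Fix $h\in\mathcal{C}_0^\infty(\mathbb{R}^2)$ with $h\ge0$, $\int h=1$ and Fourier transform $\hat h(\xi)\ne0$ for every $\xi\in\mathbb{R}^2$, and put $\delta_{n,x}(y)=n^2h(n(x-y))$. Wick powers are ${:}\phi^k(f){:}=\sum_{j=0}^{[k/2]}\frac{(-1)^jk!}{(k-2j)!\,j!\,2^j}\mathfrak{C}(f,f)^j\phi(f)^{k-2j}$, $f\in\mathscr{S}(\mathbb{R}^2)$. In the setting considered, $V=\lim_{n\to\infty}\int_{\mathbb{R}^2}{:}\phi^k(\delta_{n,x}){:}\,g(x)\,\mathrm{d}x$ in $L^2(\mu_{\mathfrak{C}})$, and it is taken as known from the literature that $e^{-V}\in\bigcap_{p<\infty}L^p(\mathscr{S}'(\mathbb{R}^2),\mu_{\mathfrak{C}})$. For $m\in\mathbb{N}$, $\mathfrak{N}_m=\{x\in\frac1{2^m}\mathbb{Z}^2:|x|\le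 m\}$, $H_{m,n}=\operatorname{span}\{\delta_{n,\ell}:\ell\in\mathfrak{N}_m\}$, $H_{m,n}^a$ is its algebraic dual, with basis $(\delta_{n,\ell}^a)_\ell$ dual to $(\delta_{n,\ell})_\ell$. $\varphi_{m,n}:\mathscr{S}'(\mathbb{R}^2)\to H_{m,n}^a$, $\varphi_{m,n}(\phi)=\phi|_{H_{m,n}}=\sum_{\ell\in\mathfrak{N}_m}\phi(\delta_{n,\ell})\delta_{n,\ell}^a$; $\mu_{m,n}=(\varphi_{m,n})_*\mu_{\mathfrak{C}}$ (centered Gaussian with covariance matrix $(\mathfrak{C}(\delta_{n,i},\delta_{n,j}))_{i,j\in\mathfrak{N}_m}$); $\pi_{mm',n}:H_{m',n}^a\to H_{m,n}^a$ is restriction, $m\le m'$. On $H_{m,n}^a$, ${:}z_\ell^k{:}=\sum_{j=0}^{[k/2]}\frac{(-1)^jk!}{(k-2j)!\,j!\,2^j}\mathfrak{C}(\delta_{n,\ell},\delta_{n,\ell})^jz_\ell^{k-2j}$. For fixed $n$, $\mathfrak{H}$ is the diagram $(H_{m,n}^a,\mu_{m,n},\pi_{mm',n})$ indexed by $m\in\mathbb{N}$. For a measure preserving map $f$, $f^*(u)=u\circ f$. A sequence $(f_m)_m\in\prod_mL^p(H_{m,n}^a,\mu_{m,n})$ is co-Cauchy if for every $\varepsilon>0$ there is $M$ with $\|\pi_{mm',n}^*(f_m)-f_{m'}\|_{L^p(\mu_{m',n})}<\varepsilon$ whenever $M\le m\le m'$. $\mathscr{L}^p(\mathfrak{H})$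 is the space of co-Cauchy sequences modulo $(f_m)\sim(g_m)$ iff $\lim_m\|f_m-g_m\|_{L^p(\mu_{m,n})}=0$, with norm $\lim_m\|f_m\|_{L^p(\mu_{m,n})}$. $\mathfrak{F}_{p,n}:\mathscr{L}^p(\mathfrak{H})\to L^p(\mathscr{S}'(\mathbb{R}^2),\mu_{\mathfrak{C}})$, $(f_m)_m\mapsto\lim_{m\to\infty}\varphi_{m,n}^*(f_m)$ (limit in $L^p$), is an isometric isomorphism. The identities are equalities in $L^p(\mathscr{S}'(\mathbb{R}^2),\mu_{\mathfrak{C}})$.
   Formalization: For k≥2 the second identity assumes: if g≥0 a.e. (resp. g≤0 a.e.) then g≥0 (resp. g≤0) everywhere; otherwise it fails, e.g. k=4, g=-1_{{0}}: V=0, but exp(-f_m) is not integrable. Also n≥1 is assumed. *)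

theory Defs
  imports "HOL-Probability.Probability"
begin

definition partial_deriv :: "2 \<Rightarrow> (real^2 \<Rightarrow> real) \<Rightarrow> real^2 \<Rightarrow> real" where
  "partial_deriv i f x = frechet_derivative f (at x) (axis i 1)"

definition partials :: "2 list \<Rightarrow> (real^2 \<Rightarrow> real) \<Rightarrow> real^2 \<Rightarrow> real" where
  "partials is f = foldr partial_deriv is f"

text \<open>Differentiability of all iterated partial derivatives also gives their continuity,
  so this is the class of infinitely differentiable functions.\<close>

definition smooth_fun :: "(real^2 \<Rightarrow> real) \<Rightarrow> bool" where
  "smooth_fun f \<longleftrightarrow> (\<forall>is x. partials is f differentiable (at x))"

definition compactly_supported :: "(real^2 \<Rightarrow> real) \<Rightarrow> bool" where
  "compactly_supported f \<longleftrightarrow> compact (closure {x. f x \<noteq> 0})"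

definition schwartz :: "(real^2 \<Rightarrow> real) set" where
  "schwartz = {f. smooth_fun f \<and>
     (\<forall>N is. bounded (range (\<lambda>x. (1 + norm x) ^ N * partials is f x)))}"

text \<open>An increasing sequence of seminorms that defines the Schwartz topology.\<close>

definition schwartz_norm :: "nat \<Rightarrow> (real^2 \<Rightarrow> real) \<Rightarrow> real" where
  "schwartz_norm N f =
     (\<Sum>is | length is \<le> N. SUP x. (1 + norm x) ^ N * \<bar>partials is f x\<bar>)"

text \<open>Functionals on a linear space \<open>W\<close> of functions.  They are made
  extensional, so that two of them that agree on \<open>W\<close> are equal.\<close>

definition algebraic_dual :: "(real^2 \<Rightarrow> real) set \<Rightarrow> ((real^2 \<Rightarrow> real) \<Rightarrow> real) set" where
  "algebraic_dual W = {\<psi> \<in> extensional W.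
     \<forall>f\<in>W. \<forall>g\<in>W. \<forall>a b. \<psi> (\<lambda>x. a * f x + b * g x) = a * \<psi> f + b * \<psi> g}"

text \<open>Continuity of a linear functional in the Schwartz topology amounts to a bound
  by one of the seminorms.\<close>

definition tempered :: "((real^2 \<Rightarrow> real) \<Rightarrow> real) set" where
  "tempered = {\<phi> \<in> algebraic_dual schwartz.
     \<exists>N C. \<forall>f\<in>schwartz. \<bar>\<phi> f\<bar> \<le> C * schwartz_norm N f}"

text \<open>The \<open>\<sigma>\<close>-algebra on a set \<open>X\<close> of functionals on \<open>W\<close> generated by the evaluations.
  For the dual of a finite-dimensional \<open>W\<close> it is the Borel \<open>\<sigma>\<close>-algebra.\<close>

definition evaluation_algebra ::
  "(real^2 \<Rightarrow> real) set \<Rightarrow> ((real^2 \<Rightarrow> real) \<Rightarrow> real) set \<Rightarrow> ((real^2 \<Rightarrow> real) \<Rightarrow> real) measure" where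
  "evaluation_algebra W X = sigma X {{\<psi>\<in>X. \<psi> f \<in> B} | f B. f \<in> W \<and> B \<in> sets borel}"

definition laplacian :: "(real^2 \<Rightarrow> real) \<Rightarrow> real^2 \<Rightarrow> real" where
  "laplacian f x = (\<Sum>i\<in>UNIV. partials [i, i] f x)"

text \<open>The operator \<open>-\<Delta> + 1\<close> is a bijection of the Schwartz space, and
  \<open>resolvent\<close> is its inverse.\<close>

definition resolvent :: "(real^2 \<Rightarrow> real) \<Rightarrow> real^2 \<Rightarrow> real" where
  "resolvent = the_inv_into schwartz (\<lambda>u x. - laplacian u x + u x)"

definition Cov :: "(real^2 \<Rightarrow> real) \<Rightarrow> (real^2 \<Rightarrow> real) \<Rightarrow> real" where
  "Cov f g = (LINT x|lborel. f x * resolvent g x)"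

definition free_field_measure :: "((real^2 \<Rightarrow> real) \<Rightarrow> real) measure \<Rightarrow> bool" where
  "free_field_measure \<mu> \<longleftrightarrow>
     prob_space \<mu> \<and> sets \<mu> = sets (evaluation_algebra schwartz tempered) \<and>
     (\<forall>f\<in>schwartz. (CLINT \<phi>|\<mu>. exp (\<i> * complex_of_real (\<phi> f)))
        = complex_of_real (exp (- (1/2) * Cov f f)))"

definition fourier :: "(real^2 \<Rightarrow> real) \<Rightarrow> real^2 \<Rightarrow> complex" where
  "fourier f \<xi> = (CLINT x|lborel. exp (- \<i> * complex_of_real (x \<bullet> \<xi>)) * complex_of_real (f x))"

text \<open>Elements of \<open>L\<^sup>p\<close> are handled through representatives; equality in \<open>L\<^sup>p\<close> is equality
  almost everywhere of two members.\<close>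

definition in_Lp :: "'a measure \<Rightarrow> real \<Rightarrow> ('a \<Rightarrow> real) \<Rightarrow> bool" where
  "in_Lp M p f \<longleftrightarrow> f \<in> borel_measurable M \<and> integrable M (\<lambda>x. \<bar>f x\<bar> powr p)"

definition Lp_norm :: "'a measure \<Rightarrow> real \<Rightarrow> ('a \<Rightarrow> real) \<Rightarrow> real" where
  "Lp_norm M p f = (LINT x|M. \<bar>f x\<bar> powr p) powr (1 / p)"

definition Lp_eq :: "'a measure \<Rightarrow> real \<Rightarrow> ('a \<Rightarrow> real) \<Rightarrow> ('a \<Rightarrow> real) \<Rightarrow> bool" where
  "Lp_eq M p f g \<longleftrightarrow> in_Lp M p f \<and> in_Lp M p g \<and> (AE x in M. f x = g x)"

definition Lp_tendsto :: "'a measure \<Rightarrow> real \<Rightarrow> (nat \<Rightarrow> 'a \<Rightarrow> real) \<Rightarrow> ('a \<Rightarrow> real) \<Rightarrow> bool" where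
  "Lp_tendsto M p F f \<longleftrightarrow> (\<forall>m. in_Lp M p (F m)) \<and> in_Lp M p f \<and>
     (\<lambda>m. Lp_norm M p (\<lambda>x. F m x - f x)) \<longlonglongrightarrow> 0"

definition riemann_integrable_on :: "(real^2 \<Rightarrow> real) \<Rightarrow> (real^2) set \<Rightarrow> bool" where
  "riemann_integrable_on f S \<longleftrightarrow> (\<exists>I. \<forall>e>0. \<exists>d>0. \<forall>P.
     P tagged_division_of S \<and> (\<forall>(x, K)\<in>P. diameter K < d) \<longrightarrow>
     \<bar>(\<Sum>(x, K)\<in>P. measure lborel K * f x) - I\<bar> < e)"

text \<open>The open box excludes degenerate rectangles of area zero, on which every function
  would be integrable.\<close>

definition riemann_integrable :: "(real^2 \<Rightarrow> real) \<Rightarrow> bool" where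
  "riemann_integrable f \<longleftrightarrow>
     (\<exists>a b. {x. f x \<noteq> 0} \<subseteq> box a b \<and> riemann_integrable_on f (cbox a b))"

text \<open>A normalization of the values of \<open>f\<close> on null sets: a sign that \<open>f\<close> has almost
  everywhere, it has everywhere.  Changing \<open>f\<close> on a null set changes none of the integrals
  against \<open>f\<close>, but it can destroy the integrability of the exponential of a lattice sum.\<close>

definition sign_normalized :: "(real^2 \<Rightarrow> real) \<Rightarrow> bool" where
  "sign_normalized f \<longleftrightarrow>
     ((AE x in lebesgue. 0 \<le> f x) \<longrightarrow> (\<forall>x. 0 \<le> f x)) \<and>
     ((AE x in lebesgue. f x \<le> 0) \<longrightarrow> (\<forall>x. f x \<le> 0))"

definition wick :: "nat \<Rightarrow> real \<Rightarrow> real \<Rightarrow> real" where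
  "wick k c t = (\<Sum>j = 0..k div 2.
     (-1) ^ j * fact k / (fact (k - 2 * j) * fact j * 2 ^ j) * c ^ j * t ^ (k - 2 * j))"

definition wick_field :: "nat \<Rightarrow> (real^2 \<Rightarrow> real) \<Rightarrow> ((real^2 \<Rightarrow> real) \<Rightarrow> real) \<Rightarrow> real" where
  "wick_field k f \<phi> = wick k (Cov f f) (\<phi> f)"

definition mollifier :: "(real^2 \<Rightarrow> real) \<Rightarrow> nat \<Rightarrow> real^2 \<Rightarrow> real^2 \<Rightarrow> real" where
  "mollifier h n x y = (real n)\<^sup>2 * h (real n *\<^sub>R (x - y))"

definition interaction ::
  "(real^2 \<Rightarrow> real) \<Rightarrow> (real^2 \<Rightarrow> real) \<Rightarrow> nat \<Rightarrow> nat \<Rightarrow> ((real^2 \<Rightarrow> real) \<Rightarrow> real) \<Rightarrow> real" where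
  "interaction h g k n \<phi> = (LINT x|lebesgue. wick_field k (mollifier h n x) \<phi> * g x)"

definition grid :: "nat \<Rightarrow> (real^2) set" where
  "grid m = {x. (\<forall>i. 2 ^ m * x $ i \<in> \<int>) \<and> norm x \<le> real m}"

definition test_space :: "(real^2 \<Rightarrow> real) \<Rightarrow> nat \<Rightarrow> nat \<Rightarrow> (real^2 \<Rightarrow> real) set" where
  "test_space h n m = {\<lambda>y. \<Sum>l\<in>grid m. c l * mollifier h n l y | c. True}"

definition lattice_dual :: "(real^2 \<Rightarrow> real) \<Rightarrow> nat \<Rightarrow> nat \<Rightarrow> ((real^2 \<Rightarrow> real) \<Rightarrow> real) set" where
  "lattice_dual h n m = algebraic_dual (test_space h n m)"

text \<open>Restriction to \<open>test_space h n m\<close> serves both as the map from the tempered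
  distributions to \<open>lattice_dual h n m\<close> and, for \<open>m \<le> m'\<close>, as the connecting map from
  \<open>lattice_dual h n m'\<close>.\<close>

definition lattice_restrict ::
  "(real^2 \<Rightarrow> real) \<Rightarrow> nat \<Rightarrow> nat \<Rightarrow> ((real^2 \<Rightarrow> real) \<Rightarrow> real) \<Rightarrow> (real^2 \<Rightarrow> real) \<Rightarrow> real" where
  "lattice_restrict h n m \<psi> = restrict \<psi> (test_space h n m)"

definition lattice_measure ::
  "((real^2 \<Rightarrow> real) \<Rightarrow> real) measure \<Rightarrow> (real^2 \<Rightarrow> real) \<Rightarrow> nat \<Rightarrow> nat
     \<Rightarrow> ((real^2 \<Rightarrow> real) \<Rightarrow> real) measure" where
  "lattice_measure \<mu> h n m =
     distr \<mu> (evaluation_algebra (test_space h n m) (lattice_dual h n m)) (lattice_restrict h n m)"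

text \<open>Representatives of the elements of the colimit space of a diagram of measure spaces
  \<open>M m\<close>, with connecting maps \<open>\<pi> m m'\<close> from \<open>M m'\<close> to \<open>M m\<close>.\<close>

definition co_Cauchy ::
  "(nat \<Rightarrow> 'a measure) \<Rightarrow> (nat \<Rightarrow> nat \<Rightarrow> 'a \<Rightarrow> 'a) \<Rightarrow> real \<Rightarrow> (nat \<Rightarrow> 'a \<Rightarrow> real) \<Rightarrow> bool" where
  "co_Cauchy M \<pi> p f \<longleftrightarrow> (\<forall>m. in_Lp (M m) p (f m)) \<and>
     (\<forall>e>0. \<exists>N. \<forall>m m'. N \<le> m \<longrightarrow> m \<le> m' \<longrightarrow>
        Lp_norm (M m') p (\<lambda>z. f m (\<pi> m m' z) - f m' z) < e)"

definition lattice_co_Cauchy ::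
  "((real^2 \<Rightarrow> real) \<Rightarrow> real) measure \<Rightarrow> (real^2 \<Rightarrow> real) \<Rightarrow> nat \<Rightarrow> real
     \<Rightarrow> (nat \<Rightarrow> ((real^2 \<Rightarrow> real) \<Rightarrow> real) \<Rightarrow> real) \<Rightarrow> bool" where
  "lattice_co_Cauchy \<mu> h n p f =
     co_Cauchy (lattice_measure \<mu> h n) (\<lambda>m m'. lattice_restrict h n m) p f"

text \<open>The isometry from the colimit space to \<open>L\<^sup>p\<close> over the tempered distributions.  The limit is
  determined up to equality almost everywhere.\<close>

definition colimit_map ::
  "((real^2 \<Rightarrow> real) \<Rightarrow> real) measure \<Rightarrow> (real^2 \<Rightarrow> real) \<Rightarrow> nat \<Rightarrow> real
     \<Rightarrow> (nat \<Rightarrow> ((real^2 \<Rightarrow> real) \<Rightarrow> real) \<Rightarrow> real) \<Rightarrow> ((real^2 \<Rightarrow> real) \<Rightarrow> real) \<Rightarrow> real" where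
  "colimit_map \<mu> h n p f =
     (SOME F. Lp_tendsto \<mu> p (\<lambda>m \<phi>. f m (lattice_restrict h n m \<phi>)) F)"

text \<open>The coordinate of \<open>z\<close> at \<open>l\<close> in the basis dual to the functions \<open>mollifier h n l\<close> is
  \<open>z (mollifier h n l)\<close>.\<close>

definition lattice_interaction ::
  "(real^2 \<Rightarrow> real) \<Rightarrow> (real^2 \<Rightarrow> real) \<Rightarrow> nat \<Rightarrow> nat \<Rightarrow> nat
     \<Rightarrow> ((real^2 \<Rightarrow> real) \<Rightarrow> real) \<Rightarrow> real" where
  "lattice_interaction h g k n m z = 1 / 2 ^ (2 * m) *
     (\<Sum>l\<in>grid m. wick k (Cov (mollifier h n l) (mollifier h n l)) (z (mollifier h n l)) * g l)"

end

theory Submission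
  imports Defs
begin

text \<open>
  Pulling back along the restriction maps is isometric, and restrictions compose.  Hence membership
  of a lattice sequence in the colimit space and the value of the colimit map on it both follow
  once the pulled-back sequence converges over the tempered distributions
  (\<open>colimit_if_Lp_tendsto\<close>).

  For a fixed distribution \<open>\<phi>\<close> the Wick power of \<open>\<phi>\<close> at the mollifier around \<open>x\<close> is a continuous
  function of \<open>x\<close>, and a Riemann integrable \<open>g\<close> is bounded and continuous almost everywhere.  So the
  lattice sums converge to the integral for every single \<open>\<phi>\<close> (\<open>lattice_sum_tendsto\<close>), and so do
  their exponentials.  Pointwise convergence improves to convergence in the mean of order \<open>p\<close> as soon
  as the moments of order \<open>2 * p\<close> are bounded (\<open>Lp_tendsto_if_pointwise_and_bounded\<close>).

  For the sums themselves these moments are bounded because a lattice sum is an average of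
  polynomials of Gaussian variables of bounded variance (\<open>convex_lattice_sum\<close>).  The values of
  the field are Gaussian by uniqueness of characteristic functions, since the covariance is homogeneous of
  degree two (\<open>Cov_scale\<close>, \<open>free_field_distr\<close>).

  For the exponentials, \<open>k = 1\<close> again leads to Gaussian integrals, and for even \<open>k\<close> and \<open>g \<ge> 0\<close> the
  sums are bounded below because a Wick polynomial of even degree is.  In the remaining cases the
  integrability of \<open>exp (- q * V)\<close> for all \<open>q\<close> comes in.  It forces \<open>g \<ge> 0\<close> almost everywhere for
  even \<open>k\<close> and \<open>g = 0\<close> almost everywhere for odd \<open>k \<ge> 3\<close>: shift the field by a multiple
  \<open>a * u\<close> of a test function.  The mean of \<open>V\<close> becomes \<open>a ^ k\<close> times the integral of \<open>u ^ k * g\<close>, while the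
  relative entropy of the shifted measure grows only like \<open>a\<^sup>2\<close>.  By the variational inequality of
  Gibbs (\<open>gibbs_lower_bound\<close>) a negative integral would make the expectation of \<open>exp (- q * V)\<close>
  infinite for large \<open>q\<close> (\<open>cutoff_moment_nonneg\<close>).  Bumps \<open>u\<close> concentrated at a point of continuity
  transfer the sign to \<open>g\<close> (\<open>nonneg_at_continuity_point\<close>), and \<open>sign_normalized\<close> extends it from almost all
  points to all, in particular to the lattice points.  The shift by \<open>a * u\<close> is the density with exponent
  \<open>\<phi> (a * (- \<Delta> u + u))\<close>, and the preimages of the mollifiers under \<open>- \<Delta> + 1\<close> enter its computation.  A
  Schwartz function without a preimage would make the field vanish almost surely
  (\<open>free_field_degenerate\<close>), and then the sums are zero for \<open>k \<ge> 2\<close>.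
\<close>

section \<open>Calculus of iterated partial derivatives\<close>

lemma partials_Nil [simp]: "partials [] f = f"
  by (simp add: partials_def)

lemma partials_Cons: "partials (i # is) f = partial_deriv i (partials is f)"
  by (simp add: partials_def)

lemma partials_partial_deriv: "partials is (partial_deriv i f) = partials (is @ [i]) f"
  by (simp add: partials_def)

lemma smooth_funD: "smooth_fun f \<Longrightarrow> partials is f differentiable (at x)"
  by (simp add: smooth_fun_def)

lemma smooth_fun_has_derivative:
  "smooth_fun f \<Longrightarrow> (partials is f has_derivative frechet_derivative (partials is f) (at x)) (at x)"
  using smooth_funD frechet_derivative_works by blast

lemma partial_deriv_eqI:
  assumes "(f has_derivative f') (at x)"
  shows "partial_deriv i f x = f' (axis i 1)"
  using frechet_derivative_at[OF assms] by (simp add: partial_deriv_def)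

lemma continuous_on_partials: "smooth_fun f \<Longrightarrow> continuous_on A (partials is f)"
  by (meson continuous_at_imp_continuous_on differentiable_imp_continuous_within smooth_funD)

lemma partials_linear:
  assumes "smooth_fun f" "smooth_fun g"
  shows "partials is (\<lambda>x. a * f x + b * g x) = (\<lambda>x. a * partials is f x + b * partials is g x)"
proof (induction "is")
  case (Cons i "is")
  show ?case
  proof
    fix x
    have "((\<lambda>x. a * partials is f x + b * partials is g x) has_derivative
        (\<lambda>v. a * frechet_derivative (partials is f) (at x) v
           + b * frechet_derivative (partials is g) (at x) v)) (at x)"
      by (intro derivative_intros smooth_fun_has_derivative assms)
    from partial_deriv_eqI[OF this]
    show "partials (i # is) (\<lambda>x. a * f x + b * g x) x
        = a * partials (i # is) f x + b * partials (i # is) g x"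
      by (simp add: partials_Cons Cons partial_deriv_def)
  qed
qed simp

lemma smooth_fun_linear:
  assumes "smooth_fun f" "smooth_fun g"
  shows "smooth_fun (\<lambda>x. a * f x + b * g x)"
  unfolding smooth_fun_def partials_linear[OF assms]
  by (intro allI derivative_intros smooth_funD assms)

lemma schwartz_smooth: "f \<in> schwartz \<Longrightarrow> smooth_fun f"
  by (simp add: schwartz_def)

lemma schwartz_continuous_on: "f \<in> schwartz \<Longrightarrow> continuous_on A f"
  using continuous_on_partials[of f A "[]"] by (simp add: schwartz_smooth)

lemma schwartz_linear:
  assumes "f \<in> schwartz" "g \<in> schwartz"
  shows "(\<lambda>x. a * f x + b * g x) \<in> schwartz"
proof -
  have "bounded (range (\<lambda>x. (1 + norm x) ^ N * partials is (\<lambda>x. a * f x + b * g x) x))" for N "is"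
  proof -
    obtain A where A: "\<And>x. \<bar>(1 + norm x) ^ N * partials is f x\<bar> \<le> A"
      using assms(1) by (fastforce simp: schwartz_def bounded_iff simp del: abs_mult)
    obtain B where B: "\<And>x. \<bar>(1 + norm x) ^ N * partials is g x\<bar> \<le> B"
      using assms(2) by (fastforce simp: schwartz_def bounded_iff simp del: abs_mult)
    have "\<bar>(1 + norm x) ^ N * (a * partials is f x + b * partials is g x)\<bar> \<le> \<bar>a\<bar> * A + \<bar>b\<bar> * B" for x
    proof -
      have "\<bar>(1 + norm x) ^ N * (a * partials is f x + b * partials is g x)\<bar>
          = \<bar>a * ((1 + norm x) ^ N * partials is f x) + b * ((1 + norm x) ^ N * partials is g x)\<bar>"
        by (simp add: algebra_simps)
      also have "\<dots> \<le> \<bar>a\<bar> * \<bar>(1 + norm x) ^ N * partials is f x\<bar> + \<bar>b\<bar> * \<bar>(1 + norm x) ^ N * partials is g x\<bar>"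
        using abs_triangle_ineq abs_mult by metis
      also have "\<dots> \<le> \<bar>a\<bar> * A + \<bar>b\<bar> * B"
        using A B by (intro add_mono mult_left_mono) auto
      finally show ?thesis .
    qed
    then show ?thesis
      unfolding bounded_iff partials_linear[OF schwartz_smooth[OF assms(1)] schwartz_smooth[OF assms(2)]]
      by (intro exI[of _ "\<bar>a\<bar> * A + \<bar>b\<bar> * B"]) auto
  qed
  then show ?thesis
    using assms smooth_fun_linear unfolding schwartz_def by blast
qed

lemma schwartz_scale: "f \<in> schwartz \<Longrightarrow> (\<lambda>x. a * f x) \<in> schwartz"
  using schwartz_linear[of f f a 0] by simp

lemma schwartz_add: "f \<in> schwartz \<Longrightarrow> g \<in> schwartz \<Longrightarrow> (\<lambda>x. f x + g x) \<in> schwartz"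
  using schwartz_linear[of f g 1 1] by simp

lemma partials_affine:
  assumes "smooth_fun f"
  shows "partials is (\<lambda>y. a * f (c *\<^sub>R (x - y)))
    = (\<lambda>y. a * (- c) ^ length is * partials is f (c *\<^sub>R (x - y)))"
proof (induction "is")
  case (Cons i "is")
  show ?case
  proof
    fix y
    have "((\<lambda>y. partials is f (c *\<^sub>R (x - y))) has_derivative
        (\<lambda>v. frechet_derivative (partials is f) (at (c *\<^sub>R (x - y))) (c *\<^sub>R (0 - v)))) (at y)"
      by (rule has_derivative_compose[of "\<lambda>y. c *\<^sub>R (x - y)"])
        (intro derivative_intros smooth_fun_has_derivative assms)+
    then have "((\<lambda>y. a * (- c) ^ length is * partials is f (c *\<^sub>R (x - y))) has_derivative
        (\<lambda>v. a * (- c) ^ length is *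
          frechet_derivative (partials is f) (at (c *\<^sub>R (x - y))) (c *\<^sub>R (0 - v)))) (at y)"
      by (intro derivative_intros)
    from partial_deriv_eqI[OF this, of i]
    have "partials (i # is) (\<lambda>y. a * f (c *\<^sub>R (x - y))) y = a * (- c) ^ length is *
        frechet_derivative (partials is f) (at (c *\<^sub>R (x - y))) ((- c) *\<^sub>R axis i 1)"
      by (simp add: partials_Cons Cons)
    also have "frechet_derivative (partials is f) (at (c *\<^sub>R (x - y))) ((- c) *\<^sub>R axis i 1)
        = (- c) * partials (i # is) f (c *\<^sub>R (x - y))"
      using linear_scale[OF linear_frechet_derivative[OF smooth_funD[OF assms]], of _ _ "- c"]
      by (simp add: partials_Cons partial_deriv_def)
    finally show "partials (i # is) (\<lambda>y. a * f (c *\<^sub>R (x - y))) y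
        = a * (- c) ^ length (i # is) * partials (i # is) f (c *\<^sub>R (x - y))"
      by simp
  qed
qed simp

lemma smooth_fun_affine:
  assumes "smooth_fun f"
  shows "smooth_fun (\<lambda>y. a * f (c *\<^sub>R (x - y)))"
  unfolding smooth_fun_def partials_affine[OF assms]
proof (intro allI)
  fix "is" and y :: "real^2"
  have "(\<lambda>y. c *\<^sub>R (x - y)) differentiable at y"
    by (intro derivative_intros)
  then have "(partials is f \<circ> (\<lambda>y. c *\<^sub>R (x - y))) differentiable at y"
    by (intro differentiable_chain_at smooth_funD assms)
  then have "(\<lambda>y. partials is f (c *\<^sub>R (x - y))) differentiable at y"
    by (simp only: o_def)
  then show "(\<lambda>y. a * (- c) ^ length is * partials is f (c *\<^sub>R (x - y))) differentiable at y"
    by (intro differentiable_mult differentiable_const)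
qed

lemma compactly_supportedD:
  assumes "compactly_supported f"
  obtains R where "0 < R" "\<And>x. R \<le> norm x \<Longrightarrow> f x = 0"
proof -
  have "bounded {x. f x \<noteq> 0}"
    using assms bounded_closure_image compact_imp_bounded bounded_subset closure_subset
    unfolding compactly_supported_def by metis
  then obtain R where R: "0 < R" "\<And>x. f x \<noteq> 0 \<Longrightarrow> norm x \<le> R"
    unfolding bounded_pos by auto
  show ?thesis
    by (rule that[of "R + 1"]) (use R in force)+
qed

lemma partials_eq_0_outside:
  assumes "\<And>x. R < norm x \<Longrightarrow> f x = 0" "R < norm x"
  shows "partials is f x = 0"
  using assms(2)
proof (induction "is" arbitrary: x)
  case (Cons i "is")
  have "((\<lambda>_. 0) has_derivative (\<lambda>_. 0 :: real)) (at x)" by simp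
  moreover have "open {y. R < norm y}" for y :: "real^2"
    by (intro open_Collect_less continuous_intros)
  ultimately have "(partials is f has_derivative (\<lambda>_. 0)) (at x)"
    by (rule has_derivative_transform_within_open) (use Cons in auto)
  then show ?case
    by (simp add: partials_Cons partial_deriv_eqI)
qed (use assms in auto)

lemma bounded_range_if_supported:
  fixes F :: "real^2 \<Rightarrow> real"
  assumes "continuous_on UNIV F" "\<And>x. R < norm x \<Longrightarrow> F x = 0"
  shows "bounded (range F)"
proof -
  have "compact (F ` cball 0 R)"
    by (intro compact_continuous_image continuous_on_subset[OF assms(1)]) auto
  moreover have "range F \<subseteq> insert 0 (F ` cball 0 R)"
    using assms(2) by (metis (no_types, lifting) image_eqI image_subsetI insertCI linorder_not_less mem_cball_0)
  ultimately show ?thesis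
    by (meson bounded_insert bounded_subset compact_imp_bounded)
qed

lemma compact_support_schwartz:
  assumes "smooth_fun f" "\<And>x. R < norm x \<Longrightarrow> f x = 0"
  shows "f \<in> schwartz"
proof -
  have "bounded (range (\<lambda>x. (1 + norm x) ^ N * partials is f x))" for N "is"
    by (rule bounded_range_if_supported[where R = R])
      (auto intro!: continuous_intros continuous_on_partials assms partials_eq_0_outside)
  then show ?thesis
    using assms by (simp add: schwartz_def)
qed

lemma schwartz_partial_deriv:
  assumes "f \<in> schwartz"
  shows "partial_deriv i f \<in> schwartz"
  using assms by (auto simp: schwartz_def smooth_fun_def partials_partial_deriv)

lemma schwartz_partials: "f \<in> schwartz \<Longrightarrow> partials is f \<in> schwartz"
  by (induction "is") (auto simp: partials_Cons schwartz_partial_deriv)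

section \<open>Mollifiers\<close>

lemma mollifier_alt: "mollifier h n x = (\<lambda>y. (real n)\<^sup>2 * h (real n *\<^sub>R (x - y)))"
  by (auto simp: mollifier_def)

lemma norm_le_of_scaled:
  fixes x y :: "'a::real_normed_vector"
  assumes "1 \<le> n" "norm (real n *\<^sub>R (x - y)) \<le> R"
  shows "norm y \<le> norm x + R"
proof -
  have "norm (x - y) \<le> real n * norm (x - y)"
    using assms(1) mult_right_mono[of 1 "real n" "norm (x - y)"] by simp
  then have "norm (x - y) \<le> R" using assms(2) by simp
  then show ?thesis
    using norm_triangle_ineq2[of y x] by (simp add: norm_minus_commute)
qed

lemma mollifier_schwartz:
  assumes "smooth_fun h" "compactly_supported h" "1 \<le> n"
  shows "mollifier h n x \<in> schwartz"
proof -
  obtain R where R: "\<And>x. R \<le> norm x \<Longrightarrow> h x = 0"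
    using compactly_supportedD[OF assms(2)] by metis
  show ?thesis
    unfolding mollifier_alt
  proof (rule compact_support_schwartz[where R = "norm x + R"])
    fix y :: "real^2" assume "norm x + R < norm y"
    then have "R \<le> norm (real n *\<^sub>R (x - y))"
      using norm_le_of_scaled[OF assms(3), of x y R] by argo
    then show "(real n)\<^sup>2 * h (real n *\<^sub>R (x - y)) = 0" by (simp add: R)
  qed (rule smooth_fun_affine assms)+
qed

lemma temperedD:
  assumes "\<phi> \<in> tempered" "f \<in> schwartz" "g \<in> schwartz"
  shows "\<phi> (\<lambda>x. a * f x + b * g x) = a * \<phi> f + b * \<phi> g"
  using assms by (auto simp: tempered_def algebraic_dual_def)

lemma tempered_diff:
  assumes "\<phi> \<in> tempered" "f \<in> schwartz" "g \<in> schwartz"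
  shows "\<phi> (\<lambda>x. f x - g x) = \<phi> f - \<phi> g"
  using temperedD[OF assms, of 1 "-1"] by simp

lemma tempered_scale:
  assumes "\<phi> \<in> tempered" "f \<in> schwartz"
  shows "\<phi> (\<lambda>x. a * f x) = a * \<phi> f"
  using temperedD[OF assms assms(2), of a 0] by simp

lemma tempered_add:
  assumes "\<phi> \<in> tempered" "f \<in> schwartz" "g \<in> schwartz"
  shows "\<phi> (\<lambda>x. f x + g x) = \<phi> f + \<phi> g"
  using temperedD[OF assms, of 1 1] by simp

text \<open>Translation is continuous in every Schwartz seminorm: the derivatives of the mollifier
  are uniformly continuous, and the weights are bounded on the common support of nearby
  translates.\<close>

lemma schwartz_norm_mollifier_tendsto:
  fixes x0 :: "real^2"
  assumes "smooth_fun h" "compactly_supported h" "1 \<le> n"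
  shows "((\<lambda>x. schwartz_norm N (\<lambda>y. mollifier h n x y - mollifier h n x0 y)) \<longlongrightarrow> 0) (at x0)"
proof -
  obtain R where R: "0 < R" "\<And>x. R \<le> norm x \<Longrightarrow> h x = 0"
    using compactly_supportedD[OF assms(2)] by metis
  have zero: "partials is h x = 0" if "R < norm x" for "is" x
    by (rule partials_eq_0_outside[OF _ that]) (use R in auto)
  \<comment> \<open>A bound of the weight on the support of every mollifier whose centre is within distance
    one of \<open>x0\<close>.\<close>
  define W where "W = (1 + (norm x0 + 1 + R)) ^ N"
  have "W > 0" unfolding W_def using R by (intro zero_less_power) (smt (verit) norm_ge_zero)
  have one: "((\<lambda>x. SUP y. (1 + norm y) ^ N * \<bar>partials is (\<lambda>y. mollifier h n x y - mollifier h n x0 y) y\<bar>) \<longlongrightarrow> 0) (at x0)"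
    for "is" :: "2 list"
  proof -
    define Q where "Q = partials is h"
    define c where "c = (real n)\<^sup>2 * (- real n) ^ length is"
    have cQ: "continuous_on UNIV Q" unfolding Q_def by (rule continuous_on_partials[OF assms(1)])
    have eq: "partials is (\<lambda>y. mollifier h n x y - mollifier h n x0 y) y
        = c * (Q (real n *\<^sub>R (x - y)) - Q (real n *\<^sub>R (x0 - y)))" for x y
    proof -
      have "partials is (\<lambda>y. 1 * mollifier h n x y + (- 1) * mollifier h n x0 y) y
        = 1 * partials is (mollifier h n x) y + (- 1) * partials is (mollifier h n x0) y"
        by (subst partials_linear) (auto intro: schwartz_smooth mollifier_schwartz assms)
      then show ?thesis
        unfolding mollifier_alt partials_affine[OF assms(1)] Q_def c_def by (simp add: algebra_simps)
    qed
    have uc: "uniformly_continuous_on UNIV Q"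
    proof -
      have "uniformly_continuous_on (cball 0 (R+2)) Q"
        by (intro compact_uniformly_continuous continuous_on_subset[OF cQ]) auto
      show ?thesis
        unfolding uniformly_continuous_on_def
      proof (intro allI impI)
        fix e :: real assume "0 < e"
        then obtain d where d: "d > 0" "\<And>x x'. x \<in> cball 0 (R+2) \<Longrightarrow> x' \<in> cball 0 (R+2) \<Longrightarrow> dist x' x < d \<Longrightarrow> dist (Q x') (Q x) < e"
          using \<open>uniformly_continuous_on (cball 0 (R+2)) Q\<close> unfolding uniformly_continuous_on_def by metis
        show "\<exists>d>0. \<forall>x\<in>UNIV. \<forall>x'\<in>UNIV. dist x' x < d \<longrightarrow> dist (Q x') (Q x) < e"
        proof (intro exI[of _ "min d 1"] conjI ballI impI)
          fix x x' :: "real^2" assume dd: "dist x' x < min d 1"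
          show "dist (Q x') (Q x) < e"
          proof (cases "x \<in> cball 0 (R+2) \<and> x' \<in> cball 0 (R+2)")
            case True then show ?thesis using d dd by auto
          next
            case False
            have "\<bar>norm x' - norm x\<bar> < 1" using dd norm_triangle_ineq3[of x' x] by (simp add: dist_norm)
            then have "Q x = 0" "Q x' = 0" using False by (auto simp: Q_def intro!: zero)
            then show ?thesis using \<open>0 < e\<close> by simp
          qed
        qed (use d in auto)
      qed
    qed
    show ?thesis
      unfolding tendsto_iff eventually_at
    proof (intro allI impI)
      fix e :: real assume e: "0 < e"
      define e' where "e' = e / (2 * W * (\<bar>c\<bar> + 1))"
      have "e' > 0" using e \<open>W > 0\<close> unfolding e'_def by auto
      then obtain d where d: "d > 0" "\<And>x x'. dist x' x < d \<Longrightarrow> dist (Q x') (Q x) < e'"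
        using uc unfolding uniformly_continuous_on_def by auto
      show "\<exists>d>0. \<forall>x\<in>UNIV. x \<noteq> x0 \<and> dist x x0 < d \<longrightarrow>
        dist (SUP y. (1 + norm y) ^ N * \<bar>partials is (\<lambda>y. mollifier h n x y - mollifier h n x0 y) y\<bar>) 0 < e"
      proof (intro exI[of _ "min 1 (d / real n)"] conjI ballI impI; (elim conjE)?)
        fix x assume x: "dist x x0 < min 1 (d / real n)"
        have bd: "(1 + norm y) ^ N * \<bar>c * (Q (real n *\<^sub>R (x - y)) - Q (real n *\<^sub>R (x0 - y)))\<bar> \<le> e / 2" for y :: "real^2"
        proof (cases "norm y \<le> norm x0 + 1 + R")
          case True
          have "dist (real n *\<^sub>R (x - y)) (real n *\<^sub>R (x0 - y)) = real n * dist x x0"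
            by (simp add: dist_norm flip: scaleR_diff_right)
          also have "\<dots> < d" using x assms(3) by (simp add: pos_less_divide_eq mult.commute)
          finally have "\<bar>Q (real n *\<^sub>R (x - y)) - Q (real n *\<^sub>R (x0 - y))\<bar> \<le> e'"
            using d(2) by (metis dist_real_def less_eq_real_def)
          moreover have "(1 + norm y) ^ N \<le> W"
            unfolding W_def by (intro power_mono) (use True in auto)
          ultimately have "(1 + norm y) ^ N * (\<bar>c\<bar> * \<bar>Q (real n *\<^sub>R (x - y)) - Q (real n *\<^sub>R (x0 - y))\<bar>) \<le> W * ((\<bar>c\<bar> + 1) * e')"
            using \<open>W > 0\<close> by (intro mult_mono) auto
          also have "\<dots> = e / 2"
          proof -
            have "\<bar>c\<bar> + 1 \<noteq> 0" by linarith
            then show ?thesis using \<open>W > 0\<close> by (simp add: e'_def)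
          qed
          finally show ?thesis by (simp add: abs_mult)
        next
          case False
          have "norm x \<le> norm x0 + 1" using x norm_triangle_ineq2[of x x0] by (simp add: dist_norm)
          have "R < norm (real n *\<^sub>R (x - y))"
            using norm_le_of_scaled[OF assms(3), of x y R] False \<open>norm x \<le> norm x0 + 1\<close> by linarith
          moreover have "R < norm (real n *\<^sub>R (x0 - y))"
            using norm_le_of_scaled[OF assms(3), of x0 y R] False by linarith
          ultimately show ?thesis using zero e unfolding Q_def by simp
        qed
        let ?S = "SUP y. (1 + norm y) ^ N * \<bar>partials is (\<lambda>y. mollifier h n x y - mollifier h n x0 y) y\<bar>"
        have "?S \<le> e / 2"
          unfolding eq by (intro cSUP_least bd) auto
        moreover have "0 \<le> ?S"
          unfolding eq by (rule cSUP_upper2[where x = 0, OF bdd_aboveI2[OF bd]]) auto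
        ultimately show "dist ?S 0 < e" using e by simp
      qed (use d assms in auto)
    qed
  qed
  have "((\<lambda>x. schwartz_norm N (\<lambda>y. mollifier h n x y - mollifier h n x0 y)) \<longlongrightarrow> (\<Sum>is\<in>{is::2 list. length is \<le> N}. 0)) (at x0)"
    unfolding schwartz_norm_def by (intro tendsto_sum one)
  then show ?thesis by simp
qed

lemma continuous_on_tempered_mollifier:
  assumes "smooth_fun h" "compactly_supported h" "1 \<le> n" "\<phi> \<in> tempered"
  shows "continuous_on UNIV (\<lambda>x. \<phi> (mollifier h n x))"
proof -
  obtain N and C :: real where NC: "\<And>f. f \<in> schwartz \<Longrightarrow> \<bar>\<phi> f\<bar> \<le> C * schwartz_norm N f"
    using assms(4) by (auto simp: tempered_def)
  have "((\<lambda>x. \<phi> (mollifier h n x)) \<longlongrightarrow> \<phi> (mollifier h n x0)) (at x0)" for x0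
  proof (rule LIM_zero_cancel)
    have "\<forall>\<^sub>F x in at x0. norm (\<phi> (mollifier h n x) - \<phi> (mollifier h n x0))
      \<le> C * schwartz_norm N (\<lambda>y. mollifier h n x y - mollifier h n x0 y)"
    proof (intro always_eventually allI)
      fix x
      have "(\<lambda>y. mollifier h n x y - mollifier h n x0 y) \<in> schwartz"
        using schwartz_linear[OF mollifier_schwartz[OF assms(1-3), of x] mollifier_schwartz[OF assms(1-3), of x0], of 1 "-1"]
        by simp
      from NC[OF this] show "norm (\<phi> (mollifier h n x) - \<phi> (mollifier h n x0))
          \<le> C * schwartz_norm N (\<lambda>y. mollifier h n x y - mollifier h n x0 y)"
        using tempered_diff[OF assms(4) mollifier_schwartz[OF assms(1-3), of x] mollifier_schwartz[OF assms(1-3), of x0]]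
        by simp
    qed
    moreover have "((\<lambda>x. C * schwartz_norm N (\<lambda>y. mollifier h n x y - mollifier h n x0 y)) \<longlongrightarrow> 0) (at x0)"
      by (rule tendsto_mult_right_zero, rule schwartz_norm_mollifier_tendsto[OF assms(1-3)])
    ultimately show "((\<lambda>x. \<phi> (mollifier h n x) - \<phi> (mollifier h n x0)) \<longlongrightarrow> 0) (at x0)"
      by (rule Lim_null_comparison)
  qed
  then show ?thesis
    by (simp add: continuous_on)
qed

section \<open>The covariance as a quadratic form\<close>

definition helmholtz :: "(real^2 \<Rightarrow> real) \<Rightarrow> real^2 \<Rightarrow> real" where
  "helmholtz u = (\<lambda>x. - laplacian u x + u x)"

lemma helmholtz_linear:
  assumes "u \<in> schwartz" "w \<in> schwartz"
  shows "helmholtz (\<lambda>x. a * u x + b * w x) = (\<lambda>x. a * helmholtz u x + b * helmholtz w x)"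
  using assms
  by (auto simp: helmholtz_def laplacian_def partials_linear schwartz_smooth sum.distrib
      sum_distrib_left algebra_simps)

lemma helmholtz_schwartz:
  assumes "u \<in> schwartz"
  shows "helmholtz u \<in> schwartz"
proof -
  have eq: "helmholtz u = (\<lambda>x. (-1) * (1 * partials [1, 1] u x + 1 * partials [2, 2] u x) + 1 * u x)"
    by (auto simp: helmholtz_def laplacian_def sum_2)
  show ?thesis
    unfolding eq by (intro schwartz_linear schwartz_partials assms)
qed

lemma has_real_derivative_along_axis:
  fixes F :: "real^2 \<Rightarrow> real"
  assumes "smooth_fun u"
  shows "((\<lambda>t. partials is u (x + t *\<^sub>R axis i 1)) has_real_derivative
    partials (i # is) u (x + t *\<^sub>R axis i 1)) (at t)"
proof -
  let ?y = "x + t *\<^sub>R axis i 1"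
  have "((\<lambda>t. partials is u (x + t *\<^sub>R axis i 1)) has_derivative
      (\<lambda>s. frechet_derivative (partials is u) (at ?y) (0 + s *\<^sub>R axis i 1))) (at t)"
    by (rule has_derivative_compose[of "\<lambda>t. x + t *\<^sub>R axis i 1"])
      (intro derivative_intros smooth_fun_has_derivative assms)+
  moreover have "(\<lambda>s. frechet_derivative (partials is u) (at ?y) (0 + s *\<^sub>R axis i 1))
      = (*) (partials (i # is) u ?y)"
    using linear_scale[OF linear_frechet_derivative[OF smooth_funD[OF assms]]]
    by (auto simp: partials_Cons partial_deriv_def fun_eq_iff)
  ultimately show ?thesis
    by (simp add: has_field_derivative_def)
qed

text \<open>The second derivative test on a line parallel to an axis.\<close>

lemma partials_twice_le_0_at_max:
  assumes "smooth_fun u" "\<And>y. u y \<le> u x"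
  shows "partials [i, i] u x \<le> 0"
proof (rule ccontr)
  assume "\<not> partials [i, i] u x \<le> 0"
  then have pos: "partials [i, i] u x > 0" by simp
  let ?y = "\<lambda>t. x + t *\<^sub>R axis i 1"
  have D1: "((\<lambda>t. u (?y t)) has_real_derivative partials [i] u (?y t)) (at t)" for t
    using has_real_derivative_along_axis[OF assms(1), of "[]" x i t] by simp
  have D2: "((\<lambda>t. partials [i] u (?y t)) has_real_derivative partials [i, i] u (?y t)) (at t)" for t
    using has_real_derivative_along_axis[OF assms(1), of "[i]" x i t] by simp
  have zero: "partials [i] u (?y 0) = 0"
    using DERIV_local_max[OF D1[of 0], of 1] assms(2) by simp
  obtain d where d: "d > 0" "\<And>t. 0 < t \<Longrightarrow> t < d \<Longrightarrow> partials [i] u (?y 0) < partials [i] u (?y t)"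
    using DERIV_pos_inc_right[OF D2[of 0]] pos by auto
  have "\<exists>z>0. z < d/2 \<and> u (?y (d/2)) - u (?y 0) = (d/2 - 0) * partials [i] u (?y z)"
    using d D1 by (intro MVT2) auto
  then obtain z where "0 < z" "z < d/2" "u (?y (d/2)) - u (?y 0) = d/2 * partials [i] u (?y z)"
    by auto
  moreover have "partials [i] u (?y z) > 0"
    using d(2)[of z] zero \<open>0 < z\<close> \<open>z < d/2\<close> by auto
  ultimately have "u (?y (d/2)) > u (?y 0)" using d(1)
    by (smt (verit) mult_pos_pos half_gt_zero)
  then show False using assms(2)[of "?y (d/2)"] by simp
qed

text \<open>Outside of a large ball a Schwartz function stays below its given positive value, so the
  maximum over the ball is global.\<close>

lemma schwartz_attains_max:
  assumes "u \<in> schwartz" "u x > 0"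
  obtains x0 where "\<And>y. u y \<le> u x0"
proof -
  have "bounded (range (\<lambda>x. (1 + norm x) ^ 1 * partials [] u x))"
    using assms(1) unfolding schwartz_def by blast
  then obtain B where B: "\<And>y. \<bar>(1 + norm y) * u y\<bar> \<le> B"
    unfolding bounded_iff by auto
  define R where "R = B / u x + norm x"
  have "B \<ge> 0" using B[of x] by linarith
  have out: "u y \<le> u x" if "norm y > R" for y
  proof (rule ccontr)
    assume "\<not> u y \<le> u x"
    then have "(1 + norm y) * u x \<le> (1 + norm y) * u y" by (intro mult_left_mono) auto
    also have "\<dots> \<le> B" using B[of y] by linarith
    finally have "norm y * u x \<le> B" using assms(2) by (simp add: algebra_simps)
    then have "norm y \<le> B / u x" using assms(2) by (simp add: field_simps)
    then show False using that norm_ge_zero[of x] unfolding R_def by linarith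
  qed
  have "x \<in> cball 0 R" using assms(2) \<open>B \<ge> 0\<close> by (simp add: R_def)
  then obtain x0 where x0: "x0 \<in> cball 0 R" "\<And>y. y \<in> cball 0 R \<Longrightarrow> u y \<le> u x0"
    using continuous_attains_sup[of "cball 0 R" u] schwartz_continuous_on[OF assms(1), of "cball 0 R"]
      compact_cball[of 0 R] by blast
  show ?thesis
  proof (rule that)
    fix y show "u y \<le> u x0"
      using x0(2)[of y] x0(2)[OF \<open>x \<in> cball 0 R\<close>] out[of y] by (cases "norm y \<le> R") auto
  qed
qed

text \<open>The maximum principle: at a positive maximum the Laplacian is nonpositive, so a Schwartz
  function in the kernel of \<open>helmholtz\<close> has no positive value; neither has its negative.\<close>

lemma helmholtz_kernel:
  assumes "u \<in> schwartz" "helmholtz u = (\<lambda>x. 0)"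
  shows "u = (\<lambda>x. 0)"
proof -
  have le: "w x \<le> 0" if w: "w \<in> schwartz" "helmholtz w = (\<lambda>x. 0)" for w x
  proof (rule ccontr)
    assume "\<not> w x \<le> 0"
    then obtain x0 where x0: "\<And>y. w y \<le> w x0" using schwartz_attains_max[OF w(1), of x] by auto
    have "laplacian w x0 \<le> 0" unfolding laplacian_def
      by (intro sum_nonpos partials_twice_le_0_at_max schwartz_smooth w x0)
    moreover have "laplacian w x0 = w x0"
      using fun_cong[OF w(2), of x0] by (simp add: helmholtz_def)
    ultimately show False using x0[of x] \<open>\<not> w x \<le> 0\<close> by linarith
  qed
  have "(\<lambda>x. (-1) * u x + 0 * u x) \<in> schwartz" "helmholtz (\<lambda>x. (-1) * u x + 0 * u x) = (\<lambda>x. 0)"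
    using assms schwartz_linear[of u u "-1" 0] helmholtz_linear[of u u "-1" 0] by auto
  note neg = this
  have "u x = 0" for x
    using le[OF neg, of x] le[OF assms, of x] by simp
  then show ?thesis by blast
qed

lemma inj_on_helmholtz: "inj_on helmholtz schwartz"
proof (rule inj_onI)
  fix u w assume uw: "u \<in> schwartz" "w \<in> schwartz" "helmholtz u = helmholtz w"
  have "(\<lambda>x. 1 * u x + (-1) * w x) = (\<lambda>x. 0)"
  proof (rule helmholtz_kernel)
    show "(\<lambda>x. 1 * u x + (-1) * w x) \<in> schwartz" by (rule schwartz_linear[OF uw(1,2)])
    show "helmholtz (\<lambda>x. 1 * u x + (-1) * w x) = (\<lambda>x. 0)"
      unfolding helmholtz_linear[OF uw(1,2)] by (simp add: uw(3))
  qed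
  then have "1 * u x + (-1) * w x = 0" for x by meson
  then show "u = w" by (simp add: fun_eq_iff)
qed

lemma resolvent_alt: "resolvent = the_inv_into schwartz helmholtz"
  unfolding resolvent_def helmholtz_def ..

lemma resolvent_helmholtz: "u \<in> schwartz \<Longrightarrow> resolvent (helmholtz u) = u"
  unfolding resolvent_alt by (rule the_inv_into_f_f[OF inj_on_helmholtz])

lemma resolvent_linear:
  assumes "f \<in> helmholtz ` schwartz" "g \<in> helmholtz ` schwartz"
  shows "resolvent (\<lambda>x. a * f x + b * g x) = (\<lambda>x. a * resolvent f x + b * resolvent g x)"
    and "(\<lambda>x. a * f x + b * g x) \<in> helmholtz ` schwartz"
proof -
  obtain u w where uw: "u \<in> schwartz" "f = helmholtz u" "w \<in> schwartz" "g = helmholtz w"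
    using assms by blast
  let ?v = "\<lambda>x. a * u x + b * w x"
  have v: "?v \<in> schwartz" "(\<lambda>x. a * f x + b * g x) = helmholtz ?v"
    using uw by (simp_all add: schwartz_linear helmholtz_linear)
  then show "(\<lambda>x. a * f x + b * g x) \<in> helmholtz ` schwartz" by blast
  show "resolvent (\<lambda>x. a * f x + b * g x) = (\<lambda>x. a * resolvent f x + b * resolvent g x)"
    unfolding v(2) resolvent_helmholtz[OF v(1)] using uw by (simp add: resolvent_helmholtz)
qed

lemma Cov_scale_range:
  assumes "f \<in> helmholtz ` schwartz"
  shows "Cov (\<lambda>x. t * f x) (\<lambda>x. t * f x) = t\<^sup>2 * Cov f f"
proof -
  have "resolvent (\<lambda>x. t * f x) = (\<lambda>x. t * resolvent f x)"
    using resolvent_linear(1)[OF assms assms, of t 0] by simp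
  then have "Cov (\<lambda>x. t * f x) (\<lambda>x. t * f x) = (LINT x|lborel. t\<^sup>2 * (f x * resolvent f x))"
    by (simp add: Cov_def power2_eq_square mult_ac)
  then show ?thesis by (simp add: Cov_def)
qed

lemma not_range_scale:
  assumes "f \<notin> helmholtz ` schwartz" "t \<noteq> 0"
  shows "(\<lambda>x. t * f x) \<notin> helmholtz ` schwartz"
  using resolvent_linear(2)[of "\<lambda>x. t * f x" "\<lambda>x. t * f x" "1/t" 0] assms by auto

text \<open>Off the range \<open>resolvent\<close> is a definite description without a solution and hence always the same
  function; \<open>Cov\<close> is therefore linear rather than quadratic along rays there.\<close>

lemma Cov_scale_not_range:
  assumes "f \<notin> helmholtz ` schwartz" "t \<noteq> 0"
  shows "Cov (\<lambda>x. t * f x) (\<lambda>x. t * f x) = t * Cov f f"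
proof -
  have R: "resolvent f' = (THE u. False)" if "f' \<notin> helmholtz ` schwartz" for f'
  proof -
    have "(\<lambda>u. u \<in> schwartz \<and> helmholtz u = f') = (\<lambda>u. False)" using that by auto
    then show ?thesis by (simp add: resolvent_alt the_inv_into_def)
  qed
  show ?thesis
    using R[OF assms(1)] R[OF not_range_scale[OF assms]] by (simp add: Cov_def mult.assoc)
qed

section \<open>The free field is Gaussian\<close>

lemma free_field_prob: "free_field_measure \<mu> \<Longrightarrow> prob_space \<mu>"
  by (simp add: free_field_measure_def)

lemma evaluation_generators:
  "{{\<psi>\<in>X. \<psi> f \<in> B} | f B. f \<in> W \<and> B \<in> sets borel} \<subseteq> Pow X"
  by auto

lemma measurable_evaluation:
  assumes "f \<in> W"
  shows "(\<lambda>\<psi>. \<psi> f) \<in> borel_measurable (evaluation_algebra W X)"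
proof (rule measurableI)
  fix B :: "real set" assume "B \<in> sets borel"
  have sp: "space (evaluation_algebra W X) = X"
    by (simp add: evaluation_algebra_def space_measure_of[OF evaluation_generators])
  have "{\<psi>\<in>X. \<psi> f \<in> B} \<in> sets (evaluation_algebra W X)"
    unfolding evaluation_algebra_def sets_measure_of[OF evaluation_generators]
    by (rule sigma_sets.Basic) (use assms \<open>B \<in> sets borel\<close> in auto)
  moreover have "(\<lambda>\<psi>. \<psi> f) -` B \<inter> space (evaluation_algebra W X) = {\<psi>\<in>X. \<psi> f \<in> B}"
    using sp by auto
  ultimately show "(\<lambda>\<psi>. \<psi> f) -` B \<inter> space (evaluation_algebra W X) \<in> sets (evaluation_algebra W X)"
    by simp
qed auto

lemma space_evaluation_algebra: "space (evaluation_algebra W X) = X"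
  by (simp add: evaluation_algebra_def space_measure_of[OF evaluation_generators])

lemma free_field_space:
  assumes "free_field_measure \<mu>"
  shows "space \<mu> = tempered"
  using assms sets_eq_imp_space_eq[of \<mu> "evaluation_algebra schwartz tempered"]
  by (simp add: free_field_measure_def space_evaluation_algebra)

lemma free_field_measurable:
  assumes "free_field_measure \<mu>" "f \<in> schwartz"
  shows "(\<lambda>\<phi>. \<phi> f) \<in> borel_measurable \<mu>"
proof -
  have "sets \<mu> = sets (evaluation_algebra schwartz tempered)"
    using assms(1) by (simp add: free_field_measure_def)
  from measurable_cong_sets[OF this refl] measurable_evaluation[OF assms(2)]
  show ?thesis by blast
qed

text \<open>A characteristic function is bounded by one.\<close>

lemma free_field_Cov_nonneg:
  assumes "free_field_measure \<mu>" "f \<in> schwartz"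
  shows "0 \<le> Cov f f"
proof -
  interpret prob_space \<mu> using assms free_field_prob by blast
  have "norm (CLINT \<phi>|\<mu>. exp (\<i> * complex_of_real (\<phi> f))) \<le> (LINT \<phi>|\<mu>. norm (exp (\<i> * complex_of_real (\<phi> f))))"
    by (rule integral_norm_bound)
  also have "\<dots> = 1" by (simp add: prob_space)
  finally have "exp (- (1/2) * Cov f f) \<le> 1"
    using assms by (simp add: free_field_measure_def)
  then show ?thesis by simp
qed

text \<open>The function \<open>1 - cos (\<phi> f)\<close> is nonnegative and has expectation zero.\<close>

lemma free_field_Cov_0_AE:
  assumes mu: "free_field_measure \<mu>" and f: "f \<in> schwartz" and "Cov f f = 0"
  shows "AE \<phi> in \<mu>. exp (\<i> * complex_of_real (\<phi> f)) = 1"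
proof -
  interpret prob_space \<mu> using mu free_field_prob by blast
  note [measurable] = free_field_measurable[OF mu f]
  have "(CLINT \<phi>|\<mu>. exp (\<i> * complex_of_real (\<phi> f))) = 1"
    using assms by (simp add: free_field_measure_def)
  moreover have int: "integrable \<mu> (\<lambda>\<phi>. exp (\<i> * complex_of_real (\<phi> f)))"
    by (rule integrable_const_bound[where B = 1]) auto
  ultimately have "(LINT \<phi>|\<mu>. Re (exp (\<i> * complex_of_real (\<phi> f)))) = 1"
    by (subst integral_Re) auto
  then have "(LINT \<phi>|\<mu>. 1 - cos (\<phi> f)) = 0"
    using integrable_Re[OF int] by (subst Bochner_Integration.integral_diff) (auto simp: Re_exp prob_space)
  moreover have "integrable \<mu> (\<lambda>\<phi>. 1 - cos (\<phi> f))"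
    using integrable_Re[OF int] by (auto simp: Re_exp)
  ultimately have "AE \<phi> in \<mu>. 1 - cos (\<phi> f) = 0"
    by (subst (asm) integral_nonneg_eq_0_iff_AE) auto
  then show ?thesis
  proof eventually_elim
    case (elim \<phi>)
    then have "cos (\<phi> f) = 1" by simp
    moreover from this have "sin (\<phi> f) = 0" using cos_one_sin_zero by blast
    ultimately show ?case by (simp add: complex_eq_iff Re_exp Im_exp)
  qed
qed

text \<open>If \<open>f0\<close> is not in the range of \<open>helmholtz\<close>, then neither is \<open>f0 + f\<close> for any \<open>f\<close> in the range.
  Off the range \<open>Cov\<close> is linear along rays and nonnegative, hence zero, so that
  \<open>exp (\<i> * \<phi> f0)\<close> and \<open>exp (\<i> * \<phi> (f0 + f))\<close> are both one almost surely, and so is their quotient.\<close>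

lemma free_field_degenerate:
  assumes mu: "free_field_measure \<mu>" and f0: "f0 \<in> schwartz" "f0 \<notin> helmholtz ` schwartz"
    and f: "f \<in> schwartz"
  shows "Cov f f = 0"
proof -
  interpret prob_space \<mu> using mu free_field_prob by blast
  have off: "Cov f f = 0" if "f \<in> schwartz" "f \<notin> helmholtz ` schwartz" for f
    using Cov_scale_not_range[OF that(2), of "-1"] free_field_Cov_nonneg[OF mu that(1)]
      free_field_Cov_nonneg[OF mu schwartz_scale[OF that(1), of "-1"]] by simp
  show ?thesis
  proof (cases "f \<in> helmholtz ` schwartz")
    case True
    have sum: "(\<lambda>x. f x + f0 x) \<in> schwartz" using f f0 by (simp add: schwartz_add)
    have "(\<lambda>x. f x + f0 x) \<notin> helmholtz ` schwartz"
      using resolvent_linear(2)[OF _ True, of "\<lambda>x. f x + f0 x" 1 "-1"] f0 by auto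
    note z = free_field_Cov_0_AE[OF mu f0(1) off[OF f0]] free_field_Cov_0_AE[OF mu sum off[OF sum this]]
    have "AE \<phi> in \<mu>. exp (\<i> * complex_of_real (\<phi> f)) = 1"
      using z AE_space
    proof eventually_elim
      case (elim \<phi>)
      then have "\<phi> (\<lambda>x. f x + f0 x) = \<phi> f + \<phi> f0"
        using tempered_add f f0 free_field_space[OF mu] by auto
      then show ?case using elim by (simp add: distrib_left exp_add)
    qed
    note [measurable] = free_field_measurable[OF mu f]
    have "(CLINT \<phi>|\<mu>. exp (\<i> * complex_of_real (\<phi> f))) = (CLINT \<phi>|\<mu>. 1)"
      using \<open>AE \<phi> in \<mu>. exp (\<i> * complex_of_real (\<phi> f)) = 1\<close> by (intro integral_cong_AE) auto
    then have "complex_of_real (exp (- (1/2) * Cov f f)) = 1"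
      using mu f by (simp add: free_field_measure_def prob_space)
    then have "exp (- (1/2) * Cov f f) = 1" using of_real_eq_1_iff by blast
    then show ?thesis by simp
  qed (use off f in auto)
qed

lemma Cov_scale:
  assumes mu: "free_field_measure \<mu>" and f: "f \<in> schwartz"
  shows "Cov (\<lambda>x. t * f x) (\<lambda>x. t * f x) = t\<^sup>2 * Cov f f"
proof (cases "f \<in> helmholtz ` schwartz")
  case False
  then show ?thesis
    using free_field_degenerate[OF mu f False] f by (simp add: schwartz_scale)
qed (rule Cov_scale_range)

text \<open>All laws of \<open>\<phi> f\<close> come out of one formula, the degenerate one included, by scaling a
  standard normal variable.\<close>

lemma free_field_distr:
  assumes mu: "free_field_measure \<mu>" and f: "f \<in> schwartz"
  shows "distr \<mu> borel (\<lambda>\<phi>. \<phi> f) = distr std_normal_distribution borel (\<lambda>z. sqrt (Cov f f) * z)"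
proof (rule Levy_uniqueness)
  interpret prob_space \<mu> using mu free_field_prob by blast
  interpret N: prob_space std_normal_distribution by (rule prob_space_normal_density) simp
  note [measurable] = free_field_measurable[OF mu f]
  have Y: "(\<lambda>z. sqrt (Cov f f) * z) \<in> borel_measurable std_normal_distribution" by simp
  show "real_distribution (distr \<mu> borel (\<lambda>\<phi>. \<phi> f))"
    by (rule real_distribution_distr[OF free_field_measurable[OF mu f]])
  show "real_distribution (distr std_normal_distribution borel (\<lambda>z. sqrt (Cov f f) * z))"
    by (rule N.real_distribution_distr[OF Y])
  show "char (distr \<mu> borel (\<lambda>\<phi>. \<phi> f)) = char (distr std_normal_distribution borel (\<lambda>z. sqrt (Cov f f) * z))"
  proof
    fix t
    have "char (distr \<mu> borel (\<lambda>\<phi>. \<phi> f)) t = (CLINT \<phi>|\<mu>. exp (\<i> * complex_of_real (t * \<phi> f)))"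
      unfolding char_def by (subst integral_distr[OF free_field_measurable[OF mu f]]) auto
    also have "\<dots> = (CLINT \<phi>|\<mu>. exp (\<i> * complex_of_real (\<phi> (\<lambda>x. t * f x))))"
      by (intro Bochner_Integration.integral_cong) (auto simp: free_field_space[OF mu] tempered_scale f)
    also have "\<dots> = complex_of_real (exp (- (1/2) * (t\<^sup>2 * Cov f f)))"
      using mu f by (simp add: free_field_measure_def schwartz_scale Cov_scale[OF mu f])
    also have "t\<^sup>2 * Cov f f = (t * sqrt (Cov f f))\<^sup>2"
      using free_field_Cov_nonneg[OF mu f] by (simp add: power_mult_distrib)
    also have "complex_of_real (exp (- (1/2) * (t * sqrt (Cov f f))\<^sup>2)) = char std_normal_distribution (t * sqrt (Cov f f))"
      by (simp add: char_std_normal_distribution)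
    also have "\<dots> = char (distr std_normal_distribution borel (\<lambda>z. sqrt (Cov f f) * z)) t"
      unfolding char_def by (subst integral_distr) (auto simp: mult_ac)
    finally show "char (distr \<mu> borel (\<lambda>\<phi>. \<phi> f)) t = char (distr std_normal_distribution borel (\<lambda>z. sqrt (Cov f f) * z)) t" .
  qed
qed

text \<open>Completing the square turns the integrand into a shifted normal density.\<close>

lemma std_normal_exp:
  "has_bochner_integral std_normal_distribution (\<lambda>z. exp (s * z)) (exp (s\<^sup>2 / 2))"
proof -
  have eq: "std_normal_density z * exp (s * z) = exp (s\<^sup>2 / 2) * normal_density s 1 z" for z
    by (simp add: std_normal_density_def normal_density_def mult_exp_exp power2_eq_square field_simps)
  have "has_bochner_integral lborel (\<lambda>z. exp (s\<^sup>2 / 2) * normal_density s 1 z) (exp (s\<^sup>2 / 2) * 1)"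
    by (intro has_bochner_integral_mult_right)
      (simp add: has_bochner_integral_iff)
  then show ?thesis
    by (subst has_bochner_integral_density) (auto simp: eq)
qed

lemma free_field_exp:
  assumes mu: "free_field_measure \<mu>" and f: "f \<in> schwartz"
  shows "has_bochner_integral \<mu> (\<lambda>\<phi>. exp (s * \<phi> f)) (exp (s\<^sup>2 * Cov f f / 2))"
proof -
  note [measurable] = free_field_measurable[OF mu f]
  have "has_bochner_integral std_normal_distribution (\<lambda>z. exp ((s * sqrt (Cov f f)) * z)) (exp ((s * sqrt (Cov f f))\<^sup>2 / 2))"
    by (rule std_normal_exp)
  then have "has_bochner_integral (distr std_normal_distribution borel (\<lambda>z. sqrt (Cov f f) * z)) (\<lambda>x. exp (s * x)) (exp (s\<^sup>2 * Cov f f / 2))"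
    using free_field_Cov_nonneg[OF mu f]
    by (subst has_bochner_integral_distr) (auto simp: mult_ac power_mult_distrib)
  then have "has_bochner_integral (distr \<mu> borel (\<lambda>\<phi>. \<phi> f)) (\<lambda>x. exp (s * x)) (exp (s\<^sup>2 * Cov f f / 2))"
    unfolding free_field_distr[OF mu f] .
  then show ?thesis
    by (simp add: has_bochner_integral_iff integrable_distr_eq integral_distr)
qed

section \<open>Wick powers\<close>

text \<open>The coefficients are those of the Cauchy product of the series of \<open>exp (s * t)\<close> and of
  \<open>exp (- s\<^sup>2 * c / 2)\<close>; the latter contains only even powers of \<open>s\<close>.\<close>

lemma wick_generating_function:
  "(\<lambda>k. s ^ k / fact k * wick k c t) sums exp (s * t - s\<^sup>2 * c / 2)"
proof -
  define a where "a i = (s * t) ^ i / fact i" for i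
  \<comment> \<open>The series of \<open>exp (- s\<^sup>2 * c / 2)\<close> as a power series in \<open>s\<close>, with zeros at odd positions.\<close>
  define b where "b m = (if even m then (- s\<^sup>2 * c / 2) ^ (m div 2) / fact (m div 2) else 0)" for m
  have a: "a sums exp (s * t)"
    using exp_converges[of "s * t"] by (simp add: a_def[abs_def] divide_inverse mult.commute)
  have a': "summable (\<lambda>i. norm (a i))"
    using summable_norm_exp[of "s * t"] by (simp add: a_def[abs_def] divide_inverse mult.commute)
  have e: "(\<lambda>m. x ^ m / fact m) sums exp x" for x :: real
    using exp_converges[of x] by (simp add: divide_inverse mult.commute)
  have b: "b sums exp (- s\<^sup>2 * c / 2)"
    using sums_if[OF sums_zero e[of "- s\<^sup>2 * c / 2"]] by (simp add: b_def[abs_def])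
  have nb: "(\<lambda>m. norm (b m)) = (\<lambda>m. if even m then (\<bar>- s\<^sup>2 * c / 2\<bar>) ^ (m div 2) / fact (m div 2) else 0)"
    unfolding b_def by (rule ext) (simp only: norm_divide norm_power real_norm_def if_distrib[of norm] norm_zero if_distrib[of abs] abs_zero abs_divide power_abs abs_of_nonneg[OF fact_ge_zero])
  have b': "summable (\<lambda>m. norm (b m))"
    unfolding nb using sums_if[OF sums_zero e[of "\<bar>- s\<^sup>2 * c / 2\<bar>"]] by (rule sums_summable)
  have "(\<lambda>k. \<Sum>i\<le>k. b i * a (k - i)) sums (exp (- s\<^sup>2 * c / 2) * exp (s * t))"
    using Cauchy_product_sums[OF b' a'] by (simp add: sums_unique[OF a, symmetric] sums_unique[OF b, symmetric])
  moreover have "(\<Sum>i\<le>k. b i * a (k - i)) = s ^ k / fact k * wick k c t" for k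
  proof -
    have "(\<Sum>i\<le>k. b i * a (k - i)) = (\<Sum>i\<in>(\<lambda>j. 2 * j) ` {0..k div 2}. b i * a (k - i))"
      by (rule sum.mono_neutral_right) (auto simp: b_def image_iff elim!: evenE)
    also have "\<dots> = (\<Sum>j = 0..k div 2. b (2 * j) * a (k - 2 * j))"
      by (subst sum.reindex) (auto simp: inj_on_def)
    also have "\<dots> = (\<Sum>j = 0..k div 2. s ^ k / fact k *
        ((-1) ^ j * fact k / (fact (k - 2 * j) * fact j * 2 ^ j) * c ^ j * t ^ (k - 2 * j)))"
    proof (intro sum.cong refl)
      fix j assume "j \<in> {0..k div 2}"
      then have "s ^ k = s ^ (2 * j) * s ^ (k - 2 * j)" by (auto simp flip: power_add)
      then show "b (2 * j) * a (k - 2 * j) = s ^ k / fact k *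
        ((-1) ^ j * fact k / (fact (k - 2 * j) * fact j * 2 ^ j) * c ^ j * t ^ (k - 2 * j))"
      proof -
        have "(- s\<^sup>2 * c / 2) ^ j = ((-1) * s\<^sup>2 * c / 2) ^ j" by simp
        also have "\<dots> = (-1) ^ j * s ^ (2 * j) * c ^ j / 2 ^ j"
          by (simp only: power_mult_distrib power_divide power_mult)
        finally show ?thesis
          using \<open>s ^ k = s ^ (2 * j) * s ^ (k - 2 * j)\<close>
          by (simp only: a_def b_def) (simp add: power_mult_distrib mult_ac)
      qed
    qed
    finally show ?thesis by (simp add: wick_def sum_distrib_left)
  qed
  ultimately show ?thesis by (simp add: exp_add[symmetric] mult_exp_exp algebra_simps)
qed

text \<open>A negative second argument cancels the alternating signs of the coefficients.\<close>

lemma abs_wick_le: "\<bar>wick k c t\<bar> \<le> wick k (- \<bar>c\<bar>) \<bar>t\<bar>"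
proof -
  have "\<bar>wick k c t\<bar> \<le> (\<Sum>j = 0..k div 2. \<bar>(-1) ^ j * fact k / (fact (k - 2 * j) * fact j * 2 ^ j) * c ^ j * t ^ (k - 2 * j)\<bar>)"
    unfolding wick_def by (rule sum_abs)
  also have "\<dots> = wick k (- \<bar>c\<bar>) \<bar>t\<bar>"
    unfolding wick_def
  proof (intro sum.cong refl)
    fix j
    have gen: "A * F / D * C * T = F / D * P * T" if "A * C = P" for A F D C P T :: real
      using that by (simp add: mult_ac flip: that)
    have "(-1) ^ j * (- \<bar>c\<bar>) ^ j = \<bar>c\<bar> ^ j" by (simp flip: power_mult_distrib)
    then have eq: "(-1) ^ j * fact k / (fact (k - 2 * j) * fact j * 2 ^ j) * (- \<bar>c\<bar>) ^ j * \<bar>t\<bar> ^ (k - 2 * j)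
      = fact k / (fact (k - 2 * j) * fact j * 2 ^ j) * \<bar>c\<bar> ^ j * \<bar>t\<bar> ^ (k - 2 * j)"
      by (rule gen)
    show "\<bar>(-1) ^ j * fact k / (fact (k - 2 * j) * fact j * 2 ^ j) * c ^ j * t ^ (k - 2 * j)\<bar>
      = (-1) ^ j * fact k / (fact (k - 2 * j) * fact j * 2 ^ j) * (- \<bar>c\<bar>) ^ j * \<bar>t\<bar> ^ (k - 2 * j)"
      unfolding eq by (simp add: abs_mult power_abs)
  qed
  finally show ?thesis .
qed

text \<open>The generating function for \<open>- \<bar>c\<bar>\<close> and \<open>\<bar>t\<bar>\<close> has nonnegative terms and majorizes the given sum.\<close>

lemma sum_abs_wick_le:
  "(\<Sum>k<n. \<bar>s\<bar> ^ k / fact k * \<bar>wick k c t\<bar>) \<le> exp (\<bar>s\<bar> * \<bar>t\<bar> + s\<^sup>2 * \<bar>c\<bar> / 2)"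
proof -
  have nn: "0 \<le> wick k (- \<bar>c\<bar>) \<bar>t\<bar>" for k using abs_wick_le[of k c t] by linarith
  have S: "(\<lambda>k. \<bar>s\<bar> ^ k / fact k * wick k (- \<bar>c\<bar>) \<bar>t\<bar>) sums exp (\<bar>s\<bar> * \<bar>t\<bar> + s\<^sup>2 * \<bar>c\<bar> / 2)"
    using wick_generating_function[of "\<bar>s\<bar>" "- \<bar>c\<bar>" "\<bar>t\<bar>"] by simp
  have "(\<Sum>k<n. \<bar>s\<bar> ^ k / fact k * \<bar>wick k c t\<bar>) \<le> (\<Sum>k<n. \<bar>s\<bar> ^ k / fact k * wick k (- \<bar>c\<bar>) \<bar>t\<bar>)"
    by (intro sum_mono mult_left_mono abs_wick_le) auto
  also have "\<dots> \<le> exp (\<bar>s\<bar> * \<bar>t\<bar> + s\<^sup>2 * \<bar>c\<bar> / 2)"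
    using sum_le_suminf[OF sums_summable[OF S], of "{..<n}"] nn sums_unique[OF S] by simp
  finally show ?thesis .
qed

lemma abs_wick_le_exp: "\<bar>wick k c t\<bar> \<le> fact k * exp (\<bar>t\<bar> + \<bar>c\<bar> / 2)"
proof -
  have "(\<Sum>k\<in>{k}. \<bar>1::real\<bar> ^ k / fact k * \<bar>wick k c t\<bar>) \<le> (\<Sum>k<Suc k. \<bar>1\<bar> ^ k / fact k * \<bar>wick k c t\<bar>)"
    by (rule sum_mono2) auto
  also have "\<dots> \<le> exp (\<bar>t\<bar> + \<bar>c\<bar> / 2)"
    using sum_abs_wick_le[of 1 c t "Suc k"] by simp
  finally show ?thesis by (simp add: field_simps)
qed

lemma continuous_wick [continuous_intros]:
  fixes f g :: "'a::topological_space \<Rightarrow> real"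
  assumes "continuous_on A f" "continuous_on A g"
  shows "continuous_on A (\<lambda>x. wick k (f x) (g x))"
  unfolding wick_def by (intro continuous_intros assms)

lemma measurable_wick [measurable]:
  assumes "f \<in> borel_measurable M"
  shows "(\<lambda>x. wick k c (f x)) \<in> borel_measurable M"
  unfolding wick_def using assms by measurable

text \<open>The first nonzero coefficient of the difference would be the limit at zero of the
  difference divided by a power of \<open>s\<close>.\<close>

lemma power_series_coeff_unique:
  fixes a b :: "nat \<Rightarrow> real"
  assumes "\<And>s. (\<lambda>k. a k * s ^ k) sums F s" "\<And>s. (\<lambda>k. b k * s ^ k) sums F s"
  shows "a = b"
proof -
  define d where "d k = a k - b k" for k
  have d: "(\<lambda>k. d k * s ^ k) sums 0" for s
    using sums_diff[OF assms(1)[of s] assms(2)[of s]] by (simp add: d_def algebra_simps)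
  have "d m = 0" for m
  proof (induction m rule: less_induct)
    case (less m)
    have "(\<lambda>k. d (k + m) * s ^ k) sums 0" if "s \<noteq> 0" for s
    proof -
      have "(\<lambda>k. d (k + m) * s ^ (k + m)) sums 0"
        using d[of s] by (subst (asm) sums_zero_iff_shift[symmetric, where n = m]) (auto simp: less)
      from sums_mult[OF this, of "1 / s ^ m"] show ?thesis
        using that by (simp add: power_add mult_ac)
    qed
    then have "((\<lambda>_. 0) \<longlongrightarrow> d (0 + m)) (at (0::real))"
      by (intro powser_limit_0_strong[where s = 1 and a = "\<lambda>k. d (k + m)"]) auto
    then show "d m = 0"
      by (simp add: tendsto_const_iff)
  qed
  then show ?thesis by (auto simp: d_def)
qed

text \<open>Under the weight \<open>exp Y\<close> a jointly Gaussian \<open>X\<close> is shifted by its covariance \<open>b\<close> with \<open>Y\<close>,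
  and the Wick power of order \<open>k\<close> has expectation \<open>b ^ k\<close>: compare the coefficients of \<open>s ^ k\<close>
  after integrating the generating function.\<close>

lemma wick_tilted_expectation:
  assumes [measurable]: "X \<in> borel_measurable M" "Y \<in> borel_measurable M"
    and mgf: "\<And>s. has_bochner_integral M (\<lambda>\<omega>. exp (s * X \<omega> + Y \<omega>)) (exp (K + s * b + s\<^sup>2 * c / 2))"
  shows "has_bochner_integral M (\<lambda>\<omega>. wick k c (X \<omega>) * exp (Y \<omega>)) (b ^ k * exp K)"
proof -
  have int: "integrable M (\<lambda>\<omega>. exp (s * X \<omega> + Y \<omega>))" and
    val: "(LINT \<omega>|M. exp (s * X \<omega> + Y \<omega>)) = exp (K + s * b + s\<^sup>2 * c / 2)" for s
    using mgf[of s] by (simp_all add: has_bochner_integral_iff)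
  have dom: "exp (s * \<bar>X \<omega>\<bar> + C) * exp (Y \<omega>) \<le> exp C * (exp (s * X \<omega> + Y \<omega>) + exp (- s * X \<omega> + Y \<omega>))" for s C \<omega>
    by (cases "X \<omega> \<ge> 0") (simp_all add: algebra_simps flip: exp_add)
  have int_dom: "integrable M (\<lambda>\<omega>. exp C * (exp (s * X \<omega> + Y \<omega>) + exp (- s * X \<omega> + Y \<omega>)))" for s C
    using int[of s] int[of "-s"] by auto
  have intw: "integrable M (\<lambda>\<omega>. wick k c (X \<omega>) * exp (Y \<omega>))" for k
  proof (rule Bochner_Integration.integrable_bound)
    show "integrable M (\<lambda>\<omega>. fact k * (exp (\<bar>c\<bar> / 2) * (exp (1 * X \<omega> + Y \<omega>) + exp (- 1 * X \<omega> + Y \<omega>))))"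
      by (intro integrable_mult_right int_dom)
    show "AE \<omega> in M. norm (wick k c (X \<omega>) * exp (Y \<omega>)) \<le> norm (fact k * (exp (\<bar>c\<bar> / 2) * (exp (1 * X \<omega> + Y \<omega>) + exp (- 1 * X \<omega> + Y \<omega>))))"
    proof (rule AE_I2)
      fix \<omega>
      have "\<bar>wick k c (X \<omega>)\<bar> * exp (Y \<omega>) \<le> (fact k * exp (1 * \<bar>X \<omega>\<bar> + \<bar>c\<bar> / 2)) * exp (Y \<omega>)"
        using abs_wick_le_exp[of k c "X \<omega>"] by (intro mult_right_mono) auto
      also have "\<dots> \<le> fact k * (exp (\<bar>c\<bar> / 2) * (exp (1 * X \<omega> + Y \<omega>) + exp (- 1 * X \<omega> + Y \<omega>)))"
        unfolding mult.assoc by (intro mult_left_mono dom) auto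
      finally show "norm (wick k c (X \<omega>) * exp (Y \<omega>)) \<le> norm (fact k * (exp (\<bar>c\<bar> / 2) * (exp (1 * X \<omega> + Y \<omega>) + exp (- 1 * X \<omega> + Y \<omega>))))"
        by (simp add: abs_mult)
    qed
  qed measurable
  define I where "I k = (LINT \<omega>|M. wick k c (X \<omega>) * exp (Y \<omega>))" for k
  have S: "(\<lambda>k. I k / fact k * s ^ k) sums (exp (K + s * b))" for s
  proof -
    define u where "u k \<omega> = s ^ k / fact k * (wick k c (X \<omega>) * exp (Y \<omega>))" for k \<omega>
    have u: "integrable M (u k)" for k
      unfolding u_def[abs_def] by (intro integrable_mult_right intw)
    have gen: "(\<lambda>k. u k \<omega>) sums (exp (s * X \<omega> - s\<^sup>2 * c / 2) * exp (Y \<omega>))" for \<omega>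
      using sums_mult2[OF wick_generating_function[of s c "X \<omega>"], of "exp (Y \<omega>)"] by (simp add: u_def mult.assoc)
    have partial: "(\<Sum>k<n. norm (u k \<omega>)) \<le> exp (s\<^sup>2 * \<bar>c\<bar> / 2) * (exp (\<bar>s\<bar> * X \<omega> + Y \<omega>) + exp (- \<bar>s\<bar> * X \<omega> + Y \<omega>))" for n \<omega>
    proof -
      have "(\<Sum>k<n. norm (u k \<omega>)) = (\<Sum>k<n. \<bar>s\<bar> ^ k / fact k * \<bar>wick k c (X \<omega>)\<bar>) * exp (Y \<omega>)"
        by (simp add: u_def abs_mult sum_distrib_right power_abs mult.assoc)
      also have "\<dots> \<le> exp (\<bar>s\<bar> * \<bar>X \<omega>\<bar> + s\<^sup>2 * \<bar>c\<bar> / 2) * exp (Y \<omega>)"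
        by (intro mult_right_mono sum_abs_wick_le) auto
      also note dom
      finally show ?thesis .
    qed
    have "(\<lambda>k. integral\<^sup>L M (u k)) sums (LINT \<omega>|M. (\<Sum>k. u k \<omega>))"
    proof (rule sums_integral[OF u])
      show "AE \<omega> in M. summable (\<lambda>k. norm (u k \<omega>))"
        by (intro AE_I2 summableI_nonneg_bounded[OF _ partial]) auto
      show "summable (\<lambda>k. LINT \<omega>|M. norm (u k \<omega>))"
      proof (rule summableI_nonneg_bounded)
        fix n
        have "(\<Sum>k<n. LINT \<omega>|M. norm (u k \<omega>)) = (LINT \<omega>|M. (\<Sum>k<n. norm (u k \<omega>)))"
          by (subst Bochner_Integration.integral_sum) (auto intro: integrable_norm u)
        also have "\<dots> \<le> (LINT \<omega>|M. exp (s\<^sup>2 * \<bar>c\<bar> / 2) * (exp (\<bar>s\<bar> * X \<omega> + Y \<omega>) + exp (- \<bar>s\<bar> * X \<omega> + Y \<omega>)))"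
          by (intro integral_mono partial int_dom Bochner_Integration.integrable_sum integrable_norm u)
        finally show "(\<Sum>k<n. LINT \<omega>|M. norm (u k \<omega>)) \<le> \<dots>" .
      qed auto
    qed
    also have "(LINT \<omega>|M. (\<Sum>k. u k \<omega>)) = (LINT \<omega>|M. exp (- s\<^sup>2 * c / 2) * exp (s * X \<omega> + Y \<omega>))"
      by (intro Bochner_Integration.integral_cong refl, subst sums_unique[OF gen, symmetric]) (simp add: algebra_simps flip: exp_add)
    also have "\<dots> = exp (K + s * b)"
      unfolding integral_mult_right_zero val by (simp add: algebra_simps flip: exp_add)
    finally show ?thesis
      unfolding u_def[abs_def] integral_mult_right_zero I_def by (simp add: mult_ac)
  qed
  have "(\<lambda>k. (b ^ k * exp K / fact k) * s ^ k) sums (exp (K + s * b))" for s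
  proof -
    have "(\<lambda>k. exp K * ((s * b) ^ k / fact k)) sums (exp K * exp (s * b))"
      using exp_converges[of "s * b"] by (intro sums_mult) (simp add: divide_inverse mult.commute)
    then show ?thesis by (simp add: exp_add power_mult_distrib mult_ac)
  qed
  from power_series_coeff_unique[OF S this]
  have "I k = b ^ k * exp K" by (simp add: fun_eq_iff)
  then show ?thesis using intw[of k] by (simp add: has_bochner_integral_iff I_def)
qed

section \<open>Riemann integrability and lattice sums\<close>

text \<open>In a fine division both selections of tags give sums close to the Riemann integral.\<close>

lemma riemann_integrable_tags:
  assumes "riemann_integrable_on g (cbox a b)" "0 < e"
  obtains \<D> where "\<D> division_of cbox a b"
    "\<And>t s. (\<And>K. K \<in> \<D> \<Longrightarrow> t K \<in> K \<and> s K \<in> K) \<Longrightarrow>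
       \<bar>\<Sum>K\<in>\<D>. measure lborel K * (g (t K) - g (s K))\<bar> < e"
proof -
  from assms obtain I where I: "\<And>e. e > 0 \<Longrightarrow> \<exists>d>0. \<forall>P.
     P tagged_division_of (cbox a b) \<and> (\<forall>(x, K)\<in>P. diameter K < d) \<longrightarrow>
     \<bar>(\<Sum>(x, K)\<in>P. measure lborel K * g x) - I\<bar> < e"
    unfolding riemann_integrable_on_def by blast
  obtain d where d: "d > 0" "\<And>P. P tagged_division_of (cbox a b) \<Longrightarrow> (\<And>x K. (x, K) \<in> P \<Longrightarrow> diameter K < d) \<Longrightarrow>
     \<bar>(\<Sum>(x, K)\<in>P. measure lborel K * g x) - I\<bar> < e / 2"
    using I[of "e / 2"] assms(2) by (metis (no_types, lifting) case_prodI2 half_gt_zero)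
  have "gauge (\<lambda>x :: real^2. ball x (d / 3))" using d(1) by (simp add: gauge_def)
  then obtain p where p: "p tagged_division_of cbox a b" "(\<lambda>x. ball x (d / 3)) fine p"
    using fine_division_exists by blast
  define \<D> where "\<D> = snd ` p"
  have D: "\<D> division_of cbox a b"
    unfolding \<D>_def by (rule division_of_tagged_division[OF p(1)])
  have diam: "diameter K < d" if "K \<in> \<D>" for K
  proof -
    obtain x where "(x, K) \<in> p" using \<open>K \<in> \<D>\<close> unfolding \<D>_def by force
    then have "K \<subseteq> ball x (d / 3)" using p(2) by (auto simp: fine_def)
    then have "diameter K \<le> diameter (ball x (d / 3))" by (intro diameter_subset) auto
    also have "\<dots> \<le> 2 * (d / 3)" using d(1) by (simp add: diameter_ball)
    finally show ?thesis using d(1) by simp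
  qed
  have fin: "finite \<D>" using D by auto
  have close: "\<bar>(\<Sum>K\<in>\<D>. measure lborel K * g (t K)) - I\<bar> < e / 2" if t: "\<And>K. K \<in> \<D> \<Longrightarrow> t K \<in> K" for t
  proof -
    let ?P = "(\<lambda>K. (t K, K)) ` \<D>"
    have inj: "inj_on (\<lambda>K. (t K, K)) \<D>" by (auto simp: inj_on_def)
    have "?P tagged_division_of cbox a b"
    proof (rule tagged_division_ofI)
      show "finite ?P" using fin by simp
    next
      fix x K assume "(x, K) \<in> ?P"
      then have K: "K \<in> \<D>" "x = t K" by auto
      then show "x \<in> K" "K \<subseteq> cbox a b" "\<exists>a b. K = cbox a b"
        using t D by (auto dest: division_ofD)
    next
      fix x1 K1 x2 K2 assume "(x1, K1) \<in> ?P" "(x2, K2) \<in> ?P" "(x1, K1) \<noteq> (x2, K2)"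
      then show "interior K1 \<inter> interior K2 = {}"
        using division_ofD(5)[OF D, of K1 K2] by auto
    next
      show "\<Union>{K. \<exists>x. (x, K) \<in> ?P} = cbox a b"
      proof -
        have "{K. \<exists>x. (x, K) \<in> ?P} = \<D>" by (auto simp: image_iff)
        then show ?thesis using division_ofD(6)[OF D] by simp
      qed
    qed
    from d(2)[OF this] diam
    have "\<bar>(\<Sum>(x, K)\<in>?P. measure lborel K * g x) - I\<bar> < e / 2" by auto
    then show ?thesis by (subst (asm) sum.reindex[OF inj]) (simp add: o_def)
  qed
  show ?thesis
  proof (rule that[OF D])
    fix t s assume ts: "\<And>K. K \<in> \<D> \<Longrightarrow> t K \<in> K \<and> s K \<in> K"
    have "\<bar>(\<Sum>K\<in>\<D>. measure lborel K * g (t K)) - I\<bar> < e / 2"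
      "\<bar>(\<Sum>K\<in>\<D>. measure lborel K * g (s K)) - I\<bar> < e / 2" using ts close[of t] close[of s] by blast+
    then show "\<bar>\<Sum>K\<in>\<D>. measure lborel K * (g (t K) - g (s K))\<bar> < e"
      unfolding right_diff_distrib sum_subtractf by linarith
  qed
qed

lemma open_subset_closed_Un_negligible:
  fixes U N :: "(real^2) set"
  assumes "open A" "A \<subseteq> U \<union> N" "closed U" "negligible N"
  shows "A \<subseteq> U"
proof -
  have "open (A - U)" using assms by auto
  moreover have "negligible (A - U)" using assms by (auto intro: negligible_subset)
  ultimately have "A - U = {}" using open_not_negligible by blast
  then show ?thesis by blast
qed

text \<open>On a cell of positive area a single tag may be moved without changing the sum by much, which
  bounds \<open>g\<close> on the cell.  These cells have a closed union that misses only a null set of the open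
  box, so they cover it.\<close>

lemma riemann_integrable_bounded:
  assumes "riemann_integrable g"
  obtains B where "0 \<le> B" "\<And>x. \<bar>g x\<bar> \<le> B"
proof -
  obtain a b where ab: "{x. g x \<noteq> 0} \<subseteq> box a b" "riemann_integrable_on g (cbox a b)"
    using assms unfolding riemann_integrable_def by blast
  obtain \<D> where D: "\<D> division_of cbox a b"
    and tags: "\<And>t s. (\<And>K. K \<in> \<D> \<Longrightarrow> t K \<in> K \<and> s K \<in> K) \<Longrightarrow>
       \<bar>\<Sum>K\<in>\<D>. measure lborel K * (g (t K) - g (s K))\<bar> < 1"
    using riemann_integrable_tags[OF ab(2), of 1] by auto
  have fin: "finite \<D>" using D by auto
  define \<D>' where "\<D>' = {K \<in> \<D>. measure lborel K \<noteq> 0}"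
  define s where "s K = (SOME x. x \<in> K)" for K :: "(real^2) set"
  have s: "s K \<in> K" if "K \<in> \<D>" for K
    using division_ofD(3)[OF D that] unfolding s_def by (simp add: some_in_eq)
  have bd: "\<bar>g x\<bar> \<le> \<bar>g (s K)\<bar> + 1 / measure lborel K" if K: "K \<in> \<D>'" "x \<in> K" for K x
  proof -
    have mK: "measure lborel K > 0" using K by (simp add: \<D>'_def zero_less_measure_iff)
    have "\<bar>\<Sum>K'\<in>\<D>. measure lborel K' * (g ((s(K := x)) K') - g (s K'))\<bar> < 1"
      using s K by (intro tags) (auto simp: \<D>'_def)
    also have "(\<Sum>K'\<in>\<D>. measure lborel K' * (g ((s(K := x)) K') - g (s K')))
        = (\<Sum>K'\<in>{K}. measure lborel K' * (g ((s(K := x)) K') - g (s K')))"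
      using K fin by (intro sum.mono_neutral_right) (auto simp: \<D>'_def)
    finally have "\<bar>g x - g (s K)\<bar> < 1 / measure lborel K"
      using mK by (simp add: abs_mult pos_less_divide_eq mult.commute[of _ "measure lborel K"])
    then show ?thesis by linarith
  qed
  define B where "B = (\<Sum>K\<in>\<D>'. \<bar>g (s K)\<bar> + 1 / measure lborel K)"
  have fin': "finite \<D>'" using fin by (simp add: \<D>'_def)
  have box: "box a b \<subseteq> \<Union>\<D>'"
  proof (rule open_subset_closed_Un_negligible[where N = "\<Union>(\<D> - \<D>')"])
    show "box a b \<subseteq> \<Union>\<D>' \<union> \<Union>(\<D> - \<D>')"
    proof -
      have "\<D>' \<subseteq> \<D>" by (auto simp: \<D>'_def)
      then have "\<Union>\<D>' \<union> \<Union>(\<D> - \<D>') = \<Union>\<D>" by blast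
      then show ?thesis using division_ofD(6)[OF D] box_subset_cbox[of a b] by simp
    qed
    show "closed (\<Union>\<D>')"
      using fin' division_ofD(4)[OF D] by (intro closed_Union) (auto simp: \<D>'_def)
    show "negligible (\<Union>(\<D> - \<D>'))"
    proof (rule negligible_Union)
      fix K assume "K \<in> \<D> - \<D>'"
      then have "measure lborel K = 0" "\<exists>c d. K = cbox c d"
        using division_ofD(4)[OF D] by (auto simp: \<D>'_def)
      then show "negligible K"
        by (auto simp: content_eq_0_interior negligible_interval interior_cbox)
    qed (use fin in auto)
  qed auto
  have Bnn: "0 \<le> \<bar>g (s K)\<bar> + 1 / measure lborel K" for K by simp
  have "\<bar>g x\<bar> \<le> B" for x
  proof (cases "g x = 0")
    case True
    then show ?thesis unfolding B_def using Bnn by (auto intro!: sum_nonneg)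
  next
    case False
    then obtain K where K: "K \<in> \<D>'" "x \<in> K" using ab(1) box by blast
    have "\<bar>g (s K)\<bar> + 1 / measure lborel K \<le> B"
      unfolding B_def using K(1) fin' Bnn by (intro member_le_sum) auto
    with bd[OF K] show ?thesis by linarith
  qed
  moreover from this[of 0] have "0 \<le> B" by linarith
  ultimately show ?thesis by (rule that[rotated])
qed

text \<open>The cells of a fine division on which \<open>g\<close> oscillates by at least \<open>\<eta>\<close> have small total
  area, and every point of oscillation at least \<open>\<eta>\<close> lies in such a cell or on the frontier of some
  cell.\<close>

lemma riemann_integrable_continuous_AE:
  assumes "riemann_integrable g"
  shows "negligible {x. \<not> isCont g x}"
proof -
  obtain a b where ab: "{x. g x \<noteq> 0} \<subseteq> box a b" "riemann_integrable_on g (cbox a b)"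
    using assms unfolding riemann_integrable_def by blast
  \<comment> \<open>The points at which the oscillation of \<open>g\<close> is at least \<open>\<eta>\<close>.\<close>
  define D where "D \<eta> = {x. \<not> (\<exists>U. open U \<and> x \<in> U \<and> (\<forall>y\<in>U. \<bar>g y - g x\<bar> < \<eta>))}" for \<eta> :: real
  have neg: "negligible (D \<eta>)" if "\<eta> > 0" for \<eta>
    unfolding negligible_outer_le
  proof (intro allI impI)
    fix e :: real assume "e > 0"
    then have pos: "e * \<eta> > 0" using that by simp
    obtain \<D> where \<D>: "\<D> division_of cbox a b"
      and tags: "\<And>t s. (\<And>K. K \<in> \<D> \<Longrightarrow> t K \<in> K \<and> s K \<in> K) \<Longrightarrow>
         \<bar>\<Sum>K\<in>\<D>. measure lborel K * (g (t K) - g (s K))\<bar> < e * \<eta>"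
      by (rule riemann_integrable_tags[OF ab(2) pos]) blast
    have fin: "finite \<D>" using \<D> by auto
    define bad where "bad K \<longleftrightarrow> (\<exists>t\<in>K. \<exists>s\<in>K. g t - g s \<ge> \<eta>)" for K
    have "\<forall>K\<in>\<D>. \<exists>ts. fst ts \<in> K \<and> snd ts \<in> K \<and> g (fst ts) - g (snd ts) \<ge> (if bad K then \<eta> else 0)"
    proof
      fix K assume "K \<in> \<D>"
      show "\<exists>ts. fst ts \<in> K \<and> snd ts \<in> K \<and> g (fst ts) - g (snd ts) \<ge> (if bad K then \<eta> else 0)"
      proof (cases "bad K")
        case True
        then obtain t s where "t \<in> K" "s \<in> K" "\<eta> \<le> g t - g s" unfolding bad_def by blast
        then show ?thesis using True by (intro exI[of _ "(t, s)"]) simp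
      next
        case False
        obtain x where "x \<in> K" using division_ofD(3)[OF \<D> \<open>K \<in> \<D>\<close>] by blast
        then show ?thesis using False by (intro exI[of _ "(x, x)"]) auto
      qed
    qed
    from bchoice[OF this] obtain ts where ts: "\<And>K. K \<in> \<D> \<Longrightarrow> fst (ts K) \<in> K \<and> snd (ts K) \<in> K"
       "\<And>K. K \<in> \<D> \<Longrightarrow> g (fst (ts K)) - g (snd (ts K)) \<ge> (if bad K then \<eta> else 0)"
      by blast
    let ?B = "{K \<in> \<D>. bad K}"
    have "(\<Sum>K\<in>?B. measure lborel K) * \<eta> = (\<Sum>K\<in>\<D>. measure lborel K * (if bad K then \<eta> else 0))"
      unfolding sum_distrib_right using fin by (intro sum.mono_neutral_cong_left) auto
    also have "\<dots> \<le> (\<Sum>K\<in>\<D>. measure lborel K * (g (fst (ts K)) - g (snd (ts K))))"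
      by (intro sum_mono mult_left_mono ts) auto
    also have "\<dots> < e * \<eta>"
      using tags[of "\<lambda>K. fst (ts K)" "\<lambda>K. snd (ts K)"] ts(1) by force
    finally have small: "(\<Sum>K\<in>?B. measure lborel K) < e" using that by simp
    define N where "N = (\<Union>K\<in>\<D>. frontier K)"
    have cells: "convex K" "K \<in> lmeasurable" "K \<in> sets lborel" if "K \<in> \<D>" for K
      using division_ofD(4)[OF \<D> that] by auto
    have N: "negligible N"
      unfolding N_def using fin cells by (intro negligible_Union) (auto intro!: negligible_convex_frontier)
    have B_meas: "\<Union>?B \<in> lmeasurable"
      using fin cells by (intro fmeasurable.finite_Union) auto
    show "\<exists>T. D \<eta> \<subseteq> T \<and> T \<in> lmeasurable \<and> measure lebesgue T \<le> e"
    proof (intro exI[of _ "\<Union>?B \<union> N"] conjI)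
      show "\<Union>?B \<union> N \<in> lmeasurable"
        using B_meas N negligible_imp_measurable by blast
      have "measure lebesgue (\<Union>?B \<union> N) = measure lebesgue (\<Union>?B)"
        using B_meas N by (intro measure_Un_null_set) (auto simp: negligible_iff_null_sets)
      also have "\<dots> \<le> (\<Sum>K\<in>?B. measure lebesgue K)"
        using fin cells by (intro measure_Union_le) auto
      also have "\<dots> = (\<Sum>K\<in>?B. measure lborel K)"
        using cells by (intro sum.cong refl measure_completion) auto
      finally show "measure lebesgue (\<Union>?B \<union> N) \<le> e" using small by simp
      show "D \<eta> \<subseteq> \<Union>?B \<union> N"
      proof (rule subsetI, rule ccontr)
        fix x assume x: "x \<in> D \<eta>" "x \<notin> \<Union>?B \<union> N"
        have "\<exists>U. open U \<and> x \<in> U \<and> (\<forall>y\<in>U. \<bar>g y - g x\<bar> < \<eta>)"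
        proof (cases "x \<in> cbox a b")
          case False
          have "g y = 0" if "y \<notin> cbox a b" for y
            using that ab(1) box_subset_cbox[of a b] by auto
          then show ?thesis
            using False \<open>\<eta> > 0\<close> by (intro exI[of _ "- cbox a b"]) (auto simp: open_Compl)
        next
          case True
          then obtain K where K: "K \<in> \<D>" "x \<in> K" using division_ofD(6)[OF \<D>] by blast
          have "x \<in> interior K"
            using x(2) K closure_subset[of K] unfolding N_def frontier_def by blast
          moreover have "\<not> bad K" using x(2) K by auto
          then have "\<bar>g y - g x\<bar> < \<eta>" if "y \<in> interior K" for y
            using K(2) that interior_subset[of K] unfolding bad_def by (smt (verit) subset_eq)
          ultimately show ?thesis by blast
        qed
        then show False using x(1) unfolding D_def by blast
      qed
    qed
  qed
  have "{x. \<not> isCont g x} \<subseteq> \<Union>(range (\<lambda>n. D (inverse (real (Suc n)))))"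
  proof (rule subsetI, rule ccontr)
    fix x assume x: "x \<in> {x. \<not> isCont g x}" "x \<notin> \<Union>(range (\<lambda>n. D (inverse (real (Suc n)))))"
    have "(g \<longlongrightarrow> g x) (at x)"
    proof (rule tendstoI)
      fix e :: real assume "e > 0"
      then obtain n where n: "inverse (real (Suc n)) < e" using reals_Archimedean by blast
      have "x \<notin> D (inverse (real (Suc n)))" using x(2) by blast
      then have "\<exists>U. open U \<and> x \<in> U \<and> (\<forall>y\<in>U. \<bar>g y - g x\<bar> < inverse (real (Suc n)))"
        unfolding D_def mem_Collect_eq not_not .
      then obtain U where U: "open U" "x \<in> U" "\<And>y. y \<in> U \<Longrightarrow> \<bar>g y - g x\<bar> < inverse (real (Suc n))"
        by blast
      show "\<forall>\<^sub>F y in at x. dist (g y) (g x) < e"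
        unfolding eventually_at_topological
        using U n by (intro exI[of _ U]) (auto simp: dist_real_def intro: less_trans)
    qed
    then show False using x(1) by (simp add: isCont_def)
  qed
  moreover have "negligible (\<Union>(range (\<lambda>n. D (inverse (real (Suc n))))))"
    by (rule negligible_countable_Union) (auto intro!: neg)
  ultimately show ?thesis by (rule negligible_subset[rotated])
qed

definition dyadic_cell :: "nat \<Rightarrow> real^2 \<Rightarrow> (real^2) set" where
  "dyadic_cell m l = {x. \<forall>i. l $ i \<le> x $ i \<and> x $ i < l $ i + 1 / 2 ^ m}"

definition dyadic_floor :: "nat \<Rightarrow> real^2 \<Rightarrow> real^2" where
  "dyadic_floor m x = (\<chi> i. of_int \<lfloor>2 ^ m * x $ i\<rfloor> / 2 ^ m)"

text \<open>Every point lies in exactly one cell whose corner is in the lattice, and \<open>dyadic_floor\<close> is that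
  corner.\<close>

lemma in_dyadic_cell_iff:
  assumes "l \<in> grid m"
  shows "x \<in> dyadic_cell m l \<longleftrightarrow> l = dyadic_floor m x"
proof -
  have "(l $ i \<le> x $ i \<and> x $ i < l $ i + 1 / 2 ^ m) \<longleftrightarrow> l $ i = dyadic_floor m x $ i" for i
  proof -
    obtain z :: int where z: "2 ^ m * l $ i = of_int z"
      using assms unfolding grid_def by (auto elim!: Ints_cases)
    then have l: "l $ i = of_int z / 2 ^ m" by (simp add: field_simps)
    have "(l $ i \<le> x $ i \<and> x $ i < l $ i + 1 / 2 ^ m) \<longleftrightarrow> of_int z \<le> 2 ^ m * x $ i \<and> 2 ^ m * x $ i < of_int z + 1"
      unfolding l by (simp add: field_simps)
    also have "\<dots> \<longleftrightarrow> \<lfloor>2 ^ m * x $ i\<rfloor> = z"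
      by (simp add: floor_eq_iff)
    also have "\<dots> \<longleftrightarrow> l $ i = dyadic_floor m x $ i"
      unfolding l dyadic_floor_def by auto
    finally show ?thesis .
  qed
  then show ?thesis by (auto simp: dyadic_cell_def vec_eq_iff)
qed

lemma dist_dyadic_floor: "dist (dyadic_floor m x) x \<le> 2 / 2 ^ m"
proof -
  have "\<bar>(dyadic_floor m x - x) $ i\<bar> \<le> 1 / 2 ^ m" for i
  proof -
    have "of_int \<lfloor>2 ^ m * x $ i\<rfloor> \<le> 2 ^ m * x $ i" "2 ^ m * x $ i < of_int \<lfloor>2 ^ m * x $ i\<rfloor> + 1" by linarith+
    then have "\<bar>of_int \<lfloor>2 ^ m * x $ i\<rfloor> - 2 ^ m * x $ i\<bar> \<le> 1" by linarith
    then have "\<bar>of_int \<lfloor>2 ^ m * x $ i\<rfloor> - 2 ^ m * x $ i\<bar> / 2 ^ m \<le> 1 / 2 ^ m"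
      by (rule divide_right_mono) simp
    also have "\<bar>of_int \<lfloor>2 ^ m * x $ i\<rfloor> - 2 ^ m * x $ i\<bar> / 2 ^ m = \<bar>(dyadic_floor m x - x) $ i\<bar>"
      by (simp add: dyadic_floor_def field_simps flip: abs_divide)
    finally show ?thesis .
  qed
  then have "(\<Sum>i\<in>UNIV. \<bar>(dyadic_floor m x - x) $ i\<bar>) \<le> (\<Sum>i\<in>(UNIV::2 set). 1 / 2 ^ m)"
    by (intro sum_mono)
  then show ?thesis
    using norm_le_l1_cart[of "dyadic_floor m x - x"] by (simp add: dist_norm)
qed

lemma dyadic_floor_tendsto: "(\<lambda>m. dyadic_floor m x) \<longlonglongrightarrow> x"
proof -
  have "(\<lambda>m. dist (dyadic_floor m x) x) \<longlonglongrightarrow> 0"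
  proof (rule tendsto_sandwich[OF _ _ tendsto_const])
    show "(\<lambda>m. 2 / 2 ^ m :: real) \<longlonglongrightarrow> 0" by (rule LIMSEQ_divide_realpow_zero) simp
  qed (auto simp: dist_dyadic_floor)
  then show ?thesis by (simp flip: tendsto_dist_iff)
qed

lemma dyadic_floor_lattice: "2 ^ m * dyadic_floor m x $ i \<in> \<int>"
  by (simp add: dyadic_floor_def)

lemma finite_grid: "finite (grid m)"
proof -
  let ?Z = "{- (2 ^ m * int m)..2 ^ m * int m}"
  have "grid m \<subseteq> (\<lambda>(a, b). vector [of_int a / 2 ^ m, of_int b / 2 ^ m]) ` (?Z \<times> ?Z)"
  proof
    fix x assume x: "x \<in> grid m"
    have "\<exists>z\<in>?Z. x $ i = of_int z / 2 ^ m" for i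
    proof -
      obtain z :: int where z: "2 ^ m * x $ i = of_int z"
        using x unfolding grid_def by (auto elim!: Ints_cases)
      have "\<bar>x $ i\<bar> \<le> real m" using x component_le_norm_cart[of x i] by (auto simp: grid_def)
      then have "\<bar>of_int z\<bar> \<le> 2 ^ m * real m" unfolding z[symmetric] by (simp add: abs_mult)
      then have "\<bar>z\<bar> \<le> 2 ^ m * int m"
        by (metis (mono_tags, lifting) of_int_abs of_int_le_iff of_int_mult of_int_numeral of_int_of_nat_eq of_int_power)
      then show ?thesis using z by (intro bexI[of _ z]) (auto simp: field_simps)
    qed
    then obtain a b where "a \<in> ?Z" "x $ 1 = of_int a / 2 ^ m" "b \<in> ?Z" "x $ 2 = of_int b / 2 ^ m" by metis
    then show "x \<in> (\<lambda>(a, b). vector [of_int a / 2 ^ m, of_int b / 2 ^ m]) ` (?Z \<times> ?Z)"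
      by (intro image_eqI[of _ _ "(a, b)"]) (auto simp: vec_eq_iff forall_2)
  qed
  then show ?thesis by (rule finite_subset) auto
qed

lemma dyadic_cell_sets [measurable]: "dyadic_cell m l \<in> sets borel"
proof -
  have "dyadic_cell m l = (\<Inter>i\<in>UNIV. {x. l $ i \<le> x $ i} \<inter> {x. x $ i < l $ i + 1 / 2 ^ m})"
    by (auto simp: dyadic_cell_def)
  moreover have "{x :: real^2. l $ i \<le> x $ i} \<inter> {x. x $ i < l $ i + 1 / 2 ^ m} \<in> sets borel" for i
    by (intro sets.Int borel_closed borel_open closed_Collect_le open_Collect_less continuous_intros)
  ultimately show ?thesis by (auto intro!: sets.finite_INT)
qed

lemma measure_dyadic_cell:
  shows "measure lebesgue (dyadic_cell m l) = 1 / 2 ^ (2 * m)"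
    and "dyadic_cell m l \<in> lmeasurable"
proof -
  let ?u = "l + (\<chi> i. 1 / 2 ^ m)"
  have sub: "box l ?u \<subseteq> dyadic_cell m l" "dyadic_cell m l \<subseteq> cbox l ?u"
    by (auto simp: dyadic_cell_def mem_box_cart less_imp_le)
  show "dyadic_cell m l \<in> lmeasurable"
    by (rule bounded_set_imp_lmeasurable[OF bounded_subset[OF bounded_cbox sub(2)]]) simp
  have N: "dyadic_cell m l - box l ?u \<in> null_sets lborel"
    by (rule null_sets_subset[OF null_sets_cbox_Diff_box[of l ?u]]) (use sub in auto)
  have "measure lborel (dyadic_cell m l) = measure lborel (box l ?u \<union> (dyadic_cell m l - box l ?u))"
    using sub(1) by (simp add: Un_absorb1)
  also have "\<dots> = measure lborel (box l ?u)"
    using N by (intro measure_Un_null_set) auto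
  also have "\<dots> = measure lborel (cbox l ?u)"
    unfolding measure_lborel_box_eq measure_lborel_cbox_eq ..
  also have "\<dots> = (\<Prod>i\<in>(UNIV::2 set). 1 / 2 ^ m)"
    by (subst content_cbox_cart) (auto simp: interval_ne_empty_cart)
  also have "\<dots> = 1 / 2 ^ (2 * m)" by (simp add: power_divide power_mult power2_eq_square power_mult_distrib[symmetric] flip: power_even_eq)
  finally show "measure lebesgue (dyadic_cell m l) = 1 / 2 ^ (2 * m)" by (simp add: measure_completion)
qed

lemma lattice_sum_as_integral:
  fixes w :: "real^2 \<Rightarrow> real"
  shows
  "1 / 2 ^ (2 * m) * (\<Sum>l\<in>S. w l) = (LINT x|lebesgue. (\<Sum>l\<in>S. w l * indicator (dyadic_cell m l) x))"
proof -
  have "(LINT x|lebesgue. w l * indicator (dyadic_cell m l) x) = w l * (1 / 2 ^ (2 * m))" for l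
    by (simp add: measure_dyadic_cell)
  moreover have "integrable lebesgue (\<lambda>x. w l * indicat_real (dyadic_cell m l) x)" for l
    using measure_dyadic_cell(2)[of m l] by (intro integrable_mult_right) (auto simp: fmeasurable_def)
  ultimately show ?thesis
    by (subst Bochner_Integration.integral_sum) (auto simp: sum_distrib_left)
qed

text \<open>The sum is a step function: at each point at most one term is nonzero.\<close>

lemma sum_dyadic_cells:
  assumes "finite S" "S \<subseteq> grid m"
  shows "(\<Sum>l\<in>S. w l * indicat_real (dyadic_cell m l) x) = (if dyadic_floor m x \<in> S then w (dyadic_floor m x) else 0)"
proof -
  have "(\<Sum>l\<in>S. w l * indicat_real (dyadic_cell m l) x) = (\<Sum>l\<in>S. if l = dyadic_floor m x then w l else 0)"
    using assms in_dyadic_cell_iff by (intro sum.cong refl) (auto simp: indicator_def)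
  then show ?thesis using assms(1) by (simp add: sum.delta)
qed

lemma norm_le_dyadic_floor: "norm x \<le> norm (dyadic_floor m x) + 2"
proof -
  have "dist (dyadic_floor m x) x \<le> 2"
    using dist_dyadic_floor[of m x] by (rule order_trans) (simp add: field_simps)
  then show ?thesis using norm_triangle_ineq2[of x "dyadic_floor m x"] by (simp add: dist_norm norm_minus_commute)
qed

text \<open>The cells are disjoint, of area \<open>1 / 2 ^ (2 * m)\<close>, and contained in a slightly larger ball.\<close>

lemma card_grid_ball_le:
  "\<exists>C. \<forall>m. real (card {l \<in> grid m. norm l \<le> R}) / 2 ^ (2 * m) \<le> C"
proof (intro exI allI)
  fix m
  let ?S = "{l \<in> grid m. norm l \<le> R}"
  have "real (card ?S) / 2 ^ (2 * m) = (LINT x|lebesgue. (\<Sum>l\<in>?S. 1 * indicat_real (dyadic_cell m l) x))"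
    using lattice_sum_as_integral[of m "\<lambda>_. 1" ?S] by simp
  also have "\<dots> \<le> (LINT x|lebesgue. indicat_real (cball 0 (R + 2) :: (real^2) set) x)"
  proof (rule integral_mono)
    fix x
    show "(\<Sum>l\<in>?S. 1 * indicat_real (dyadic_cell m l) x) \<le> indicat_real (cball 0 (R + 2)) x"
      using norm_le_dyadic_floor[of x m] finite_grid[of m]
      by (subst sum_dyadic_cells[where w = "\<lambda>_. 1"]) (auto simp: indicator_def)
  qed (use measure_dyadic_cell(2)[of m] lmeasurable_cball[of 0 "R + 2"] in
      \<open>auto intro!: Bochner_Integration.integrable_sum simp: fmeasurable_def\<close>)
  also have "\<dots> = measure lebesgue (cball 0 (R + 2) :: (real^2) set)" by simp
  finally show "real (card ?S) / 2 ^ (2 * m) \<le> measure lebesgue (cball 0 (R + 2) :: (real^2) set)" .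
qed

lemma continuous_bounded_cball:
  fixes F :: "real^2 \<Rightarrow> real"
  assumes "continuous_on UNIV F"
  obtains C where "0 \<le> C" "\<And>x. norm x \<le> R \<Longrightarrow> \<bar>F x\<bar> \<le> C"
proof -
  have "bounded (F ` cball 0 R)"
    by (intro compact_imp_bounded compact_continuous_image continuous_on_subset[OF assms]) auto
  then obtain C where "0 < C" "\<And>x. x \<in> cball 0 R \<Longrightarrow> \<bar>F x\<bar> \<le> C"
    unfolding bounded_pos by auto
  then show ?thesis using that[of C] by auto
qed

text \<open>The lattice sums are integrals of step functions, which converge at every point of
  continuity of \<open>g\<close> and are dominated.\<close>

lemma lattice_sum_tendsto:
  fixes F g :: "real^2 \<Rightarrow> real"
  assumes g: "riemann_integrable g" "g \<in> borel_measurable lebesgue"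
    and supp: "\<And>x. R < norm x \<Longrightarrow> g x = 0" and F: "continuous_on UNIV F"
  shows "(\<lambda>m. 1 / 2 ^ (2 * m) * (\<Sum>l\<in>grid m. F l * g l)) \<longlonglongrightarrow> (LINT x|lebesgue. F x * g x)"
proof -
  obtain B where B: "0 \<le> B" "\<And>x. \<bar>g x\<bar> \<le> B" using riemann_integrable_bounded[OF g(1)] by blast
  obtain C where C: "0 \<le> C" "\<And>x. norm x \<le> R \<Longrightarrow> \<bar>F x\<bar> \<le> C" using continuous_bounded_cball[OF F] by blast
  have F_meas: "F \<in> borel_measurable lebesgue"
    using F by (simp add: borel_measurable_continuous_onI measurable_completion)
  show ?thesis
    unfolding lattice_sum_as_integral
  proof (rule integral_dominated_convergence[where w = "\<lambda>x. (C * B) * indicat_real (cball 0 (R + 2)) x"])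
    show "(\<lambda>x. F x * g x) \<in> borel_measurable lebesgue" using g(2) F_meas by simp
    show "(\<lambda>x. \<Sum>l\<in>grid m. F l * g l * indicat_real (dyadic_cell m l) x) \<in> borel_measurable lebesgue" for m
      by (intro borel_measurable_sum borel_measurable_times borel_measurable_const borel_measurable_indicator) simp
    show "integrable lebesgue (\<lambda>x. (C * B) * indicat_real (cball 0 (R + 2)) x)"
      by (intro integrable_mult_right lmeasurable_iff_integrable[THEN iffD1] lmeasurable_cball)
    show "AE x in lebesgue. norm (\<Sum>l\<in>grid m. F l * g l * indicat_real (dyadic_cell m l) x)
        \<le> (C * B) * indicat_real (cball 0 (R + 2)) x" for m
    proof (rule AE_I2)
      fix x
      let ?d = "dyadic_floor m x"
      have "norm (F ?d * g ?d) \<le> (C * B) * indicat_real (cball 0 (R + 2)) x"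
      proof (cases "norm ?d \<le> R")
        case True
        then have "x \<in> cball 0 (R + 2)" using norm_le_dyadic_floor[of x m] by simp
        moreover have "\<bar>F ?d\<bar> * \<bar>g ?d\<bar> \<le> C * B" using B C True by (intro mult_mono) auto
        ultimately show ?thesis by (simp add: abs_mult)
      next
        case False
        then show ?thesis using supp[of ?d] B C by (simp add: not_le)
      qed
      then show "norm (\<Sum>l\<in>grid m. F l * g l * indicat_real (dyadic_cell m l) x)
        \<le> (C * B) * indicat_real (cball 0 (R + 2)) x"
        using B C by (subst sum_dyadic_cells[OF finite_grid order_refl]) auto
    qed
    have "{x. \<not> isCont g x} \<in> null_sets lebesgue"
      using riemann_integrable_continuous_AE[OF g(1)] by (simp add: negligible_iff_null_sets)
    then have "AE x in lebesgue. isCont g x" by (rule AE_I') auto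
    then show "AE x in lebesgue. (\<lambda>m. \<Sum>l\<in>grid m. F l * g l * indicat_real (dyadic_cell m l) x) \<longlonglongrightarrow> F x * g x"
    proof eventually_elim
      case (elim x)
      have "isCont F x" using F by (simp add: continuous_on_eq_continuous_at)
      then have "(\<lambda>m. F (dyadic_floor m x) * g (dyadic_floor m x)) \<longlonglongrightarrow> F x * g x"
        by (intro tendsto_mult[OF isCont_tendsto_compose[OF _ dyadic_floor_tendsto]
              isCont_tendsto_compose[OF elim dyadic_floor_tendsto]])
      moreover have "\<forall>\<^sub>F m in sequentially. F (dyadic_floor m x) * g (dyadic_floor m x)
          = (\<Sum>l\<in>grid m. F l * g l * indicat_real (dyadic_cell m l) x)"
      proof -
        obtain m0 where m0: "R \<le> real m0" using real_arch_simple by blast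
        show ?thesis
          unfolding eventually_sequentially
        proof (intro exI[of _ m0] allI impI)
          fix m assume "m0 \<le> m"
          then have "dyadic_floor m x \<in> grid m \<or> R < norm (dyadic_floor m x)"
            using m0 unfolding grid_def by (auto simp: dyadic_floor_lattice)
          then show "F (dyadic_floor m x) * g (dyadic_floor m x)
            = (\<Sum>l\<in>grid m. F l * g l * indicat_real (dyadic_cell m l) x)"
            using supp by (subst sum_dyadic_cells[OF finite_grid order_refl]) auto
        qed
      qed
      ultimately show ?case by (rule Lim_transform_eventually)
    qed
  qed
qed

section \<open>Convergence in the space of p-integrable functions\<close>

lemma abs_diff_powr_le:
  fixes a b q :: real
  assumes "0 < q"
  shows "\<bar>a - b\<bar> powr q \<le> 2 powr q * (\<bar>a\<bar> powr q + \<bar>b\<bar> powr q)"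
proof -
  have "\<bar>a - b\<bar> powr q \<le> (2 * max \<bar>a\<bar> \<bar>b\<bar>) powr q"
    using assms by (intro powr_mono2) auto
  also have "\<dots> = 2 powr q * max \<bar>a\<bar> \<bar>b\<bar> powr q"
    by (simp add: powr_mult)
  also have "\<dots> \<le> 2 powr q * (\<bar>a\<bar> powr q + \<bar>b\<bar> powr q)"
    by (intro mult_left_mono) (auto simp: max_def)
  finally show ?thesis .
qed

lemma in_Lp_diff:
  assumes "0 < p" "in_Lp M p f" "in_Lp M p g"
  shows "in_Lp M p (\<lambda>x. f x - g x)"
    and "(LINT x|M. \<bar>f x - g x\<bar> powr p) \<le> 2 powr p * ((LINT x|M. \<bar>f x\<bar> powr p) + (LINT x|M. \<bar>g x\<bar> powr p))"
proof -
  have m [measurable]: "f \<in> borel_measurable M" "g \<in> borel_measurable M"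
    and i: "integrable M (\<lambda>x. \<bar>f x\<bar> powr p)" "integrable M (\<lambda>x. \<bar>g x\<bar> powr p)"
    using assms by (auto simp: in_Lp_def)
  have i2: "integrable M (\<lambda>x. 2 powr p * (\<bar>f x\<bar> powr p + \<bar>g x\<bar> powr p))"
    using i by auto
  have int: "integrable M (\<lambda>x. \<bar>f x - g x\<bar> powr p)"
    by (rule Bochner_Integration.integrable_bound[OF i2])
      (auto intro!: AE_I2 order_trans[OF abs_diff_powr_le[OF assms(1)]])
  then show "in_Lp M p (\<lambda>x. f x - g x)" by (simp add: in_Lp_def)
  have "(LINT x|M. \<bar>f x - g x\<bar> powr p) \<le> (LINT x|M. 2 powr p * (\<bar>f x\<bar> powr p + \<bar>g x\<bar> powr p))"
    by (intro integral_mono int i2 abs_diff_powr_le assms(1))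
  also have "\<dots> = 2 powr p * ((LINT x|M. \<bar>f x\<bar> powr p) + (LINT x|M. \<bar>g x\<bar> powr p))"
    using i by simp
  finally show "(LINT x|M. \<bar>f x - g x\<bar> powr p) \<le> 2 powr p * ((LINT x|M. \<bar>f x\<bar> powr p) + (LINT x|M. \<bar>g x\<bar> powr p))" .
qed

lemma Lp_norm_powr: "p \<noteq> 0 \<Longrightarrow> Lp_norm M p f powr p = (LINT x|M. \<bar>f x\<bar> powr p)"
  by (simp add: Lp_norm_def powr_powr integral_nonneg_AE)

lemma Lp_tendsto_iff:
  assumes "0 < p"
  shows "Lp_tendsto M p F f \<longleftrightarrow> (\<forall>m. in_Lp M p (F m)) \<and> in_Lp M p f \<and>
    (\<lambda>m. LINT x|M. \<bar>F m x - f x\<bar> powr p) \<longlonglongrightarrow> 0"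
proof -
  have "(\<lambda>m. Lp_norm M p (\<lambda>x. F m x - f x)) \<longlonglongrightarrow> 0 \<longleftrightarrow> (\<lambda>m. LINT x|M. \<bar>F m x - f x\<bar> powr p) \<longlonglongrightarrow> 0"
  proof
    assume "(\<lambda>m. Lp_norm M p (\<lambda>x. F m x - f x)) \<longlonglongrightarrow> 0"
    then have "(\<lambda>m. Lp_norm M p (\<lambda>x. F m x - f x) powr p) \<longlonglongrightarrow> 0"
      using assms by (intro tendsto_zero_powrI[OF _ tendsto_const]) (auto simp: Lp_norm_def)
    then show "(\<lambda>m. LINT x|M. \<bar>F m x - f x\<bar> powr p) \<longlonglongrightarrow> 0"
      using assms by (simp add: Lp_norm_powr)
  next
    assume "(\<lambda>m. LINT x|M. \<bar>F m x - f x\<bar> powr p) \<longlonglongrightarrow> 0"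
    then show "(\<lambda>m. Lp_norm M p (\<lambda>x. F m x - f x)) \<longlonglongrightarrow> 0"
      unfolding Lp_norm_def using assms
      by (intro tendsto_zero_powrI[OF _ tendsto_const]) (auto simp: integral_nonneg_AE)
  qed
  then show ?thesis by (simp add: Lp_tendsto_def)
qed

lemma Lp_tendsto_unique:
  assumes "0 < p" "Lp_tendsto M p F f" "Lp_tendsto M p F g"
  shows "Lp_eq M p f g"
proof -
  note t = assms(2,3)[unfolded Lp_tendsto_iff[OF assms(1)]]
  have sym: "\<bar>(a - b) - (a - c)\<bar> = \<bar>b - c\<bar>" for a b c :: real by simp
  have "(LINT x|M. \<bar>f x - g x\<bar> powr p) \<le> 2 powr p * ((LINT x|M. \<bar>F m x - f x\<bar> powr p) + (LINT x|M. \<bar>F m x - g x\<bar> powr p))" for m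
    using in_Lp_diff(2)[OF assms(1) in_Lp_diff(1)[OF assms(1), of M "F m" f] in_Lp_diff(1)[OF assms(1), of M "F m" g]] t
    unfolding sym by blast
  moreover have "(\<lambda>m. 2 powr p * ((LINT x|M. \<bar>F m x - f x\<bar> powr p) + (LINT x|M. \<bar>F m x - g x\<bar> powr p))) \<longlonglongrightarrow> 2 powr p * (0 + 0)"
    using t by (intro tendsto_intros) auto
  ultimately have "(LINT x|M. \<bar>f x - g x\<bar> powr p) \<le> 2 powr p * (0 + 0)"
    by (intro LIMSEQ_le_const) blast+
  then have "(LINT x|M. \<bar>f x - g x\<bar> powr p) \<le> 0" by simp
  moreover have "(LINT x|M. \<bar>f x - g x\<bar> powr p) \<ge> 0" by (simp add: integral_nonneg_AE)
  ultimately have "(LINT x|M. \<bar>f x - g x\<bar> powr p) = 0" by simp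
  moreover have "integrable M (\<lambda>x. \<bar>f x - g x\<bar> powr p)"
    using in_Lp_diff(1)[OF assms(1), of M f g] t by (simp add: in_Lp_def)
  ultimately have "AE x in M. \<bar>f x - g x\<bar> powr p = 0"
    by (subst (asm) integral_nonneg_eq_0_iff_AE) auto
  then show ?thesis using t by (auto simp: Lp_eq_def)
qed

text \<open>Convergence in mean from a second-moment bound: \<open>Z \<le> min Z r + Z\<^sup>2 / r\<close>, where the first
  part tends to zero by dominated convergence and the second is uniformly small for large \<open>r\<close>.\<close>

lemma (in prob_space) expectation_tendsto_0_if_second_moment_bounded:
  fixes Z :: "nat \<Rightarrow> 'a \<Rightarrow> real"
  assumes [measurable]: "\<And>m. Z m \<in> borel_measurable M"
    and nonneg: "\<And>m x. 0 \<le> Z m x"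
    and lim: "AE x in M. (\<lambda>m. Z m x) \<longlonglongrightarrow> 0"
    and int: "\<And>m. integrable M (\<lambda>x. (Z m x)\<^sup>2)"
    and bd: "\<And>m. (LINT x|M. (Z m x)\<^sup>2) \<le> B"
  shows "(\<lambda>m. LINT x|M. Z m x) \<longlonglongrightarrow> 0"
proof (rule LIMSEQ_I)
  fix e :: real assume e: "0 < e"
  define r where "r = 2 * (\<bar>B\<bar> + 1) / e"
  have r: "r > 0" using e by (simp add: r_def add_nonneg_pos)
  have le: "z \<le> min z r + z\<^sup>2 / r" if "0 \<le> z" for z :: real
  proof (cases "z \<le> r")
    case False
    then have "z * r \<le> z * z" using that by (intro mult_left_mono) auto
    then have "z \<le> z\<^sup>2 / r" using r by (simp add: pos_le_divide_eq power2_eq_square)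
    then show ?thesis using False r by (simp add: min_def)
  qed (use r in \<open>simp add: min_def\<close>)
  have int_min: "integrable M (\<lambda>x. min (Z m x) r)" for m
    by (rule integrable_const_bound[where B = r]) (use nonneg r in auto)
  have "(\<lambda>m. LINT x|M. min (Z m x) r) \<longlonglongrightarrow> (LINT x|M. 0)"
  proof (rule integral_dominated_convergence[where w = "\<lambda>_. r"])
    show "AE x in M. (\<lambda>m. min (Z m x) r) \<longlonglongrightarrow> 0"
      using lim
    proof eventually_elim
      case (elim x)
      have "(\<lambda>m. min (Z m x) r) \<longlonglongrightarrow> min 0 r" by (intro tendsto_min elim tendsto_const)
      then show ?case using r by simp
    qed
  qed (use nonneg r in auto)
  then have "\<forall>\<^sub>F m in sequentially. (LINT x|M. min (Z m x) r) < e / 2"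
    using e by (intro order_tendstoD(2)) auto
  then obtain N where N: "\<And>m. N \<le> m \<Longrightarrow> (LINT x|M. min (Z m x) r) < e / 2"
    unfolding eventually_sequentially by blast
  show "\<exists>N. \<forall>m\<ge>N. norm ((LINT x|M. Z m x) - 0) < e"
  proof (intro exI[of _ N] allI impI)
    fix m assume "N \<le> m"
    have i2: "integrable M (\<lambda>x. min (Z m x) r + (Z m x)\<^sup>2 / r)"
      using int_min int by auto
    have "integrable M (Z m)"
      by (rule Bochner_Integration.integrable_bound[OF i2]) (use nonneg le r in \<open>auto simp: abs_of_nonneg\<close>)
    then have "(LINT x|M. Z m x) \<le> (LINT x|M. min (Z m x) r + (Z m x)\<^sup>2 / r)"
      using le nonneg by (intro integral_mono i2) auto
    also have "\<dots> = (LINT x|M. min (Z m x) r) + (LINT x|M. (Z m x)\<^sup>2) / r"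
      using int_min int by simp
    also have "(LINT x|M. (Z m x)\<^sup>2) / r \<le> B / r"
      using bd r by (intro divide_right_mono) auto
    also have "B / r \<le> e / 2"
    proof -
      have "B / (\<bar>B\<bar> + 1) \<le> 1" by (simp add: divide_le_eq) linarith
      then have "(B / (\<bar>B\<bar> + 1)) * (e / 2) \<le> 1 * (e / 2)" using e by (intro mult_right_mono) auto
      moreover have "B / r = (B / (\<bar>B\<bar> + 1)) * (e / 2)" using e by (simp add: r_def)
      ultimately show ?thesis by simp
    qed
    finally have "(LINT x|M. Z m x) < e" using N[OF \<open>N \<le> m\<close>] by linarith
    moreover have "0 \<le> (LINT x|M. Z m x)" using nonneg by simp
    ultimately show "norm ((LINT x|M. Z m x) - 0) < e" by simp
  qed
qed

lemma (in prob_space) in_Lp_half: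
  assumes "0 < p" "in_Lp M (2 * p) f"
  shows "in_Lp M p f"
proof -
  have [measurable]: "f \<in> borel_measurable M" and int: "integrable M (\<lambda>x. \<bar>f x\<bar> powr (2 * p))"
    using assms by (auto simp: in_Lp_def)
  have "\<bar>f x\<bar> powr p \<le> 1 + \<bar>f x\<bar> powr (2 * p)" for x
  proof -
    have "y \<le> 1 + y\<^sup>2" for y :: real
    proof -
      have "(y - 1)\<^sup>2 = y\<^sup>2 - 2 * y + 1" by (simp add: power2_eq_square algebra_simps)
      then show ?thesis using zero_le_power2[of "y - 1"] zero_le_power2[of y] by linarith
    qed
    moreover have "(\<bar>f x\<bar> powr p)\<^sup>2 = \<bar>f x\<bar> powr (2 * p)"
      by (simp add: power2_eq_square flip: powr_add)
    ultimately show ?thesis by metis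
  qed
  note le = this
  have "integrable M (\<lambda>x. \<bar>f x\<bar> powr p)"
  proof (rule Bochner_Integration.integrable_bound)
    show "integrable M (\<lambda>x. 1 + \<bar>f x\<bar> powr (2 * p))" using int by simp
    show "AE x in M. norm (\<bar>f x\<bar> powr p) \<le> norm (1 + \<bar>f x\<bar> powr (2 * p))"
      using le by (intro AE_I2) (simp add: abs_of_nonneg)
  qed measurable
  then show ?thesis by (simp add: in_Lp_def)
qed

lemma (in prob_space) Lp_tendsto_if_pointwise_and_bounded:
  assumes p: "0 < p"
    and [measurable]: "\<And>m. F m \<in> borel_measurable M"
    and lim: "\<And>x. x \<in> space M \<Longrightarrow> (\<lambda>m. F m x) \<longlonglongrightarrow> f x"
    and int: "\<And>m. integrable M (\<lambda>x. \<bar>F m x\<bar> powr (2 * p))"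
    and bd: "\<And>m. (LINT x|M. \<bar>F m x\<bar> powr (2 * p)) \<le> B"
  shows "Lp_tendsto M p F f"
proof -
  have f [measurable]: "f \<in> borel_measurable M"
    by (rule borel_measurable_LIMSEQ_real[OF lim]) auto
  have q: "2 * p > 0" using p by simp
  have "(\<integral>\<^sup>+x. ennreal (\<bar>f x\<bar> powr (2 * p)) \<partial>M) = (\<integral>\<^sup>+x. liminf (\<lambda>m. ennreal (\<bar>F m x\<bar> powr (2 * p))) \<partial>M)"
  proof (rule nn_integral_cong)
    fix x assume "x \<in> space M"
    have "(\<lambda>m. \<bar>F m x\<bar> powr (2 * p)) \<longlonglongrightarrow> \<bar>f x\<bar> powr (2 * p)"
      using q by (intro tendsto_powr2 tendsto_rabs lim \<open>x \<in> space M\<close> tendsto_const) auto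
    then have "(\<lambda>m. ennreal (\<bar>F m x\<bar> powr (2 * p))) \<longlonglongrightarrow> ennreal (\<bar>f x\<bar> powr (2 * p))"
      by (rule tendsto_ennrealI)
    then show "ennreal (\<bar>f x\<bar> powr (2 * p)) = liminf (\<lambda>m. ennreal (\<bar>F m x\<bar> powr (2 * p)))"
      by (rule lim_imp_Liminf[OF trivial_limit_sequentially, symmetric])
  qed
  also have "\<dots> \<le> liminf (\<lambda>m. \<integral>\<^sup>+x. ennreal (\<bar>F m x\<bar> powr (2 * p)) \<partial>M)"
    by (rule nn_integral_liminf) measurable
  also have "\<dots> \<le> limsup (\<lambda>m. \<integral>\<^sup>+x. ennreal (\<bar>F m x\<bar> powr (2 * p)) \<partial>M)"
    by (rule Liminf_le_Limsup) simp
  also have "\<dots> \<le> ennreal B"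
    using int bd by (intro Limsup_bounded always_eventually allI)
      (simp add: nn_integral_eq_integral ennreal_leI)
  finally have fin: "(\<integral>\<^sup>+x. ennreal (\<bar>f x\<bar> powr (2 * p)) \<partial>M) \<le> ennreal B" .
  then have fint: "integrable M (\<lambda>x. \<bar>f x\<bar> powr (2 * p))"
    by (intro integrableI_bounded) (auto intro: le_less_trans)
  have L: "in_Lp M (2 * p) (F m)" "in_Lp M (2 * p) f" for m
    using int fint by (auto simp: in_Lp_def)
  have sq: "(\<bar>F m x - f x\<bar> powr p)\<^sup>2 = \<bar>F m x - f x\<bar> powr (2 * p)" for m x
    by (simp add: power2_eq_square flip: powr_add)
  have "(\<lambda>m. LINT x|M. \<bar>F m x - f x\<bar> powr p) \<longlonglongrightarrow> 0"
  proof (rule expectation_tendsto_0_if_second_moment_bounded)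
    show "AE x in M. (\<lambda>m. \<bar>F m x - f x\<bar> powr p) \<longlonglongrightarrow> 0"
    proof (rule AE_I2)
      fix x assume "x \<in> space M"
      then show "(\<lambda>m. \<bar>F m x - f x\<bar> powr p) \<longlonglongrightarrow> 0"
        using p lim by (intro tendsto_zero_powrI[OF _ tendsto_const] tendsto_rabs_zero) (auto simp: LIM_zero)
    qed
    show "integrable M (\<lambda>x. (\<bar>F m x - f x\<bar> powr p)\<^sup>2)" for m
      unfolding sq using in_Lp_diff(1)[OF q L(1) L(2)] by (simp add: in_Lp_def)
    show "(LINT x|M. (\<bar>F m x - f x\<bar> powr p)\<^sup>2) \<le> 2 powr (2 * p) * (B + (LINT x|M. \<bar>f x\<bar> powr (2 * p)))" for m
      unfolding sq by (rule order_trans[OF in_Lp_diff(2)[OF q L(1) L(2)]]) (use bd in auto)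
  qed auto
  then show ?thesis
    using L in_Lp_half[OF p] by (simp add: Lp_tendsto_iff[OF p])
qed

section \<open>Functions on the lattice\<close>

lemma grid_mono: "m \<le> m' \<Longrightarrow> grid m \<subseteq> grid m'"
proof
  fix x assume m: "m \<le> m'" and x: "x \<in> grid m"
  have "2 ^ m' * x $ i \<in> \<int>" for i
  proof -
    have "(2::real) ^ m' = 2 ^ (m' - m) * 2 ^ m" using m by (simp flip: power_add)
    then have "2 ^ m' * x $ i = 2 ^ (m' - m) * (2 ^ m * x $ i)" by simp
    moreover have "2 ^ m * x $ i \<in> \<int>" using x unfolding grid_def by blast
    ultimately show ?thesis by (metis Ints_mult Ints_numeral Ints_power)
  qed
  moreover have "norm x \<le> real m'" using x m by (auto simp: grid_def)
  ultimately show "x \<in> grid m'" by (simp add: grid_def)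
qed

lemma test_spaceI: "(\<lambda>y. \<Sum>l\<in>grid m. c l * mollifier h n l y) \<in> test_space h n m"
  unfolding test_space_def by (intro CollectI exI[of _ c] conjI TrueI refl)

lemma test_space_mono:
  assumes "m \<le> m'"
  shows "test_space h n m \<subseteq> test_space h n m'"
proof
  fix f assume "f \<in> test_space h n m"
  then obtain c where f: "f = (\<lambda>y. \<Sum>l\<in>grid m. c l * mollifier h n l y)" by (auto simp: test_space_def)
  have "f y = (\<Sum>l\<in>grid m'. (if l \<in> grid m then c l else 0) * mollifier h n l y)" for y
    unfolding f using grid_mono[OF assms] finite_grid[of m']
    by (intro sum.mono_neutral_cong_left) auto
  then have "f = (\<lambda>y. \<Sum>l\<in>grid m'. (if l \<in> grid m then c l else 0) * mollifier h n l y)" by blast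
  then show "f \<in> test_space h n m'" by (simp only: test_spaceI)
qed

lemma mollifier_in_test_space:
  assumes "l \<in> grid m"
  shows "mollifier h n l \<in> test_space h n m"
proof -
  have "mollifier h n l = (\<lambda>y. \<Sum>l'\<in>grid m. (if l' = l then 1 else 0) * mollifier h n l' y)"
    using assms finite_grid[of m] by (auto simp: if_distrib[of "\<lambda>x. x * _"] sum.delta cong: if_cong)
  then show ?thesis by (rule ssubst) (rule test_spaceI)
qed

lemma test_space_linear:
  assumes "f \<in> test_space h n m" "g \<in> test_space h n m"
  shows "(\<lambda>x. a * f x + b * g x) \<in> test_space h n m"
proof -
  obtain c d where "f = (\<lambda>y. \<Sum>l\<in>grid m. c l * mollifier h n l y)" "g = (\<lambda>y. \<Sum>l\<in>grid m. d l * mollifier h n l y)"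
    using assms by (auto simp: test_space_def)
  then have "(\<lambda>x. a * f x + b * g x) = (\<lambda>y. \<Sum>l\<in>grid m. (a * c l + b * d l) * mollifier h n l y)"
    by (auto simp: sum_distrib_left sum.distrib algebra_simps)
  then show ?thesis by (simp only: test_spaceI)
qed

lemma sum_schwartz:
  assumes "finite S" "S \<noteq> {}" "\<And>l. l \<in> S \<Longrightarrow> f l \<in> schwartz"
  shows "(\<lambda>y. \<Sum>l\<in>S. c l * f l y) \<in> schwartz"
  using assms
proof (induction S rule: finite_ne_induct)
  case (insert l S)
  then show ?case using schwartz_linear[of "f l" "\<lambda>y. \<Sum>l\<in>S. c l * f l y" "c l" 1] by simp
qed (simp add: schwartz_scale)

lemma zero_in_grid: "0 \<in> grid m"
  by (simp add: grid_def)

locale lattice_field =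
  fixes \<mu> :: "((real^2 \<Rightarrow> real) \<Rightarrow> real) measure" and h :: "real^2 \<Rightarrow> real" and n :: nat
  assumes mu: "free_field_measure \<mu>" and h_smooth: "smooth_fun h"
    and h_supp: "compactly_supported h" and n: "1 \<le> n"
begin

sublocale prob_space \<mu>
  by (rule free_field_prob[OF mu])

abbreviation \<delta> :: "real^2 \<Rightarrow> real^2 \<Rightarrow> real" where
  "\<delta> \<equiv> mollifier h n"

lemma \<delta>_schwartz: "\<delta> x \<in> schwartz"
  by (rule mollifier_schwartz[OF h_smooth h_supp n])

lemma space_\<mu>: "space \<mu> = tempered"
  by (rule free_field_space[OF mu])

lemma \<delta>_measurable [measurable]: "(\<lambda>\<phi>. \<phi> (\<delta> x)) \<in> borel_measurable \<mu>"
  by (rule free_field_measurable[OF mu \<delta>_schwartz])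

lemma test_space_schwartz: "test_space h n m \<subseteq> schwartz"
proof
  fix f assume "f \<in> test_space h n m"
  then obtain c where f: "f = (\<lambda>y. \<Sum>l\<in>grid m. c l * \<delta> l y)" by (auto simp: test_space_def)
  show "f \<in> schwartz"
    unfolding f by (rule sum_schwartz[OF finite_grid]) (use zero_in_grid \<delta>_schwartz in auto)
qed

abbreviation "lattice_algebra m \<equiv> evaluation_algebra (test_space h n m) (lattice_dual h n m)"

lemma lattice_restrict_measurable [measurable]:
  "lattice_restrict h n m \<in> measurable \<mu> (lattice_algebra m)"
  unfolding evaluation_algebra_def
proof (rule measurable_measure_of[OF evaluation_generators])
  show "lattice_restrict h n m \<in> space \<mu> \<rightarrow> lattice_dual h n m"
  proof
    fix \<phi> assume "\<phi> \<in> space \<mu>"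
    then show "lattice_restrict h n m \<phi> \<in> lattice_dual h n m"
      using test_space_schwartz[of m] test_space_linear[of _ h n m]
      by (auto simp: lattice_dual_def algebraic_dual_def lattice_restrict_def space_\<mu> temperedD subset_eq)
  qed
next
  fix Y assume "Y \<in> {{\<psi> \<in> lattice_dual h n m. \<psi> f \<in> B} |f B. f \<in> test_space h n m \<and> B \<in> sets borel}"
  then obtain f B where Y: "Y = {\<psi> \<in> lattice_dual h n m. \<psi> f \<in> B}" and f: "f \<in> test_space h n m" "B \<in> sets borel"
    by blast
  have "lattice_restrict h n m -` Y \<inter> space \<mu> = (\<lambda>\<phi>. \<phi> f) -` B \<inter> space \<mu>"
    using f test_space_schwartz[of m] test_space_linear[of _ h n m]
    by (auto simp: Y lattice_dual_def algebraic_dual_def lattice_restrict_def space_\<mu> temperedD subset_eq)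
  also have "\<dots> \<in> sets \<mu>"
    by (rule measurable_sets[OF free_field_measurable[OF mu] f(2)]) (use f test_space_schwartz in auto)
  finally show "lattice_restrict h n m -` Y \<inter> space \<mu> \<in> sets \<mu>" .
qed

lemma lattice_restrict_restrict:
  "m \<le> m' \<Longrightarrow> lattice_restrict h n m (lattice_restrict h n m' \<phi>) = lattice_restrict h n m \<phi>"
  using test_space_mono[of m m' h n] by (simp add: lattice_restrict_def Int_absorb1)

lemma lattice_coordinate: "l \<in> grid m \<Longrightarrow> lattice_restrict h n m \<phi> (\<delta> l) = \<phi> (\<delta> l)"
  by (simp add: lattice_restrict_def mollifier_in_test_space)

lemma measurable_lattice_measure: "borel_measurable (lattice_measure \<mu> h n m) = borel_measurable (lattice_algebra m)"
  by (simp add: lattice_measure_def)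

lemma integral_lattice_measure:
  fixes f :: "_ \<Rightarrow> real"
  assumes "f \<in> borel_measurable (lattice_algebra m)"
  shows "integral\<^sup>L (lattice_measure \<mu> h n m) f = (LINT \<phi>|\<mu>. f (lattice_restrict h n m \<phi>))"
    and "integrable (lattice_measure \<mu> h n m) f \<longleftrightarrow> integrable \<mu> (\<lambda>\<phi>. f (lattice_restrict h n m \<phi>))"
  unfolding lattice_measure_def
  by (rule integral_distr[OF lattice_restrict_measurable assms])
    (rule integrable_distr_eq[OF lattice_restrict_measurable assms])

lemma lattice_restrict_measurable_lattice:
  assumes "m \<le> m'"
  shows "lattice_restrict h n m \<in> measurable (lattice_algebra m') (lattice_algebra m)"
  unfolding evaluation_algebra_def[of "test_space h n m"]
proof (rule measurable_measure_of[OF evaluation_generators])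
  note mono = test_space_mono[OF assms, of h n]
  show "lattice_restrict h n m \<in> space (lattice_algebra m') \<rightarrow> lattice_dual h n m"
    using mono test_space_linear[of _ h n m]
    by (auto simp: space_evaluation_algebra lattice_dual_def algebraic_dual_def lattice_restrict_def subset_eq)
  fix Y assume "Y \<in> {{\<psi> \<in> lattice_dual h n m. \<psi> f \<in> B} |f B. f \<in> test_space h n m \<and> B \<in> sets borel}"
  then obtain f B where Y: "Y = {\<psi> \<in> lattice_dual h n m. \<psi> f \<in> B}" and f: "f \<in> test_space h n m" "B \<in> sets borel"
    by blast
  have "lattice_restrict h n m -` Y \<inter> space (lattice_algebra m') = (\<lambda>\<phi>. \<phi> f) -` B \<inter> space (lattice_algebra m')"
    using f mono test_space_linear[of _ h n m]
    by (auto simp: Y space_evaluation_algebra lattice_dual_def algebraic_dual_def lattice_restrict_def subset_eq)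
  also have "\<dots> \<in> sets (lattice_algebra m')"
    by (rule measurable_sets[OF measurable_evaluation f(2)]) (use f mono in auto)
  finally show "lattice_restrict h n m -` Y \<inter> space (lattice_algebra m') \<in> sets (lattice_algebra m')" .
qed

text \<open>Everything about the colimit reduces to convergence of the pulled-back sequence over the
  tempered distributions, because the pull-backs are isometric and compatible.\<close>

lemma colimit_if_Lp_tendsto:
  assumes p: "0 < p" and f: "\<And>m. f m \<in> borel_measurable (lattice_algebra m)"
    and lim: "Lp_tendsto \<mu> p (\<lambda>m \<phi>. f m (lattice_restrict h n m \<phi>)) Y"
  shows "lattice_co_Cauchy \<mu> h n p f" and "Lp_eq \<mu> p (colimit_map \<mu> h n p f) Y"
proof -
  let ?X = "\<lambda>m \<phi>. f m (lattice_restrict h n m \<phi>)"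
  note t = lim[unfolded Lp_tendsto_iff[OF p]]
  show "Lp_eq \<mu> p (colimit_map \<mu> h n p f) Y"
    unfolding colimit_map_def by (rule Lp_tendsto_unique[OF p someI[of "Lp_tendsto \<mu> p ?X", OF lim] lim])
  have in_Lp: "in_Lp (lattice_measure \<mu> h n m) p (f m)" for m
    unfolding in_Lp_def measurable_lattice_measure
    using t f[of m] integral_lattice_measure(2)[of "\<lambda>z. \<bar>f m z\<bar> powr p" m] by (auto simp: in_Lp_def)
  have norm: "Lp_norm (lattice_measure \<mu> h n m') p (\<lambda>z. f m (lattice_restrict h n m z) - f m' z)
      = (LINT \<phi>|\<mu>. \<bar>?X m \<phi> - ?X m' \<phi>\<bar> powr p) powr (1 / p)" if "m \<le> m'" for m m'
  proof -
    have [measurable]: "(\<lambda>z. f m (lattice_restrict h n m z)) \<in> borel_measurable (lattice_algebra m')"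
      "f m' \<in> borel_measurable (lattice_algebra m')"
      using measurable_compose[OF lattice_restrict_measurable_lattice[OF that] f] f by auto
    show ?thesis
      unfolding Lp_norm_def
      by (subst integral_lattice_measure(1)) (use that in \<open>simp_all add: lattice_restrict_restrict\<close>)
  qed
  have "\<exists>N. \<forall>m m'. N \<le> m \<longrightarrow> m \<le> m' \<longrightarrow>
      Lp_norm (lattice_measure \<mu> h n m') p (\<lambda>z. f m (lattice_restrict h n m z) - f m' z) < e" if "0 < e" for e
  proof -
    \<comment> \<open>The factor \<open>2 powr p\<close> is the price of the triangle inequality without taking roots.\<close>
    define e' where "e' = e powr p / (2 * 2 powr p)"
    have "e' > 0" using that by (simp add: e'_def)
    then have "\<forall>\<^sub>F m in sequentially. (LINT \<phi>|\<mu>. \<bar>?X m \<phi> - Y \<phi>\<bar> powr p) < e'"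
      using t by (intro order_tendstoD(2)) auto
    then obtain N where N: "\<And>m. N \<le> m \<Longrightarrow> (LINT \<phi>|\<mu>. \<bar>?X m \<phi> - Y \<phi>\<bar> powr p) < e'"
      unfolding eventually_sequentially by blast
    show ?thesis
    proof (intro exI[of _ N] allI impI)
      fix m m' assume m: "N \<le> m" "m \<le> m'"
      have "(LINT \<phi>|\<mu>. \<bar>?X m \<phi> - ?X m' \<phi>\<bar> powr p) = (LINT \<phi>|\<mu>. \<bar>(?X m \<phi> - Y \<phi>) - (?X m' \<phi> - Y \<phi>)\<bar> powr p)"
        by simp
      also have "\<dots> \<le> 2 powr p * ((LINT \<phi>|\<mu>. \<bar>?X m \<phi> - Y \<phi>\<bar> powr p) + (LINT \<phi>|\<mu>. \<bar>?X m' \<phi> - Y \<phi>\<bar> powr p))"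
        using t by (intro in_Lp_diff(2) in_Lp_diff(1) p) auto
      also have "\<dots> < 2 powr p * (e' + e')"
        using N[of m] N[of m'] m by (intro mult_strict_left_mono add_strict_mono) auto
      also have "\<dots> = e powr p" by (simp add: e'_def)
      finally have "(LINT \<phi>|\<mu>. \<bar>?X m \<phi> - ?X m' \<phi>\<bar> powr p) < e powr p" .
      then have "(LINT \<phi>|\<mu>. \<bar>?X m \<phi> - ?X m' \<phi>\<bar> powr p) powr (1 / p) < (e powr p) powr (1 / p)"
        using p by (intro powr_less_mono2) (auto simp: integral_nonneg_AE)
      also have "\<dots> = e" using p that by (simp add: powr_powr)
      finally show "Lp_norm (lattice_measure \<mu> h n m') p (\<lambda>z. f m (lattice_restrict h n m z) - f m' z) < e"
        by (simp add: norm[OF m(2)])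
    qed
  qed
  then show "lattice_co_Cauchy \<mu> h n p f"
    using in_Lp by (simp add: lattice_co_Cauchy_def co_Cauchy_def)
qed

section \<open>Convergence of the lattice interaction\<close>

definition variance_at :: "real^2 \<Rightarrow> real" where
  "variance_at x = Cov (\<delta> x) (\<delta> x)"

lemma variance_at_nonneg: "0 \<le> variance_at x"
  unfolding variance_at_def by (rule free_field_Cov_nonneg[OF mu \<delta>_schwartz])

lemma exp_\<delta>: "has_bochner_integral \<mu> (\<lambda>\<phi>. exp (s * \<phi> (\<delta> x))) (exp (s\<^sup>2 * variance_at x / 2))"
  unfolding variance_at_def by (rule free_field_exp[OF mu \<delta>_schwartz])

lemma continuous_\<delta>: "\<phi> \<in> tempered \<Longrightarrow> continuous_on UNIV (\<lambda>x. \<phi> (\<delta> x))"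
  by (rule continuous_on_tempered_mollifier[OF h_smooth h_supp n])

text \<open>The characteristic function depends continuously on the point, and it determines the
  variance.\<close>

lemma continuous_variance_at: "continuous_on UNIV variance_at"
proof -
  have char: "(CLINT \<phi>|\<mu>. exp (\<i> * complex_of_real (\<phi> (\<delta> x)))) = complex_of_real (exp (- (1/2) * variance_at x))" for x
    using mu \<delta>_schwartz[of x] by (simp add: free_field_measure_def variance_at_def)
  have "(\<lambda>j. variance_at (X j)) \<longlonglongrightarrow> variance_at x" if X: "X \<longlonglongrightarrow> x" for X x
  proof -
    have "(\<lambda>j. CLINT \<phi>|\<mu>. exp (\<i> * complex_of_real (\<phi> (\<delta> (X j))))) \<longlonglongrightarrow> (CLINT \<phi>|\<mu>. exp (\<i> * complex_of_real (\<phi> (\<delta> x))))"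
    proof (rule integral_dominated_convergence[where w = "\<lambda>_. 1"])
      show "AE \<phi> in \<mu>. (\<lambda>j. exp (\<i> * complex_of_real (\<phi> (\<delta> (X j))))) \<longlonglongrightarrow> exp (\<i> * complex_of_real (\<phi> (\<delta> x)))"
      proof (rule AE_I2)
        fix \<phi> assume "\<phi> \<in> space \<mu>"
        then have "isCont (\<lambda>x. \<phi> (\<delta> x)) x"
          using continuous_\<delta> by (simp add: space_\<mu> continuous_on_eq_continuous_at)
        from isCont_tendsto_compose[OF this X]
        show "(\<lambda>j. exp (\<i> * complex_of_real (\<phi> (\<delta> (X j))))) \<longlonglongrightarrow> exp (\<i> * complex_of_real (\<phi> (\<delta> x)))"
          by (intro tendsto_intros)
      qed
    qed auto
    then have "(\<lambda>j. exp (- (1/2) * variance_at (X j))) \<longlonglongrightarrow> exp (- (1/2) * variance_at x)"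
      unfolding char tendsto_of_real_iff .
    then have "(\<lambda>j. ln (exp (- (1/2) * variance_at (X j)))) \<longlonglongrightarrow> ln (exp (- (1/2) * variance_at x))"
      by (rule tendsto_ln) simp
    then have "(\<lambda>j. (-2) * (- (1/2) * variance_at (X j))) \<longlonglongrightarrow> (-2) * (- (1/2) * variance_at x)"
      unfolding ln_exp by (rule tendsto_mult_left)
    then show ?thesis by simp
  qed
  then show ?thesis
    unfolding continuous_on_sequentially by (auto simp: o_def)
qed

lemma lattice_interaction_measurable [measurable]:
  "lattice_interaction h g k n m \<in> borel_measurable (lattice_algebra m)"
proof -
  have "(\<lambda>z. z (\<delta> l)) \<in> borel_measurable (lattice_algebra m)" if "l \<in> grid m" for l
    using mollifier_in_test_space[OF that] by (rule measurable_evaluation)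
  then show ?thesis
    unfolding lattice_interaction_def[abs_def]
    by (intro borel_measurable_times borel_measurable_const borel_measurable_sum measurable_wick)
qed

lemma lattice_interaction_restrict:
  "lattice_interaction h g k n m (lattice_restrict h n m \<phi>)
    = 1 / 2 ^ (2 * m) * (\<Sum>l\<in>grid m. wick k (variance_at l) (\<phi> (\<delta> l)) * g l)"
  by (simp add: lattice_interaction_def lattice_coordinate variance_at_def)

lemma lattice_interaction_tendsto:
  assumes "riemann_integrable g" "g \<in> borel_measurable lebesgue" "\<And>x. R < norm x \<Longrightarrow> g x = 0"
    and "\<phi> \<in> tempered"
  shows "(\<lambda>m. lattice_interaction h g k n m (lattice_restrict h n m \<phi>)) \<longlonglongrightarrow> interaction h g k n \<phi>"
  unfolding lattice_interaction_restrict interaction_def wick_field_def variance_at_def[symmetric]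
  by (rule lattice_sum_tendsto[OF assms(1-3)])
    (auto intro!: continuous_intros continuous_variance_at continuous_\<delta> assms)

text \<open>A lattice sum is an average of its terms, each multiplied by a bounded factor, because the
  number of lattice points in a ball is of the order of \<open>2 ^ (2 * m)\<close>.  Convexity then carries
  bounds on expectations from the terms to the sum.\<close>

lemma convex_lattice_sum:
  assumes conv: "convex_on UNIV \<Phi>" and nonneg: "\<And>x. 0 \<le> \<Phi> x" and cont: "continuous_on UNIV \<Phi>"
    and Z [measurable]: "\<And>l. Z l \<in> borel_measurable \<mu>"
    and zero: "\<And>l \<phi>. R < norm l \<Longrightarrow> Z l \<phi> = 0"
    and K: "\<And>m. real (card {l \<in> grid m. norm l \<le> R}) / 2 ^ (2 * m) \<le> K"
    and int: "\<And>l t. norm l \<le> R \<Longrightarrow> 0 \<le> t \<Longrightarrow> t \<le> K \<Longrightarrow> integrable \<mu> (\<lambda>\<phi>. \<Phi> (t * Z l \<phi>))"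
    and bd: "\<And>l t. norm l \<le> R \<Longrightarrow> 0 \<le> t \<Longrightarrow> t \<le> K \<Longrightarrow> (LINT \<phi>|\<mu>. \<Phi> (t * Z l \<phi>)) \<le> B"
    and B0: "\<Phi> 0 \<le> B"
  shows "integrable \<mu> (\<lambda>\<phi>. \<Phi> (1 / 2 ^ (2 * m) * (\<Sum>l\<in>grid m. Z l \<phi>))) \<and>
    (LINT \<phi>|\<mu>. \<Phi> (1 / 2 ^ (2 * m) * (\<Sum>l\<in>grid m. Z l \<phi>))) \<le> B"
proof -
  let ?S = "{l \<in> grid m. norm l \<le> R}"
  let ?X = "\<lambda>\<phi>. 1 / 2 ^ (2 * m) * (\<Sum>l\<in>grid m. Z l \<phi>)"
  have fin: "finite ?S" using finite_grid[of m] by simp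
  have X: "?X \<phi> = 1 / 2 ^ (2 * m) * (\<Sum>l\<in>?S. Z l \<phi>)" for \<phi>
  proof -
    have "(\<Sum>l\<in>grid m. Z l \<phi>) = (\<Sum>l\<in>?S. Z l \<phi>)"
      using finite_grid[of m] zero by (intro sum.mono_neutral_right) (auto simp: not_le[symmetric])
    then show ?thesis by simp
  qed
  have [measurable]: "\<Phi> \<in> borel_measurable borel"
    using cont by (rule borel_measurable_continuous_onI)
  show ?thesis
  proof (cases "?S = {}")
    case True
    have "(\<Sum>l\<in>?S. Z l \<phi>) = 0" for \<phi> unfolding True by simp
    then show ?thesis unfolding X using B0 by (simp add: prob_space)
  next
    case False
    \<comment> \<open>The sum is the mean over \<open>?S\<close> of the terms multiplied by \<open>t\<close>.\<close>
    define M where "M = real (card ?S)"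
    define t where "t = M / 2 ^ (2 * m)"
    have M: "M > 0" using False fin by (simp add: M_def card_gt_0_iff)
    have t: "0 \<le> t" "t \<le> K" using K[of m] M by (auto simp: t_def M_def)
    have le: "\<Phi> (?X \<phi>) \<le> (\<Sum>l\<in>?S. (1 / M) * \<Phi> (t * Z l \<phi>))" for \<phi>
    proof -
      have "?X \<phi> = (\<Sum>l\<in>?S. (1 / M) *\<^sub>R (t * Z l \<phi>))"
        unfolding X using M by (simp add: t_def sum_distrib_left)
      moreover have "\<Phi> (\<Sum>l\<in>?S. (1 / M) *\<^sub>R (t * Z l \<phi>)) \<le> (\<Sum>l\<in>?S. (1 / M) * \<Phi> (t * Z l \<phi>))"
        using M False fin by (intro convex_on_sum[OF fin False conv]) (auto simp: M_def)
      ultimately show ?thesis by simp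
    qed
    have i: "integrable \<mu> (\<lambda>\<phi>. \<Sum>l\<in>?S. (1 / M) * \<Phi> (t * Z l \<phi>))"
      using int t by (intro Bochner_Integration.integrable_sum integrable_mult_right) auto
    have iX: "integrable \<mu> (\<lambda>\<phi>. \<Phi> (?X \<phi>))"
    proof (rule Bochner_Integration.integrable_bound[OF i])
      show "(\<lambda>\<phi>. \<Phi> (?X \<phi>)) \<in> borel_measurable \<mu>" by measurable
      show "AE \<phi> in \<mu>. norm (\<Phi> (?X \<phi>)) \<le> norm (\<Sum>l\<in>?S. (1 / M) * \<Phi> (t * Z l \<phi>))"
      proof (rule AE_I2)
        fix \<phi>
        show "norm (\<Phi> (?X \<phi>)) \<le> norm (\<Sum>l\<in>?S. (1 / M) * \<Phi> (t * Z l \<phi>))"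
          using le[of \<phi>] nonneg[of "?X \<phi>"] by simp
      qed
    qed
    have "(LINT \<phi>|\<mu>. \<Phi> (?X \<phi>)) \<le> (LINT \<phi>|\<mu>. (\<Sum>l\<in>?S. (1 / M) * \<Phi> (t * Z l \<phi>)))"
      by (intro integral_mono iX i le)
    also have "\<dots> = (\<Sum>l\<in>?S. (1 / M) * (LINT \<phi>|\<mu>. \<Phi> (t * Z l \<phi>)))"
      using int t by (subst Bochner_Integration.integral_sum) auto
    also have "\<dots> \<le> (\<Sum>l\<in>?S. (1 / M) * B)"
      using bd t M by (intro sum_mono mult_left_mono) auto
    also have "\<dots> = B" using M by (simp add: M_def)
    finally show ?thesis using iX by blast
  qed
qed

end

lemma wick_0: "wick 0 c t = 1"
  by (simp add: wick_def)

lemma wick_1: "wick (Suc 0) c t = t"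
  by (simp add: wick_def)

lemma wick_at_0_0: "1 \<le> k \<Longrightarrow> wick k 0 0 = 0"
proof -
  assume k: "1 \<le> k"
  have "(-1) ^ j * fact k / (fact (k - 2 * j) * fact j * 2 ^ j) * 0 ^ j * 0 ^ (k - 2 * j) = (0::real)" for j
    using k by (cases "j = 0") auto
  then show ?thesis unfolding wick_def by (intro sum.neutral ballI)
qed

text \<open>For large \<open>t\<close> the leading power dominates the others uniformly in \<open>c\<close>; on the remaining
  bounded range the exponential bound is uniform.\<close>

lemma wick_even_bounded_below:
  assumes "even k" "2 \<le> k"
  obtains W where "0 \<le> W" "\<And>c t. 0 \<le> c \<Longrightarrow> c \<le> C \<Longrightarrow> - W \<le> wick k c t"
proof -
  define a :: "nat \<Rightarrow> real" where "a j = fact k / (fact (k - 2 * j) * fact j * 2 ^ j)" for j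
  have a: "0 \<le> a j" for j by (simp add: a_def)
  define A where "A = (\<Sum>j = 1..k div 2. a j * \<bar>C\<bar> ^ j)"
  have A: "0 \<le> A" unfolding A_def by (intro sum_nonneg mult_nonneg_nonneg a) auto
  define W where "W = fact k * exp (A + 1 + \<bar>C\<bar> / 2)"
  have "- W \<le> wick k c t" if c: "0 \<le> c" "c \<le> C" for c t
  proof (cases "\<bar>t\<bar> \<le> A + 1")
    case True
    have "\<bar>wick k c t\<bar> \<le> fact k * exp (\<bar>t\<bar> + \<bar>c\<bar> / 2)" by (rule abs_wick_le_exp)
    also have "\<dots> \<le> W" unfolding W_def using True c by (intro mult_left_mono) auto
    finally show ?thesis by linarith
  next
    case False
    then have t: "1 \<le> \<bar>t\<bar>" "A \<le> \<bar>t\<bar>" using A by auto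
    have term_le: "\<bar>(-1) ^ j * a j * c ^ j * t ^ (k - 2 * j)\<bar> \<le> a j * \<bar>C\<bar> ^ j * \<bar>t\<bar> ^ (k - 2)" if "j \<in> {1..k div 2}" for j
    proof -
      have "\<bar>t\<bar> ^ (k - 2 * j) \<le> \<bar>t\<bar> ^ (k - 2)" using that t by (intro power_increasing) auto
      moreover have "\<bar>c\<bar> ^ j \<le> \<bar>C\<bar> ^ j" using c by (intro power_mono) auto
      ultimately have "a j * \<bar>c\<bar> ^ j * \<bar>t\<bar> ^ (k - 2 * j) \<le> a j * \<bar>C\<bar> ^ j * \<bar>t\<bar> ^ (k - 2)"
        using a by (intro mult_mono mult_nonneg_nonneg) auto
      then show ?thesis using a[of j] by (simp add: abs_mult power_abs)
    qed
    have "wick k c t = (\<Sum>j = 0..k div 2. (-1) ^ j * a j * c ^ j * t ^ (k - 2 * j))"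
      by (simp add: wick_def a_def)
    also have "\<dots> = t ^ k + (\<Sum>j = 1..k div 2. (-1) ^ j * a j * c ^ j * t ^ (k - 2 * j))"
      by (subst sum.atLeast_Suc_atMost) (auto simp: a_def)
    also have "\<dots> \<ge> t ^ k - A * \<bar>t\<bar> ^ (k - 2)"
    proof -
      have "\<bar>\<Sum>j = 1..k div 2. (-1) ^ j * a j * c ^ j * t ^ (k - 2 * j)\<bar> \<le> (\<Sum>j = 1..k div 2. a j * \<bar>C\<bar> ^ j * \<bar>t\<bar> ^ (k - 2))"
        by (rule order_trans[OF sum_abs sum_mono[OF term_le]])
      also have "\<dots> = A * \<bar>t\<bar> ^ (k - 2)" by (simp add: A_def sum_distrib_right)
      finally show ?thesis by linarith
    qed
    moreover have "A * \<bar>t\<bar> ^ (k - 2) \<le> t ^ k"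
    proof -
      have "A \<le> \<bar>t\<bar> ^ 2" using t self_le_power[of "\<bar>t\<bar>" 2] by simp
      then have "A * \<bar>t\<bar> ^ (k - 2) \<le> \<bar>t\<bar> ^ 2 * \<bar>t\<bar> ^ (k - 2)" by (intro mult_right_mono) auto
      also have "\<dots> = \<bar>t\<bar> ^ k" 
        unfolding power_add[symmetric] le_add_diff_inverse[OF assms(2)] ..
      also have "\<dots> = t ^ k" using assms(1) by (rule power_even_abs)
      finally show ?thesis .
    qed
    moreover have "0 \<le> W" by (simp add: W_def)
    ultimately show ?thesis by linarith
  qed
  moreover have "0 \<le> W" by (simp add: W_def)
  ultimately show ?thesis using that by blast
qed

text \<open>\<open>R\<close> bounds the support of the cutoff and \<open>B\<close> its values.\<close>

locale cutoff_field = lattice_field +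
  fixes g :: "real^2 \<Rightarrow> real" and R B :: real
  assumes g_riemann: "riemann_integrable g" and g_meas: "g \<in> borel_measurable lebesgue"
    and g_supp: "\<And>x. R < norm x \<Longrightarrow> g x = 0" and g_bd: "\<And>x. \<bar>g x\<bar> \<le> B"
begin

lemma B_nonneg: "0 \<le> B"
  using g_bd[of 0] by linarith

abbreviation pulled_back :: "nat \<Rightarrow> nat \<Rightarrow> ((real^2 \<Rightarrow> real) \<Rightarrow> real) \<Rightarrow> real" where
  "pulled_back k m \<phi> \<equiv> lattice_interaction h g k n m (lattice_restrict h n m \<phi>)"

lemma pulled_back_measurable [measurable]: "pulled_back k m \<in> borel_measurable \<mu>"
  by (rule measurable_compose[OF lattice_restrict_measurable lattice_interaction_measurable])

lemma pulled_back_tendsto: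
  "\<phi> \<in> space \<mu> \<Longrightarrow> (\<lambda>m. pulled_back k m \<phi>) \<longlonglongrightarrow> interaction h g k n \<phi>"
  by (rule lattice_interaction_tendsto[OF g_riemann g_meas g_supp]) (simp_all add: space_\<mu>)

lemma variance_bounded:
  obtains C where "0 \<le> C" "\<And>x. norm x \<le> R \<Longrightarrow> variance_at x \<le> C"
proof -
  obtain C where "0 \<le> C" "\<And>x. norm x \<le> R \<Longrightarrow> \<bar>variance_at x\<bar> \<le> C"
    using continuous_bounded_cball[OF continuous_variance_at] by metis
  then show ?thesis using that[of C] by (meson abs_le_D1)
qed

lemma point_count_bounded:
  obtains K where "0 \<le> K" "\<And>m. real (card {l \<in> grid m. norm l \<le> R}) / 2 ^ (2 * m) \<le> K"
proof -
  obtain K where K: "\<And>m. real (card {l \<in> grid m. norm l \<le> R}) / 2 ^ (2 * m) \<le> K"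
    using card_grid_ball_le by blast
  have "0 \<le> K" by (rule order_trans[OF _ K[of 0]]) simp
  then show ?thesis using K that by blast
qed

text \<open>A Wick power is dominated by a multiple of \<open>exp (\<bar>\<phi> (\<delta> x)\<bar>)\<close>, whose powers have Gaussian
  expectations.\<close>

lemma wick_even_moment:
  assumes C: "variance_at x \<le> C"
  shows "integrable \<mu> (\<lambda>\<phi>. wick k (variance_at x) (\<phi> (\<delta> x)) ^ (2 * N))"
    and "(LINT \<phi>|\<mu>. wick k (variance_at x) (\<phi> (\<delta> x)) ^ (2 * N)) \<le> fact k ^ (2 * N) * exp (real N * C) * (2 * exp (2 * (real N)\<^sup>2 * C))"
proof -
  let ?c = "variance_at x" and ?M = "fact k ^ (2 * N) * exp (real N * C) :: real"
  let ?D = "\<lambda>\<phi>. ?M * (exp ((2 * real N) * \<phi> (\<delta> x)) + exp ((- 2 * real N) * \<phi> (\<delta> x)))"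
  have e: "integrable \<mu> (\<lambda>\<phi>. exp (s * \<phi> (\<delta> x)))" "(LINT \<phi>|\<mu>. exp (s * \<phi> (\<delta> x))) = exp (s\<^sup>2 * ?c / 2)" for s
    using exp_\<delta>[of s x] by (simp_all add: has_bochner_integral_iff)
  have le: "wick k ?c t ^ (2 * N) \<le> ?M * (exp ((2 * real N) * t) + exp ((- 2 * real N) * t))" for t
  proof -
    have "wick k ?c t ^ (2 * N) = \<bar>wick k ?c t\<bar> ^ (2 * N)" by (simp add: power_even_abs)
    also have "\<dots> \<le> (fact k * exp (\<bar>t\<bar> + \<bar>?c\<bar> / 2)) ^ (2 * N)"
      by (intro power_mono abs_wick_le_exp) auto
    also have "\<dots> = fact k ^ (2 * N) * (exp (real N * ?c) * exp (2 * real N * \<bar>t\<bar>))"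
      using variance_at_nonneg[of x] by (simp add: power_mult_distrib exp_of_nat_mult[symmetric] mult_exp_exp algebra_simps)
    also have "\<dots> \<le> fact k ^ (2 * N) * (exp (real N * C) * (exp ((2 * real N) * t) + exp ((- 2 * real N) * t)))"
    proof -
      have "exp (2 * real N * \<bar>t\<bar>) \<le> exp ((2 * real N) * t) + exp ((- 2 * real N) * t)"
        by (cases "t \<ge> 0") auto
      then show ?thesis using C by (intro mult_left_mono mult_mono) (auto intro: mult_left_mono)
    qed
    finally show ?thesis by (simp add: mult.assoc)
  qed
  have iD: "integrable \<mu> ?D" by (intro integrable_mult_right Bochner_Integration.integrable_add e)
  show i: "integrable \<mu> (\<lambda>\<phi>. wick k ?c (\<phi> (\<delta> x)) ^ (2 * N))"
  proof (rule Bochner_Integration.integrable_bound[OF iD])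
    show "AE \<phi> in \<mu>. norm (wick k ?c (\<phi> (\<delta> x)) ^ (2 * N)) \<le> norm (?D \<phi>)"
    proof (rule AE_I2)
      fix \<phi>
      have "0 \<le> wick k ?c (\<phi> (\<delta> x)) ^ (2 * N)" by simp
      then show "norm (wick k ?c (\<phi> (\<delta> x)) ^ (2 * N)) \<le> norm (?D \<phi>)"
        using le[of "\<phi> (\<delta> x)"] unfolding real_norm_def by linarith
    qed
  qed measurable
  have "(LINT \<phi>|\<mu>. wick k ?c (\<phi> (\<delta> x)) ^ (2 * N)) \<le> (LINT \<phi>|\<mu>. ?D \<phi>)"
    by (intro integral_mono i iD le)
  also have "\<dots> = ?M * (exp ((2 * real N)\<^sup>2 * ?c / 2) + exp ((- 2 * real N)\<^sup>2 * ?c / 2))"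
    by (simp only: integral_mult_right_zero Bochner_Integration.integral_add[OF e(1) e(1)] e(2))
  also have "\<dots> = ?M * (2 * exp (2 * (real N)\<^sup>2 * ?c))"
    by (simp add: power2_eq_square)
  also have "\<dots> \<le> ?M * (2 * exp (2 * (real N)\<^sup>2 * C))"
    using C by (intro mult_left_mono) (auto intro: mult_left_mono)
  finally show "(LINT \<phi>|\<mu>. wick k ?c (\<phi> (\<delta> x)) ^ (2 * N)) \<le> ?M * (2 * exp (2 * (real N)\<^sup>2 * C))" .
qed

text \<open>An even power above \<open>q\<close> is convex and dominates the power \<open>q\<close> up to a constant.\<close>

lemma pulled_back_moments_bounded:
  assumes q: "0 < q"
  obtains D where "\<And>m. integrable \<mu> (\<lambda>\<phi>. \<bar>pulled_back k m \<phi>\<bar> powr q)"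
    "\<And>m. (LINT \<phi>|\<mu>. \<bar>pulled_back k m \<phi>\<bar> powr q) \<le> D"
proof -
  obtain C where C: "0 \<le> C" "\<And>x. norm x \<le> R \<Longrightarrow> variance_at x \<le> C" using variance_bounded by blast
  obtain K where K: "0 \<le> K" "\<And>m. real (card {l \<in> grid m. norm l \<le> R}) / 2 ^ (2 * m) \<le> K"
    using point_count_bounded by blast
  obtain N where N: "q \<le> real N" using real_arch_simple by blast
  then have N1: "1 \<le> N" using q by linarith
  define Z where "Z l \<phi> = wick k (variance_at l) (\<phi> (\<delta> l)) * g l" for l \<phi>
  have [measurable]: "Z l \<in> borel_measurable \<mu>" for l unfolding Z_def[abs_def] by measurable
  define D where "D = (K * B) ^ (2 * N) * (fact k ^ (2 * N) * exp (real N * C) * (2 * exp (2 * (real N)\<^sup>2 * C)))"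
  have D0: "0 \<le> D" using K B_nonneg by (auto simp: D_def)
  have Zt: "(t * Z l \<phi>) ^ (2 * N) = (t * g l) ^ (2 * N) * wick k (variance_at l) (\<phi> (\<delta> l)) ^ (2 * N)" for t l \<phi>
    by (simp add: Z_def power_mult_distrib mult_ac)
  have "integrable \<mu> (\<lambda>\<phi>. (1 / 2 ^ (2 * m) * (\<Sum>l\<in>grid m. Z l \<phi>)) ^ (2 * N)) \<and>
    (LINT \<phi>|\<mu>. (1 / 2 ^ (2 * m) * (\<Sum>l\<in>grid m. Z l \<phi>)) ^ (2 * N)) \<le> D" for m
  proof (rule convex_lattice_sum[where \<Phi> = "\<lambda>x. x ^ (2 * N)" and R = R and K = K])
    show "convex_on UNIV (\<lambda>x::real. x ^ (2 * N))" by (rule convex_power_even) simp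
    show "continuous_on UNIV (\<lambda>x::real. x ^ (2 * N))" by (intro continuous_intros)
    show "0 ^ (2 * N) \<le> D" using N1 D0 by (simp add: power_0_left)
    fix l :: "real^2" and t :: real assume l: "norm l \<le> R" and t: "0 \<le> t" "t \<le> K"
    show "integrable \<mu> (\<lambda>\<phi>. (t * Z l \<phi>) ^ (2 * N))"
      unfolding Zt by (rule integrable_mult_right) (rule wick_even_moment(1)[OF C(2)[OF l]])
    have "(LINT \<phi>|\<mu>. (t * Z l \<phi>) ^ (2 * N)) = (t * g l) ^ (2 * N) * (LINT \<phi>|\<mu>. wick k (variance_at l) (\<phi> (\<delta> l)) ^ (2 * N))"
      unfolding Zt by simp
    also have "\<dots> \<le> D" unfolding D_def
    proof (intro mult_mono wick_even_moment C l)
      have "\<bar>t * g l\<bar> \<le> K * B" using t g_bd[of l] by (auto simp: abs_mult intro!: mult_mono)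
      then have "\<bar>t * g l\<bar> ^ (2 * N) \<le> (K * B) ^ (2 * N)" by (intro power_mono) auto
      then show "(t * g l) ^ (2 * N) \<le> (K * B) ^ (2 * N)" by (simp add: power_even_abs)
    qed (use K B_nonneg in auto)
    finally show "(LINT \<phi>|\<mu>. (t * Z l \<phi>) ^ (2 * N)) \<le> D" .
  qed (auto simp: Z_def g_supp K)
  note bound = conjunct1[OF this] conjunct2[OF this]
  have X: "pulled_back k m \<phi> = 1 / 2 ^ (2 * m) * (\<Sum>l\<in>grid m. Z l \<phi>)" for m \<phi>
    by (simp add: lattice_interaction_restrict Z_def)
  have le: "\<bar>x\<bar> powr q \<le> 1 + x ^ (2 * N)" for x
  proof (cases "\<bar>x\<bar> \<le> 1")
    case True
    then have "\<bar>x\<bar> powr q \<le> 1" using q powr_le1[of q "\<bar>x\<bar>"] by simp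
    moreover have "0 \<le> x ^ (2 * N)" by simp
    ultimately show ?thesis by linarith
  next
    case False
    then have "\<bar>x\<bar> powr q \<le> \<bar>x\<bar> powr real (2 * N)" using N by (intro powr_mono) auto
    also have "\<dots> = x ^ (2 * N)" using False by (subst powr_realpow) (auto simp: power_even_abs)
    finally show ?thesis by simp
  qed
  have i1: "integrable \<mu> (\<lambda>\<phi>. 1 + pulled_back k m \<phi> ^ (2 * N))" for m
    using bound(1)[of m] by (simp add: X)
  have i: "integrable \<mu> (\<lambda>\<phi>. \<bar>pulled_back k m \<phi>\<bar> powr q)" for m
  proof (rule Bochner_Integration.integrable_bound[OF i1[of m]])
    show "AE \<phi> in \<mu>. norm (\<bar>pulled_back k m \<phi>\<bar> powr q) \<le> norm (1 + pulled_back k m \<phi> ^ (2 * N))"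
    proof (rule AE_I2)
      fix \<phi> show "norm (\<bar>pulled_back k m \<phi>\<bar> powr q) \<le> norm (1 + pulled_back k m \<phi> ^ (2 * N))"
        using le[of "pulled_back k m \<phi>"] powr_ge_zero[of "\<bar>pulled_back k m \<phi>\<bar>" q]
        unfolding real_norm_def by linarith
    qed
  qed measurable
  have "(LINT \<phi>|\<mu>. \<bar>pulled_back k m \<phi>\<bar> powr q) \<le> 1 + D" for m
  proof -
    have "(LINT \<phi>|\<mu>. \<bar>pulled_back k m \<phi>\<bar> powr q) \<le> (LINT \<phi>|\<mu>. 1 + pulled_back k m \<phi> ^ (2 * N))"
      by (intro integral_mono i i1 le)
    also have "\<dots> = 1 + (LINT \<phi>|\<mu>. pulled_back k m \<phi> ^ (2 * N))"
      using bound(1)[of m] unfolding X by (subst Bochner_Integration.integral_add) (auto simp: prob_space)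
    finally show ?thesis using bound(2)[of m] by (simp add: X)
  qed
  with i show ?thesis by (rule that)
qed

lemma pulled_back_Lp_tendsto:
  assumes "0 < p"
  shows "Lp_tendsto \<mu> p (pulled_back k) (interaction h g k n)"
proof -
  obtain D where D: "\<And>m. integrable \<mu> (\<lambda>\<phi>. \<bar>pulled_back k m \<phi>\<bar> powr (2 * p))"
    "\<And>m. (LINT \<phi>|\<mu>. \<bar>pulled_back k m \<phi>\<bar> powr (2 * p)) \<le> D"
    using pulled_back_moments_bounded[of "2 * p" k] assms by auto
  show ?thesis
    by (rule Lp_tendsto_if_pointwise_and_bounded[OF assms _ pulled_back_tendsto D]) auto
qed

lemma interaction_colimit:
  assumes "0 < p"
  shows "lattice_co_Cauchy \<mu> h n p (lattice_interaction h g k n)"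
    and "Lp_eq \<mu> p (colimit_map \<mu> h n p (lattice_interaction h g k n)) (interaction h g k n)"
  using colimit_if_Lp_tendsto[OF assms lattice_interaction_measurable pulled_back_Lp_tendsto[OF assms]]
  by blast+

lemma exp_interaction_colimit:
  assumes p: "0 < p"
    and int: "\<And>m. integrable \<mu> (\<lambda>\<phi>. exp (- (2 * p) * pulled_back k m \<phi>))"
    and bd: "\<And>m. (LINT \<phi>|\<mu>. exp (- (2 * p) * pulled_back k m \<phi>)) \<le> D"
  shows "lattice_co_Cauchy \<mu> h n p (\<lambda>m z. exp (- lattice_interaction h g k n m z))"
    and "Lp_eq \<mu> p (colimit_map \<mu> h n p (\<lambda>m z. exp (- lattice_interaction h g k n m z)))
      (\<lambda>\<phi>. exp (- interaction h g k n \<phi>))"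
proof -
  have pw: "\<bar>exp (- x)\<bar> powr (2 * p) = exp (- (2 * p) * x)" for x :: real
    by (simp add: exp_powr_real mult.commute)
  have "Lp_tendsto \<mu> p (\<lambda>m \<phi>. exp (- pulled_back k m \<phi>)) (\<lambda>\<phi>. exp (- interaction h g k n \<phi>))"
  proof (rule Lp_tendsto_if_pointwise_and_bounded[OF p])
    show "(\<lambda>m. exp (- pulled_back k m \<phi>)) \<longlonglongrightarrow> exp (- interaction h g k n \<phi>)" if "\<phi> \<in> space \<mu>" for \<phi>
      by (intro tendsto_intros pulled_back_tendsto that)
    show "integrable \<mu> (\<lambda>\<phi>. \<bar>exp (- pulled_back k m \<phi>)\<bar> powr (2 * p))" for m
      unfolding pw by (rule int)
    show "(LINT \<phi>|\<mu>. \<bar>exp (- pulled_back k m \<phi>)\<bar> powr (2 * p)) \<le> D" for m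
      unfolding pw by (rule bd)
  qed measurable
  moreover have "(\<lambda>z. exp (- lattice_interaction h g k n m z)) \<in> borel_measurable (lattice_algebra m)" for m
    by measurable
  ultimately show "lattice_co_Cauchy \<mu> h n p (\<lambda>m z. exp (- lattice_interaction h g k n m z))"
    "Lp_eq \<mu> p (colimit_map \<mu> h n p (\<lambda>m z. exp (- lattice_interaction h g k n m z)))
      (\<lambda>\<phi>. exp (- interaction h g k n \<phi>))"
    using colimit_if_Lp_tendsto[OF p, of "\<lambda>m z. exp (- lattice_interaction h g k n m z)"] by blast+
qed

lemma exp_pulled_back_bounded_if_bounded_below:
  assumes q: "0 \<le> q" and lower: "\<And>m. AE \<phi> in \<mu>. - L \<le> pulled_back k m \<phi>"
  shows "integrable \<mu> (\<lambda>\<phi>. exp (- q * pulled_back k m \<phi>))"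
    and "(LINT \<phi>|\<mu>. exp (- q * pulled_back k m \<phi>)) \<le> exp (q * L)"
proof -
  have le: "AE \<phi> in \<mu>. exp (- q * pulled_back k m \<phi>) \<le> exp (q * L)"
    using lower[of m]
  proof eventually_elim
    case (elim \<phi>)
    have "q * (- L) \<le> q * pulled_back k m \<phi>" using q elim by (intro mult_left_mono)
    then show ?case by simp
  qed
  show i: "integrable \<mu> (\<lambda>\<phi>. exp (- q * pulled_back k m \<phi>))"
    by (rule integrable_const_bound[where B = "exp (q * L)"]) (use le in auto)
  have "(LINT \<phi>|\<mu>. exp (- q * pulled_back k m \<phi>)) \<le> (LINT \<phi>|\<mu>. exp (q * L))"
    by (intro integral_mono_AE i le) auto
  then show "(LINT \<phi>|\<mu>. exp (- q * pulled_back k m \<phi>)) \<le> exp (q * L)" by (simp add: prob_space)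
qed

lemma pulled_back_bounded_below:
  assumes K: "\<And>m. real (card {l \<in> grid m. norm l \<le> R}) / 2 ^ (2 * m) \<le> K" and W: "0 \<le> W"
    and lower: "\<And>l. norm l \<le> R \<Longrightarrow> AE \<phi> in \<mu>. - W \<le> wick k (variance_at l) (\<phi> (\<delta> l)) * g l"
  shows "AE \<phi> in \<mu>. - (K * W) \<le> pulled_back k m \<phi>"
proof -
  let ?S = "{l \<in> grid m. norm l \<le> R}"
  have fin: "finite ?S" using finite_grid[of m] by simp
  have "AE \<phi> in \<mu>. \<forall>l\<in>?S. - W \<le> wick k (variance_at l) (\<phi> (\<delta> l)) * g l"
    using fin lower by (subst AE_finite_all) auto
  then show ?thesis
  proof eventually_elim
    case (elim \<phi>)
    have "pulled_back k m \<phi> = 1 / 2 ^ (2 * m) * (\<Sum>l\<in>?S. wick k (variance_at l) (\<phi> (\<delta> l)) * g l)"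
      unfolding lattice_interaction_restrict using finite_grid[of m] g_supp
      by (intro arg_cong[where f = "\<lambda>x. 1 / 2 ^ (2 * m) * x"] sum.mono_neutral_right) (auto simp: not_le[symmetric])
    moreover have "(\<Sum>l\<in>?S. - W) \<le> (\<Sum>l\<in>?S. wick k (variance_at l) (\<phi> (\<delta> l)) * g l)"
      using elim by (intro sum_mono) auto
    ultimately have "1 / 2 ^ (2 * m) * (\<Sum>l\<in>?S. - W) \<le> pulled_back k m \<phi>"
      by (simp only:) (intro mult_left_mono, auto)
    moreover have "1 / 2 ^ (2 * m) * (\<Sum>l\<in>?S. - W) = - (real (card ?S) / 2 ^ (2 * m) * W)"
      by simp
    moreover have "real (card ?S) / 2 ^ (2 * m) * W \<le> K * W"
      by (intro mult_right_mono K W)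
    ultimately show ?case by linarith
  qed
qed

text \<open>For \<open>k = 1\<close> each term is Gaussian, and \<open>exp\<close> is convex.\<close>

lemma exp_linear_moments_bounded:
  obtains D where "\<And>m. integrable \<mu> (\<lambda>\<phi>. exp (- q * pulled_back (Suc 0) m \<phi>))"
    "\<And>m. (LINT \<phi>|\<mu>. exp (- q * pulled_back (Suc 0) m \<phi>)) \<le> D"
proof -
  obtain C where C: "0 \<le> C" "\<And>x. norm x \<le> R \<Longrightarrow> variance_at x \<le> C" using variance_bounded by blast
  obtain K where K: "0 \<le> K" "\<And>m. real (card {l \<in> grid m. norm l \<le> R}) / 2 ^ (2 * m) \<le> K"
    using point_count_bounded by blast
  define Z where "Z l \<phi> = - q * g l * \<phi> (\<delta> l)" for l \<phi>
  have [measurable]: "Z l \<in> borel_measurable \<mu>" for l unfolding Z_def[abs_def] by measurable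
  define D where "D = exp ((q * K * B)\<^sup>2 * C / 2)"
  have e: "has_bochner_integral \<mu> (\<lambda>\<phi>. exp (t * Z l \<phi>)) (exp ((- t * q * g l)\<^sup>2 * variance_at l / 2))"
    for t :: real and l :: "real^2"
    using exp_\<delta>[of "- t * q * g l" l] by (simp add: Z_def mult_ac)
  have "integrable \<mu> (\<lambda>\<phi>. exp (1 / 2 ^ (2 * m) * (\<Sum>l\<in>grid m. Z l \<phi>))) \<and>
    (LINT \<phi>|\<mu>. exp (1 / 2 ^ (2 * m) * (\<Sum>l\<in>grid m. Z l \<phi>))) \<le> D" for m
  proof (rule convex_lattice_sum[where \<Phi> = exp and R = R and K = K])
    show "convex_on UNIV (exp :: real \<Rightarrow> real)" by (rule exp_convex)
    show "continuous_on UNIV (exp :: real \<Rightarrow> real)" by (intro continuous_intros)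
    show "exp 0 \<le> D" using C by (simp add: D_def)
    fix l :: "real^2" and t :: real assume l: "norm l \<le> R" and t: "0 \<le> t" "t \<le> K"
    show "integrable \<mu> (\<lambda>\<phi>. exp (t * Z l \<phi>))" using e by (simp add: has_bochner_integral_iff)
    have "(LINT \<phi>|\<mu>. exp (t * Z l \<phi>)) = exp ((- t * q * g l)\<^sup>2 * variance_at l / 2)"
      using e by (simp add: has_bochner_integral_iff)
    also have "\<dots> \<le> D"
    proof -
      have "\<bar>- t * q * g l\<bar> \<le> \<bar>q * K * B\<bar>"
      proof -
        have "\<bar>t\<bar> * \<bar>q\<bar> * \<bar>g l\<bar> \<le> K * \<bar>q\<bar> * B"
          using t g_bd[of l] B_nonneg K(1) by (intro mult_mono) auto
        then show ?thesis using B_nonneg K(1) by (simp add: abs_mult mult.commute)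
      qed
      then have "(- t * q * g l)\<^sup>2 \<le> (q * K * B)\<^sup>2" by (rule abs_le_square_iff[THEN iffD1])
      then have "(- t * q * g l)\<^sup>2 * variance_at l \<le> (q * K * B)\<^sup>2 * C"
        using C(2)[OF l] variance_at_nonneg[of l] by (intro mult_mono) auto
      then show ?thesis by (simp add: D_def)
    qed
    finally show "(LINT \<phi>|\<mu>. exp (t * Z l \<phi>)) \<le> D" .
  qed (auto simp: Z_def g_supp K)
  note bound = conjunct1[OF this] conjunct2[OF this]
  have X: "- q * pulled_back (Suc 0) m \<phi> = 1 / 2 ^ (2 * m) * (\<Sum>l\<in>grid m. Z l \<phi>)" for m \<phi>
    by (simp add: lattice_interaction_restrict Z_def wick_1 sum_distrib_left mult_ac sum_divide_distrib flip: sum_negf)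
  show ?thesis
    by (rule that[of D]) (simp_all only: X bound)
qed

end

section \<open>Integration by parts\<close>

lemma integrable_if_supported:
  fixes F :: "real^2 \<Rightarrow> real"
  assumes "continuous_on UNIV F" "\<And>x. R < norm x \<Longrightarrow> F x = 0"
  shows "integrable lborel F"
proof -
  have "integrable lborel (\<lambda>x. indicator (cball 0 R) x *\<^sub>R F x)"
    by (intro borel_integrable_compact continuous_on_subset[OF assms(1)]) auto
  moreover have "(\<lambda>x. indicator (cball 0 R) x *\<^sub>R F x) = F"
    using assms(2) by (auto simp: indicator_def fun_eq_iff)
  ultimately show ?thesis by simp
qed

lemma lborel_integral_translate:
  fixes F :: "real^2 \<Rightarrow> real"
  assumes "F \<in> borel_measurable borel"
  shows "(LINT x|lborel. F (c + x)) = (LINT x|lborel. F x)"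
    using integral_distr[of "(+) c" lborel borel F] assms lborel_distr_plus[of c] by simp

text \<open>By translation invariance the difference quotients have integral zero.\<close>

lemma integral_derivative_along_axis:
  fixes F G :: "real^2 \<Rightarrow> real"
  assumes F: "continuous_on UNIV F" "\<And>x. R < norm x \<Longrightarrow> F x = 0"
    and G: "continuous_on UNIV G" "\<And>x. R < norm x \<Longrightarrow> G x = 0"
    and D: "\<And>x t. ((\<lambda>t. F (x + t *\<^sub>R axis i 1)) has_real_derivative G (x + t *\<^sub>R axis i 1)) (at t)"
  shows "(LINT x|lborel. G x) = 0"
proof -
  let ?e = "axis i 1 :: real^2"
  define t where "t j = inverse (real (Suc j))" for j
  have t: "0 < t j" "t j \<le> 1" for j by (simp_all add: t_def inverse_le_1_iff)
  define Q where "Q j x = (F (x + t j *\<^sub>R ?e) - F x) / t j" for j x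
  obtain C where C: "\<And>x. \<bar>G x\<bar> \<le> C"
    using bounded_range_if_supported[OF G] unfolding bounded_iff by auto
  have F_meas [measurable]: "F \<in> borel_measurable borel" and G_meas [measurable]: "G \<in> borel_measurable borel"
    using F(1) G(1) by (auto intro: borel_measurable_continuous_onI)
  have "(\<lambda>j. LINT x|lborel. Q j x) \<longlonglongrightarrow> (LINT x|lborel. G x)"
  proof (rule integral_dominated_convergence[where w = "\<lambda>x. C * indicat_real (cball 0 (R + 1)) x"])
    show "integrable lborel (\<lambda>x::real^2. C * indicat_real (cball 0 (R + 1)) x)"
      using emeasure_bounded_finite[OF bounded_cball[of "0::real^2" "R + 1"]]
      by (intro integrable_mult_right integrable_real_indicator) auto
    show "AE x in lborel. (\<lambda>j. Q j x) \<longlonglongrightarrow> G x"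
    proof (rule AE_I2)
      fix x
      have "((\<lambda>h. (F (x + h *\<^sub>R ?e) - F x) / h) \<longlongrightarrow> G x) (at 0)"
        using D[of x 0] by (simp add: has_field_derivative_iff)
      moreover have "filterlim t (at 0) sequentially"
        unfolding filterlim_at t_def using LIMSEQ_inverse_real_of_nat by auto
      ultimately show "(\<lambda>j. Q j x) \<longlonglongrightarrow> G x"
        unfolding Q_def by (rule filterlim_compose)
    qed
    show "AE x in lborel. norm (Q j x) \<le> C * indicat_real (cball 0 (R + 1)) x" for j
    proof (rule AE_I2)
      fix x
      have ne: "norm (t j *\<^sub>R ?e) \<le> 1" using t[of j] by simp
      show "norm (Q j x) \<le> C * indicat_real (cball 0 (R + 1)) x"
      proof (cases "norm x \<le> R + 1")
        case True
        have "\<exists>z>0. z < t j \<and> F (x + t j *\<^sub>R ?e) - F (x + 0 *\<^sub>R ?e) = (t j - 0) * G (x + z *\<^sub>R ?e)"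
          using t D by (intro MVT2) auto
        then obtain z where "F (x + t j *\<^sub>R ?e) - F x = t j * G (x + z *\<^sub>R ?e)" by auto
        then have "Q j x = G (x + z *\<^sub>R ?e)" using t[of j] by (simp add: Q_def)
        then show ?thesis using C True by simp
      next
        case False
        have "R < norm (x + t j *\<^sub>R ?e)"
          using False ne norm_triangle_ineq4[of "x + t j *\<^sub>R ?e" "t j *\<^sub>R ?e"] by simp
        then have "Q j x = 0" using False F(2) by (simp add: Q_def)
        then show ?thesis using False by simp
      qed
    qed
  qed (simp_all add: Q_def[abs_def])
  moreover have "(LINT x|lborel. Q j x) = 0" for j
  proof -
    have i: "integrable lborel F" by (rule integrable_if_supported[OF F])
    have "integrable lborel (\<lambda>x. F (x + t j *\<^sub>R ?e))"
    proof (rule integrable_if_supported)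
      show "continuous_on UNIV (\<lambda>x. F (x + t j *\<^sub>R ?e))"
        by (intro continuous_on_compose2[OF F(1)] continuous_intros) auto
      fix x :: "real^2" assume "R + 1 < norm x"
      then have "R < norm (x + t j *\<^sub>R ?e)"
        using t[of j] norm_triangle_ineq4[of "x + t j *\<^sub>R ?e" "t j *\<^sub>R ?e"] by simp
      then show "F (x + t j *\<^sub>R ?e) = 0" by (rule F(2))
    qed
    then show ?thesis
      using i lborel_integral_translate[OF F_meas, of "t j *\<^sub>R ?e"]
      by (simp add: Q_def add.commute)
  qed
  ultimately have "(\<lambda>j. 0) \<longlonglongrightarrow> (LINT x|lborel. G x)" by simp
  then show ?thesis by (simp add: LIMSEQ_const_iff)
qed

text \<open>Green's identity: \<open>u * \<partial>\<^sub>i\<partial>\<^sub>i w - w * \<partial>\<^sub>i\<partial>\<^sub>i u\<close> is the derivative of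
  \<open>u * \<partial>\<^sub>i w - w * \<partial>\<^sub>i u\<close>, which has compact support.\<close>

lemma helmholtz_symmetric:
  assumes u: "u \<in> schwartz" "\<And>x. R < norm x \<Longrightarrow> u x = 0" and w: "w \<in> schwartz"
  shows "(LINT x|lborel. helmholtz u x * w x) = (LINT x|lborel. u x * helmholtz w x)"
proof -
  note su = schwartz_smooth[OF u(1)] and sw = schwartz_smooth[OF w]
  have zero: "partials is u x = 0" if "R < norm x" for "is" x
    by (rule partials_eq_0_outside[OF u(2) that])
  have cont: "continuous_on UNIV (partials is u)" "continuous_on UNIV (partials is w)" for "is"
    by (auto intro: continuous_on_partials su sw)
  have cont0: "continuous_on UNIV u" "continuous_on UNIV w"
    using cont[of "[]"] by auto
  have one: "(LINT x|lborel. u x * partials [i, i] w x - partials [i, i] u x * w x) = 0" for i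
  proof (rule integral_derivative_along_axis[where R = R and F = "\<lambda>x. u x * partials [i] w x - partials [i] u x * w x" and i = i])
    fix x :: "real^2" and t :: real
    show "((\<lambda>t. u (x + t *\<^sub>R axis i 1) * partials [i] w (x + t *\<^sub>R axis i 1)
          - partials [i] u (x + t *\<^sub>R axis i 1) * w (x + t *\<^sub>R axis i 1)) has_real_derivative
        u (x + t *\<^sub>R axis i 1) * partials [i, i] w (x + t *\<^sub>R axis i 1)
          - partials [i, i] u (x + t *\<^sub>R axis i 1) * w (x + t *\<^sub>R axis i 1)) (at t)"
      using has_real_derivative_along_axis[OF su, of "[]" x i t] has_real_derivative_along_axis[OF su, of "[i]" x i t]
        has_real_derivative_along_axis[OF sw, of "[]" x i t] has_real_derivative_along_axis[OF sw, of "[i]" x i t]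
      by (auto intro!: derivative_eq_intros)
  qed (auto intro!: continuous_intros cont cont0 simp: u(2) zero)
  have int: "integrable lborel (\<lambda>x. u x * partials is w x)" "integrable lborel (\<lambda>x. partials is u x * w x)" for "is"
    by (auto intro!: integrable_if_supported[where R = R] continuous_intros cont cont0 simp: u(2) zero)
  have eq: "u x * helmholtz w x - helmholtz u x * w x
      = - (u x * partials [1, 1] w x - partials [1, 1] u x * w x) - (u x * partials [2, 2] w x - partials [2, 2] u x * w x)" for x
    by (simp add: helmholtz_def laplacian_def sum_2 algebra_simps)
  have "(LINT x|lborel. u x * helmholtz w x - helmholtz u x * w x) = 0"
    unfolding eq using one[of 1] one[of 2] int
    by (subst Bochner_Integration.integral_diff) auto
  moreover have "integrable lborel (\<lambda>x. u x * helmholtz w x)"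
    by (rule integrable_if_supported[where R = R])
      (intro continuous_on_mult schwartz_continuous_on helmholtz_schwartz u(1) w, simp add: u(2))
  moreover have "helmholtz u x = 0" if "R < norm x" for x
    using zero that by (simp add: helmholtz_def laplacian_def u(2))
  then have "integrable lborel (\<lambda>x. helmholtz u x * w x)"
    by (intro integrable_if_supported[where R = R] continuous_on_mult schwartz_continuous_on
        helmholtz_schwartz u(1) w) simp
  ultimately show ?thesis by simp
qed

section \<open>Mollification\<close>

lemma integral_mollifier:
  fixes w :: "real^2 \<Rightarrow> real"
  assumes n: "1 \<le> n" and [measurable]: "h \<in> borel_measurable borel" "w \<in> borel_measurable borel"
  shows "(LINT y|lborel. mollifier h n x y * w y) = (LINT z|lborel. h z * w (x - inverse (real n) *\<^sub>R z))"
proof -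
  let ?c = "- inverse (real n)"
  have c: "?c \<noteq> 0" using n by simp
  have "(LINT y|lborel. mollifier h n x y * w y)
      = (LINT y|density (distr lborel borel (\<lambda>z. x + ?c *\<^sub>R z)) (\<lambda>_. \<bar>?c\<bar> ^ DIM(real^2)). mollifier h n x y * w y)"
    using lborel_affine[OF c, of x] by simp
  also have "\<dots> = (LINT y|distr lborel borel (\<lambda>z. x + ?c *\<^sub>R z). \<bar>?c\<bar> ^ DIM(real^2) *\<^sub>R (mollifier h n x y * w y))"
    unfolding mollifier_def by (rule integral_density) auto
  also have "\<dots> = (LINT z|lborel. \<bar>?c\<bar> ^ DIM(real^2) *\<^sub>R (mollifier h n x (x + ?c *\<^sub>R z) * w (x + ?c *\<^sub>R z)))"
    unfolding mollifier_def by (rule integral_distr) auto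
  also have "\<dots> = (LINT z|lborel. h z * w (x - inverse (real n) *\<^sub>R z))"
    using n by (intro Bochner_Integration.integral_cong refl) (simp add: mollifier_def power_inverse)
  finally show ?thesis .
qed

text \<open>The convolution of \<open>u\<close> with the rescaled bump function.\<close>

definition smear :: "(real^2 \<Rightarrow> real) \<Rightarrow> nat \<Rightarrow> (real^2 \<Rightarrow> real) \<Rightarrow> real^2 \<Rightarrow> real" where
  "smear h n u x = (LINT y|lborel. mollifier h n x y * u y)"

locale smooth_mollifier =
  fixes h :: "real^2 \<Rightarrow> real"
  assumes h_smooth: "smooth_fun h" and h_supp: "compactly_supported h"
    and h_nonneg: "\<And>x. 0 \<le> h x" and h_int: "(LINT x|lborel. h x) = 1"
begin

lemma h_continuous: "continuous_on UNIV h"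
  using continuous_on_partials[OF h_smooth, of UNIV "[]"] by simp

lemma h_measurable [measurable]: "h \<in> borel_measurable borel"
  by (rule borel_measurable_continuous_onI[OF h_continuous])

lemma h_integrable: "integrable lborel h"
  using h_int not_integrable_integral_eq[of lborel h] by auto

lemma integral_mollifier_1: "1 \<le> N \<Longrightarrow> (LINT y|lborel. mollifier h N x y) = 1"
  using integral_mollifier[of N h "\<lambda>_. 1" x] h_int by simp

text \<open>After the substitution \<open>y = x - z / n\<close> the bump no longer depends on \<open>n\<close> and dominates.  The
  points \<open>X j\<close> and the scales \<open>N j\<close> vary together, which covers continuity at a fixed scale as well as the
  removal of the mollifier.\<close>

lemma smear_tendsto:
  assumes n: "\<And>j. 1 \<le> N j" and u: "continuous_on UNIV u" "\<And>x. \<bar>u x\<bar> \<le> C"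
    and lim: "\<And>z. (\<lambda>j. X j - inverse (real (N j)) *\<^sub>R z) \<longlonglongrightarrow> Y z"
  shows "(\<lambda>j. smear h (N j) u (X j)) \<longlonglongrightarrow> (LINT z|lborel. h z * u (Y z))"
proof -
  have um [measurable]: "u \<in> borel_measurable borel" by (rule borel_measurable_continuous_onI[OF u(1)])
  have Ym [measurable]: "Y \<in> borel_measurable borel"
    by (rule borel_measurable_LIMSEQ_metric[OF _ lim]) auto
  show ?thesis
    unfolding smear_def integral_mollifier[OF n h_measurable um]
  proof (rule integral_dominated_convergence[where w = "\<lambda>z. h z * C"])
    show "integrable lborel (\<lambda>z. h z * C)" using h_integrable by simp
    show "AE z in lborel. (\<lambda>j. h z * u (X j - inverse (real (N j)) *\<^sub>R z)) \<longlonglongrightarrow> h z * u (Y z)"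
    proof (rule AE_I2)
      fix z
      have "isCont u (Y z)" using u(1) by (simp add: continuous_on_eq_continuous_at)
      from isCont_tendsto_compose[OF this lim]
      show "(\<lambda>j. h z * u (X j - inverse (real (N j)) *\<^sub>R z)) \<longlonglongrightarrow> h z * u (Y z)"
        by (rule tendsto_mult_left)
    qed
    show "AE z in lborel. norm (h z * u (X j - inverse (real (N j)) *\<^sub>R z)) \<le> h z * C" for j
      using h_nonneg u(2) by (intro AE_I2) (auto simp: abs_mult intro!: mult_left_mono)
  qed measurable
qed

lemma smear_continuous:
  assumes "1 \<le> n" "continuous_on UNIV u" "\<And>x. \<bar>u x\<bar> \<le> C"
  shows "continuous_on UNIV (smear h n u)"
  unfolding continuous_on_sequentially
proof (intro allI ballI impI)
  fix X and a :: "real^2" assume "(\<forall>j. X j \<in> UNIV) \<and> X \<longlonglongrightarrow> a"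
  then have X: "X \<longlonglongrightarrow> a" by simp
  have um: "u \<in> borel_measurable borel" by (rule borel_measurable_continuous_onI[OF assms(2)])
  have "(\<lambda>j. smear h n u (X j)) \<longlonglongrightarrow> (LINT z|lborel. h z * u (a - inverse (real n) *\<^sub>R z))"
    by (rule smear_tendsto[OF _ assms(2,3)]) (use assms(1) in \<open>auto intro!: tendsto_intros X\<close>)
  then show "(smear h n u \<circ> X) \<longlonglongrightarrow> smear h n u a"
    unfolding smear_def integral_mollifier[OF assms(1) h_measurable um] by (simp add: o_def)
qed

lemma smear_bounded:
  assumes "1 \<le> n" "continuous_on UNIV u" "\<And>x. \<bar>u x\<bar> \<le> C"
  shows "\<bar>smear h n u x\<bar> \<le> C"
proof -
  have um [measurable]: "u \<in> borel_measurable borel" by (rule borel_measurable_continuous_onI[OF assms(2)])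
  have "\<bar>smear h n u x\<bar> \<le> (LINT z|lborel. \<bar>h z * u (x - inverse (real n) *\<^sub>R z)\<bar>)"
    unfolding smear_def integral_mollifier[OF assms(1) h_measurable um] by (rule integral_abs_bound)
  also have "\<dots> \<le> (LINT z|lborel. h z * C)"
  proof (rule integral_mono)
    show i: "integrable lborel (\<lambda>z. h z * C)" using h_integrable by simp
    show "\<bar>h z * u (x - inverse (real n) *\<^sub>R z)\<bar> \<le> h z * C" for z
      using h_nonneg assms(3) by (auto simp: abs_mult intro!: mult_left_mono)
    then show "integrable lborel (\<lambda>z. \<bar>h z * u (x - inverse (real n) *\<^sub>R z)\<bar>)"
      by (intro Bochner_Integration.integrable_bound[OF i] AE_I2) (auto intro: order_trans[OF _ abs_ge_self])
  qed
  also have "\<dots> = C" using h_int by simp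
  finally show ?thesis .
qed

lemma smear_tendsto_id:
  assumes "continuous_on UNIV u" "\<And>x. \<bar>u x\<bar> \<le> C"
  shows "(\<lambda>n. smear h (Suc n) u x) \<longlonglongrightarrow> u x"
proof -
  have "(\<lambda>j. x - inverse (real (Suc j)) *\<^sub>R z) \<longlonglongrightarrow> x - 0 *\<^sub>R z" for z
    by (intro tendsto_intros LIMSEQ_inverse_real_of_nat)
  then have "(\<lambda>n. smear h (Suc n) u x) \<longlonglongrightarrow> (LINT z|lborel. h z * u x)"
    by (intro smear_tendsto[OF _ assms]) auto
  then show ?thesis using h_int by simp
qed

text \<open>Otherwise \<open>g\<close> is negative on the whole support of a narrow bump around \<open>x0\<close>.  A nonpositive
  integrand with nonnegative integral is zero almost everywhere, so that the bump would vanish almost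
  everywhere, although its integral is one.\<close>

lemma nonneg_at_continuity_point:
  assumes k: "1 \<le> k" and int: "\<And>N. 1 \<le> N \<Longrightarrow> integrable lebesgue (\<lambda>x. mollifier h N x0 x ^ k * g x)"
    and nn: "\<And>N. 1 \<le> N \<Longrightarrow> 0 \<le> (LINT x|lebesgue. mollifier h N x0 x ^ k * g x)"
    and cont: "isCont g x0"
  shows "0 \<le> g x0"
proof (rule ccontr)
  assume "\<not> 0 \<le> g x0"
  then have "\<forall>\<^sub>F x in at x0. g x < 0"
    using cont unfolding isCont_def by (intro order_tendstoD(2)) auto
  then obtain r where r: "r > 0" "\<And>x. x \<noteq> x0 \<Longrightarrow> dist x x0 < r \<Longrightarrow> g x < 0"
    unfolding eventually_at by auto
  then have neg: "g x < 0" if "dist x x0 < r" for x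
    using that \<open>\<not> 0 \<le> g x0\<close> by (cases "x = x0") auto
  obtain R where R: "0 < R" "\<And>x. R \<le> norm x \<Longrightarrow> h x = 0"
    using compactly_supportedD[OF h_supp] by metis
  obtain N where N: "R / r < real N" using reals_Archimedean2 by blast
  have "0 < R / r" using R r by simp
  then have N1: "1 \<le> N" using N by (cases N) auto
  let ?m = "mollifier h N x0"
  have out: "?m x = 0" if "r \<le> dist x x0" for x
  proof -
    have "R \<le> real N * r" using N r by (simp add: field_simps)
    also have "\<dots> \<le> real N * dist x x0" using that by (intro mult_left_mono) auto
    also have "\<dots> = norm (real N *\<^sub>R (x0 - x))" by (simp add: dist_norm norm_minus_commute)
    finally show ?thesis using R(2) by (simp add: mollifier_def)
  qed
  have mnn: "0 \<le> ?m x" for x using h_nonneg by (simp add: mollifier_def)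
  have le: "0 \<le> - (?m x ^ k * g x)" if "1 \<le> k" for x
  proof (cases "dist x x0 < r")
    case True
    then show ?thesis using neg[OF True] mnn[of x] by (simp add: mult_nonneg_nonpos)
  qed (use out[of x] that in \<open>auto simp: not_less power_0_left\<close>)
  have le: "0 \<le> - (?m x ^ k * g x)" for x
    using le k by blast
  have "(LINT x|lebesgue. - (?m x ^ k * g x)) \<le> 0"
    using nn[OF N1] by simp
  moreover have "0 \<le> (LINT x|lebesgue. - (?m x ^ k * g x))"
    by (intro Bochner_Integration.integral_nonneg le)
  ultimately have "(LINT x|lebesgue. - (?m x ^ k * g x)) = 0" by linarith
  moreover have "integrable lebesgue (\<lambda>x. - (?m x ^ k * g x))" using int[OF N1] by simp
  ultimately have "AE x in lebesgue. - (?m x ^ k * g x) = 0"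
    using le by (subst (asm) integral_nonneg_eq_0_iff_AE) auto
  then have "AE x in lebesgue. ?m x = 0"
  proof eventually_elim
    case (elim x)
    then show ?case using out[of x] neg[of x] by (cases "dist x x0 < r") (auto simp: not_less)
  qed
  moreover have m_meas: "?m \<in> borel_measurable borel" unfolding mollifier_def by measurable
  ultimately have "(LINT x|lebesgue. ?m x) = integral\<^sup>L lebesgue (\<lambda>x::real^2. 0)"
    by (intro integral_cong_AE) (auto intro: measurable_completion)
  then show False
    using integral_mollifier_1[OF N1, of x0] m_meas by (simp add: integral_completion)
qed

end

section \<open>The tilted field\<close>

context lattice_field
begin

text \<open>The two mixed terms are the integral of \<open>\<delta> x * u\<close> and that of
  \<open>helmholtz u\<close> times the preimage of \<open>\<delta> x\<close>; they agree because \<open>helmholtz\<close> is symmetric.\<close>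

lemma Cov_linear_combination:
  assumes u: "u \<in> schwartz" "\<And>y. R < norm y \<Longrightarrow> u y = 0" and range: "\<delta> x \<in> helmholtz ` schwartz"
  shows "Cov (\<lambda>y. s * \<delta> x y + 1 * helmholtz u y) (\<lambda>y. s * \<delta> x y + 1 * helmholtz u y)
    = Cov (helmholtz u) (helmholtz u) + 2 * s * smear h n u x + s\<^sup>2 * variance_at x"
proof -
  let ?f = "helmholtz u"
  obtain v where v: "v \<in> schwartz" "helmholtz v = \<delta> x" using range by auto
  have f: "?f \<in> helmholtz ` schwartz" "resolvent ?f = u" using u resolvent_helmholtz by auto
  have rv: "resolvent (\<delta> x) = v" using v resolvent_helmholtz by metis
  have res: "resolvent (\<lambda>y. s * \<delta> x y + 1 * ?f y) = (\<lambda>y. s * v y + 1 * u y)"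
    using resolvent_linear(1)[OF range f(1), of s 1] by (simp add: rv f(2))
  obtain Rh where Rh: "\<And>y. Rh \<le> norm y \<Longrightarrow> h y = 0"
    using compactly_supportedD[OF h_supp] by metis
  define r where "r = max R (norm x + Rh)"
  have out: "\<delta> x y = 0" "u y = 0" "?f y = 0" if y: "r < norm y" for y
  proof -
    have "Rh \<le> norm (real n *\<^sub>R (x - y))"
      using norm_le_of_scaled[OF n, of x y Rh] y unfolding r_def by argo
    then show "\<delta> x y = 0" by (simp add: mollifier_def Rh)
    show "u y = 0" using u(2)[of y] y by (simp add: r_def)
    have "partials is u y = 0" for "is"
      by (rule partials_eq_0_outside[OF u(2)]) (use y in \<open>auto simp: r_def\<close>)
    then show "?f y = 0" using u(2)[of y] y by (simp add: helmholtz_def laplacian_def r_def)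
  qed
  have sch: "\<delta> x \<in> schwartz" "?f \<in> schwartz" using \<delta>_schwartz helmholtz_schwartz u by auto
  have int: "integrable lborel (\<lambda>y. \<delta> x y * v y)" "integrable lborel (\<lambda>y. \<delta> x y * u y)"
    "integrable lborel (\<lambda>y. ?f y * v y)" "integrable lborel (\<lambda>y. ?f y * u y)"
    by (intro integrable_if_supported[where R = r] continuous_on_mult schwartz_continuous_on sch u(1) v(1);
        simp add: out)+
  have sym: "(LINT y|lborel. ?f y * v y) = smear h n u x"
    using helmholtz_symmetric[OF u v(1)] unfolding v(2) smear_def by (simp only: mult.commute[of "u _"])
  have "Cov (\<lambda>y. s * \<delta> x y + 1 * ?f y) (\<lambda>y. s * \<delta> x y + 1 * ?f y)
      = (LINT y|lborel. s\<^sup>2 * (\<delta> x y * v y) + s * (\<delta> x y * u y) + s * (?f y * v y) + ?f y * u y)"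
    unfolding Cov_def res by (intro Bochner_Integration.integral_cong refl) (simp add: algebra_simps power2_eq_square)
  also have "\<dots> = s\<^sup>2 * (LINT y|lborel. \<delta> x y * v y) + s * (LINT y|lborel. \<delta> x y * u y)
      + s * (LINT y|lborel. ?f y * v y) + (LINT y|lborel. ?f y * u y)"
    using int by simp
  finally show ?thesis
    unfolding sym by (simp add: Cov_def rv f(2) variance_at_def smear_def)
qed

lemma wick_tilted_by_helmholtz:
  assumes u: "u \<in> schwartz" "\<And>y. R < norm y \<Longrightarrow> u y = 0" and range: "\<delta> x \<in> helmholtz ` schwartz"
  shows "has_bochner_integral \<mu> (\<lambda>\<phi>. wick k (variance_at x) (\<phi> (\<delta> x)) * exp (\<phi> (helmholtz u)))
    (smear h n u x ^ k * exp (Cov (helmholtz u) (helmholtz u) / 2))"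
proof (rule wick_tilted_expectation)
  have f: "helmholtz u \<in> schwartz" by (rule helmholtz_schwartz[OF u(1)])
  show "(\<lambda>\<phi>. \<phi> (helmholtz u)) \<in> borel_measurable \<mu>" by (rule free_field_measurable[OF mu f])
  fix s
  let ?F = "\<lambda>y. s * \<delta> x y + 1 * helmholtz u y"
  have "has_bochner_integral \<mu> (\<lambda>\<phi>. exp (1 * \<phi> ?F)) (exp (1\<^sup>2 * Cov ?F ?F / 2))"
    by (rule free_field_exp[OF mu schwartz_linear[OF \<delta>_schwartz f]])
  also have "has_bochner_integral \<mu> (\<lambda>\<phi>. exp (1 * \<phi> ?F)) = has_bochner_integral \<mu> (\<lambda>\<phi>. exp (s * \<phi> (\<delta> x) + \<phi> (helmholtz u)))"
  proof (intro ext has_bochner_integral_cong refl)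
    fix \<phi> assume "\<phi> \<in> space \<mu>"
    then have "\<phi> ?F = s * \<phi> (\<delta> x) + 1 * \<phi> (helmholtz u)"
      unfolding space_\<mu> by (rule temperedD[OF _ \<delta>_schwartz f])
    then show "exp (1 * \<phi> ?F) = exp (s * \<phi> (\<delta> x) + \<phi> (helmholtz u))"
      by (simp only: mult_1)
  qed
  finally have "has_bochner_integral \<mu> (\<lambda>\<phi>. exp (s * \<phi> (\<delta> x) + \<phi> (helmholtz u))) (exp (1\<^sup>2 * Cov ?F ?F / 2))" .
  moreover have C: "Cov ?F ?F = Cov (helmholtz u) (helmholtz u) + 2 * s * smear h n u x + s\<^sup>2 * variance_at x"
    by (rule Cov_linear_combination[OF u range])
  have "1\<^sup>2 * Cov ?F ?F / 2 = Cov (helmholtz u) (helmholtz u) / 2 + s * smear h n u x + s\<^sup>2 * variance_at x / 2"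
    unfolding C by (simp add: add_divide_distrib)
  ultimately show "has_bochner_integral \<mu> (\<lambda>\<phi>. exp (s * \<phi> (\<delta> x) + \<phi> (helmholtz u)))
      (exp (Cov (helmholtz u) (helmholtz u) / 2 + s * smear h n u x + s\<^sup>2 * variance_at x / 2))"
    by (simp only:)
qed measurable

end

text \<open>Young's inequality; the free parameter \<open>e\<close> makes the first summand small once and for all, before the
  second one tends to zero.\<close>

lemma L2_weighted_bound:
  fixes a D :: "'a \<Rightarrow> real"
  assumes a: "in_Lp M 2 a" and [measurable]: "D \<in> borel_measurable M" and D2: "integrable M (\<lambda>x. (D x)\<^sup>2)"
    and e: "0 < e"
  shows "integrable M (\<lambda>x. a x * D x)"
    and "\<bar>LINT x|M. a x * D x\<bar> \<le> e * (LINT x|M. (D x)\<^sup>2) + (LINT x|M. \<bar>a x\<bar> powr 2) / e"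
proof -
  have [measurable]: "a \<in> borel_measurable M" and a2: "integrable M (\<lambda>x. \<bar>a x\<bar> powr 2)"
    using a by (auto simp: in_Lp_def)
  have le: "\<bar>s * t\<bar> \<le> e * t\<^sup>2 + \<bar>s\<bar> powr 2 / e" for s t :: real
  proof -
    have "0 \<le> (e * \<bar>t\<bar> - \<bar>s\<bar>)\<^sup>2" by simp
    also have "\<dots> = e\<^sup>2 * t\<^sup>2 - 2 * e * \<bar>s * t\<bar> + s\<^sup>2" by (simp add: power2_eq_square algebra_simps abs_mult)
    finally have "2 * e * \<bar>s * t\<bar> \<le> e\<^sup>2 * t\<^sup>2 + s\<^sup>2" by simp
    moreover have "0 \<le> e * \<bar>s * t\<bar>" using e by simp
    ultimately have "e * \<bar>s * t\<bar> \<le> e\<^sup>2 * t\<^sup>2 + s\<^sup>2" by linarith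
    also have "\<dots> = e * (e * t\<^sup>2 + s\<^sup>2 / e)" using e by (simp add: power2_eq_square algebra_simps)
    finally have "\<bar>s * t\<bar> \<le> e * t\<^sup>2 + s\<^sup>2 / e" using e by simp
    then show ?thesis by simp
  qed
  have i: "integrable M (\<lambda>x. e * (D x)\<^sup>2 + \<bar>a x\<bar> powr 2 / e)" using D2 a2 by auto
  show ia: "integrable M (\<lambda>x. a x * D x)"
    by (rule Bochner_Integration.integrable_bound[OF i]) (auto intro!: AE_I2 order_trans[OF le] simp flip: abs_mult)
  have "\<bar>LINT x|M. a x * D x\<bar> \<le> (LINT x|M. \<bar>a x * D x\<bar>)" by (rule integral_abs_bound)
  also have "\<dots> \<le> (LINT x|M. e * (D x)\<^sup>2 + \<bar>a x\<bar> powr 2 / e)"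
    by (intro integral_mono i le integrable_abs ia)
  also have "\<dots> = e * (LINT x|M. (D x)\<^sup>2) + (LINT x|M. \<bar>a x\<bar> powr 2) / e"
    using D2 a2 by simp
  finally show "\<bar>LINT x|M. a x * D x\<bar> \<le> e * (LINT x|M. (D x)\<^sup>2) + (LINT x|M. \<bar>a x\<bar> powr 2) / e" .
qed

lemma L2_tendsto_weighted:
  assumes lim: "Lp_tendsto M 2 F f" and D: "D \<in> borel_measurable M" "integrable M (\<lambda>x. (D x)\<^sup>2)"
  shows "(\<lambda>m. LINT x|M. F m x * D x) \<longlonglongrightarrow> (LINT x|M. f x * D x)"
proof (rule LIMSEQ_I)
  fix e :: real assume e: "0 < e"
  have t: "\<And>m. in_Lp M 2 (F m)" "in_Lp M 2 f" "(\<lambda>m. LINT x|M. \<bar>F m x - f x\<bar> powr 2) \<longlonglongrightarrow> 0"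
    using lim by (auto simp: Lp_tendsto_iff)
  define I where "I = (LINT x|M. (D x)\<^sup>2)"
  have I: "0 \<le> I" by (simp add: I_def)
  define e' where "e' = e / (2 * (I + 1))"
  have e': "e' > 0" using e I by (simp add: e'_def)
  have "e' * I < e / 2"
  proof -
    have "I / (I + 1) < 1" using I by simp
    then have "e / 2 * (I / (I + 1)) < e / 2 * 1" using e by (intro mult_strict_left_mono) auto
    then show ?thesis by (simp add: e'_def)
  qed
  have "\<forall>\<^sub>F m in sequentially. (LINT x|M. \<bar>F m x - f x\<bar> powr 2) < e' * (e / 2)"
    using e e' by (intro order_tendstoD(2)[OF t(3)]) auto
  then obtain N where N: "\<And>m. N \<le> m \<Longrightarrow> (LINT x|M. \<bar>F m x - f x\<bar> powr 2) < e' * (e / 2)"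
    unfolding eventually_sequentially by blast
  show "\<exists>N. \<forall>m\<ge>N. norm ((LINT x|M. F m x * D x) - (LINT x|M. f x * D x)) < e"
  proof (intro exI[of _ N] allI impI)
    fix m assume m: "N \<le> m"
    have d: "in_Lp M 2 (\<lambda>x. F m x - f x)" by (rule in_Lp_diff(1)) (auto intro: t)
    have "(LINT x|M. F m x * D x) - (LINT x|M. f x * D x) = (LINT x|M. (F m x - f x) * D x)"
      using L2_weighted_bound(1)[OF t(1) D, of 1] L2_weighted_bound(1)[OF t(2) D, of 1]
      by (simp add: left_diff_distrib)
    also have "\<bar>\<dots>\<bar> \<le> e' * I + (LINT x|M. \<bar>F m x - f x\<bar> powr 2) / e'"
      unfolding I_def by (rule L2_weighted_bound(2)[OF d D e'])
    also have "(LINT x|M. \<bar>F m x - f x\<bar> powr 2) / e' < e / 2"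
      using N[OF m] e' by (simp add: pos_divide_less_eq mult.commute)
    finally show "norm ((LINT x|M. F m x * D x) - (LINT x|M. f x * D x)) < e"
      using \<open>e' * I < e / 2\<close> by simp
  qed
qed

context lattice_field
begin

lemma exp_weight_square_integrable:
  assumes "f \<in> schwartz"
  shows "(\<lambda>\<phi>. exp (\<phi> f)) \<in> borel_measurable \<mu>" "integrable \<mu> (\<lambda>\<phi>. (exp (\<phi> f))\<^sup>2)"
proof -
  note [measurable] = free_field_measurable[OF mu assms]
  show "(\<lambda>\<phi>. exp (\<phi> f)) \<in> borel_measurable \<mu>" by measurable
  have "(exp x)\<^sup>2 = exp (2 * x)" for x :: real by (simp add: power2_eq_square flip: exp_add)
  then show "integrable \<mu> (\<lambda>\<phi>. (exp (\<phi> f))\<^sup>2)"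
    using free_field_exp[OF mu assms, of 2] by (simp add: has_bochner_integral_iff)
qed

end

context cutoff_field
begin

text \<open>Lattice sums are integrated term by term, and both sides pass to the limit.\<close>

lemma interaction_tilted_by_helmholtz:
  assumes u: "u \<in> schwartz" "\<And>y. r < norm y \<Longrightarrow> u y = 0" and range: "schwartz \<subseteq> helmholtz ` schwartz"
    and cont: "continuous_on UNIV (smear h n u)"
  shows "(LINT \<phi>|\<mu>. interaction h g k n \<phi> * exp (\<phi> (helmholtz u)))
    = (LINT x|lebesgue. smear h n u x ^ k * g x) * exp (Cov (helmholtz u) (helmholtz u) / 2)"
proof -
  let ?D = "\<lambda>\<phi>. exp (\<phi> (helmholtz u))" and ?E = "exp (Cov (helmholtz u) (helmholtz u) / 2)"
  have f: "helmholtz u \<in> schwartz" by (rule helmholtz_schwartz[OF u(1)])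
  have "\<delta> x \<in> helmholtz ` schwartz" for x using range \<delta>_schwartz by blast
  from wick_tilted_by_helmholtz[OF u this]
  have w: "integrable \<mu> (\<lambda>\<phi>. wick k (variance_at x) (\<phi> (\<delta> x)) * ?D \<phi>)"
    "(LINT \<phi>|\<mu>. wick k (variance_at x) (\<phi> (\<delta> x)) * ?D \<phi>) = smear h n u x ^ k * ?E" for x
    by (simp_all add: has_bochner_integral_iff)
  have "(LINT \<phi>|\<mu>. pulled_back k m \<phi> * ?D \<phi>) = 1 / 2 ^ (2 * m) * (\<Sum>l\<in>grid m. smear h n u l ^ k * g l) * ?E" for m
  proof -
    have "pulled_back k m \<phi> * ?D \<phi> = (\<Sum>l\<in>grid m. (1 / 2 ^ (2 * m) * g l) * (wick k (variance_at l) (\<phi> (\<delta> l)) * ?D \<phi>))" for \<phi>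
      by (simp add: lattice_interaction_restrict sum_distrib_left sum_distrib_right mult_ac sum_divide_distrib)
    then have "(LINT \<phi>|\<mu>. pulled_back k m \<phi> * ?D \<phi>) = (\<Sum>l\<in>grid m. (1 / 2 ^ (2 * m) * g l) * (smear h n u l ^ k * ?E))"
      using w by (simp only:) (subst Bochner_Integration.integral_sum, simp_all)
    then show ?thesis by (simp add: sum_distrib_left sum_distrib_right mult_ac)
  qed
  moreover have "(\<lambda>m. 1 / 2 ^ (2 * m) * (\<Sum>l\<in>grid m. smear h n u l ^ k * g l) * ?E)
      \<longlonglongrightarrow> (LINT x|lebesgue. smear h n u x ^ k * g x) * ?E"
    by (intro tendsto_mult_right lattice_sum_tendsto[OF g_riemann g_meas g_supp] continuous_intros cont)
  moreover have "(\<lambda>m. LINT \<phi>|\<mu>. pulled_back k m \<phi> * ?D \<phi>) \<longlonglongrightarrow> (LINT \<phi>|\<mu>. interaction h g k n \<phi> * ?D \<phi>)"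
    by (intro L2_tendsto_weighted pulled_back_Lp_tendsto exp_weight_square_integrable f) simp
  ultimately show ?thesis
    using LIMSEQ_unique by (simp only:)
qed

lemma integrable_cutoff: "integrable lebesgue g"
proof (rule Bochner_Integration.integrable_bound)
  show "integrable lebesgue (\<lambda>x. B * indicat_real (cball 0 R) x)"
    by (intro integrable_mult_right lmeasurable_iff_integrable[THEN iffD1] lmeasurable_cball)
  show "AE x in lebesgue. norm (g x) \<le> norm (B * indicat_real (cball 0 R) x)"
  proof (rule AE_I2)
    fix x show "norm (g x) \<le> norm (B * indicat_real (cball 0 R) x)"
      using g_bd[of x] g_supp[of x] B_nonneg by (cases "norm x \<le> R") auto
  qed
qed (rule g_meas)

lemma integrable_continuous_times_cutoff:
  assumes "continuous_on UNIV F"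
  shows "integrable lebesgue (\<lambda>x. F x * g x)"
proof -
  obtain C where C: "0 \<le> C" "\<And>x. norm x \<le> R \<Longrightarrow> \<bar>F x\<bar> \<le> C" using continuous_bounded_cball[OF assms] by blast
  have Fm: "F \<in> borel_measurable lebesgue"
    using assms by (simp add: borel_measurable_continuous_onI measurable_completion)
  show ?thesis
  proof (rule Bochner_Integration.integrable_bound)
    show "integrable lebesgue (\<lambda>x. C * g x)" using integrable_cutoff by simp
    show "AE x in lebesgue. norm (F x * g x) \<le> norm (C * g x)"
    proof (rule AE_I2)
      fix x show "norm (F x * g x) \<le> norm (C * g x)"
        using C g_supp[of x] by (cases "norm x \<le> R") (auto simp: abs_mult intro!: mult_right_mono)
    qed
  qed (use Fm g_meas in simp)
qed

end

section \<open>Exponential integrability forces the sign of the cutoff\<close>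

context lattice_field
begin

text \<open>The variational inequality of Gibbs for the probability density
  \<open>exp (\<phi> f - Cov f f / 2)\<close>, whose relative entropy is \<open>Cov f f / 2\<close>.\<close>

lemma gibbs_lower_bound:
  assumes f: "f \<in> schwartz" and intV: "integrable \<mu> (\<lambda>\<phi>. exp (- q * V \<phi>))"
    and intVf: "integrable \<mu> (\<lambda>\<phi>. V \<phi> * exp (\<phi> f))"
    and I: "(LINT \<phi>|\<mu>. V \<phi> * exp (\<phi> f)) = I * exp (Cov f f / 2)"
  shows "exp (- q * I - Cov f f / 2) \<le> (LINT \<phi>|\<mu>. exp (- q * V \<phi>))"
proof -
  define c where "c = Cov f f"
  define m where "m = - q * I - c / 2"
  note [measurable] = free_field_measurable[OF mu f]
  have E0: "integrable \<mu> (\<lambda>\<phi>. exp (\<phi> f))" "(LINT \<phi>|\<mu>. exp (\<phi> f)) = exp (c / 2)"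
    using free_field_exp[OF mu f, of 1] by (simp_all add: has_bochner_integral_iff c_def)
  have "has_bochner_integral \<mu> (\<lambda>\<phi>. wick (Suc 0) c (\<phi> f) * exp (\<phi> f)) (c ^ Suc 0 * exp (c / 2))"
  proof (rule wick_tilted_expectation)
    fix s
    have "has_bochner_integral \<mu> (\<lambda>\<phi>. exp ((s + 1) * \<phi> f)) (exp ((s + 1)\<^sup>2 * c / 2))"
      unfolding c_def by (rule free_field_exp[OF mu f])
    then show "has_bochner_integral \<mu> (\<lambda>\<phi>. exp (s * \<phi> f + \<phi> f)) (exp (c / 2 + s * c + s\<^sup>2 * c / 2))"
      by (simp add: algebra_simps power2_eq_square add_divide_distrib)
  qed measurable
  then have E1: "integrable \<mu> (\<lambda>\<phi>. \<phi> f * exp (\<phi> f))" "(LINT \<phi>|\<mu>. \<phi> f * exp (\<phi> f)) = c * exp (c / 2)"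
    by (simp_all add: has_bochner_integral_iff wick_1)
  \<comment> \<open>With the density \<open>d = exp (\<phi> f - c / 2)\<close> and \<open>y = - q * V \<phi> - ln d\<close>, this is the tangent bound
    \<open>d * exp m * (1 + y - m)\<close> of \<open>d * exp y = exp (- q * V \<phi>)\<close>; \<open>m\<close> is the mean of \<open>y\<close> under the density.\<close>
  define L where "L \<phi> = exp (m - c / 2) * ((1 + c / 2 - m) * exp (\<phi> f) - q * (V \<phi> * exp (\<phi> f)) - \<phi> f * exp (\<phi> f))" for \<phi>
  have iL: "integrable \<mu> L"
    unfolding L_def[abs_def] using E0 E1 intVf by auto
  have "(LINT \<phi>|\<mu>. L \<phi>) = exp (m - c / 2) * ((1 + c / 2 - m) * exp (c / 2) - q * (I * exp (c / 2)) - c * exp (c / 2))"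
    unfolding L_def using E0 E1 intVf I by (simp add: c_def)
  also have "\<dots> = exp (m - c / 2) * exp (c / 2) * (1 + c / 2 - m - q * I - c)"
    by (simp add: algebra_simps)
  also have "1 + c / 2 - m - q * I - c = 1" by (simp add: m_def)
  also have "exp (m - c / 2) * exp (c / 2) * 1 = exp m" by (simp flip: exp_add)
  finally have "exp m = (LINT \<phi>|\<mu>. L \<phi>)" by simp
  also have "\<dots> \<le> (LINT \<phi>|\<mu>. exp (- q * V \<phi>))"
  proof (rule integral_mono[OF iL intV])
    fix \<phi>
    let ?x = "- q * V \<phi> - \<phi> f + c / 2 - m"
    have "L \<phi> = exp (m - c / 2) * exp (\<phi> f) * (1 + ?x)"
      by (simp add: L_def algebra_simps)
    also have "\<dots> \<le> exp (m - c / 2) * exp (\<phi> f) * exp ?x"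
      by (intro mult_left_mono exp_ge_add_one_self) auto
    also have "\<dots> = exp (- q * V \<phi>)" by (simp flip: exp_add)
    finally show "L \<phi> \<le> exp (- q * V \<phi>)" .
  qed
  finally show ?thesis by (simp add: m_def c_def)
qed

text \<open>The normal law of variance zero is concentrated at zero.\<close>

lemma \<delta>_AE_0:
  assumes "variance_at x = 0"
  shows "AE \<phi> in \<mu>. \<phi> (\<delta> x) = 0"
proof -
  have "AE y in distr \<mu> borel (\<lambda>\<phi>. \<phi> (\<delta> x)). y = 0"
    unfolding free_field_distr[OF mu \<delta>_schwartz] using assms
    by (subst AE_distr_iff) (simp_all add: variance_at_def)
  then show ?thesis by (subst (asm) AE_distr_iff) simp_all
qed

end

text \<open>Here the scale of the mollifier is not fixed, because \<open>V\<close> is the limit of the interactions as the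
  scale tends to zero.\<close>

locale exponentiable_interaction = smooth_mollifier +
  fixes \<mu> :: "((real^2 \<Rightarrow> real) \<Rightarrow> real) measure" and g :: "real^2 \<Rightarrow> real" and R B :: real
    and k :: nat and V :: "((real^2 \<Rightarrow> real) \<Rightarrow> real) \<Rightarrow> real"
  assumes mu: "free_field_measure \<mu>" and g_riemann: "riemann_integrable g"
    and g_meas: "g \<in> borel_measurable lebesgue"
    and g_supp: "\<And>x. R < norm x \<Longrightarrow> g x = 0" and g_bd: "\<And>x. \<bar>g x\<bar> \<le> B"
    and V_lim: "Lp_tendsto \<mu> 2 (interaction h g k) V"
    and V_exp: "\<And>q. 1 \<le> q \<Longrightarrow> in_Lp \<mu> q (\<lambda>\<phi>. exp (- V \<phi>))"
begin

lemma cutoff_field: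
  assumes n: "1 \<le> n"
  shows "cutoff_field \<mu> h n g R B"
  by unfold_locales (rule mu h_smooth h_supp n g_riemann g_meas g_bd | rule g_supp, assumption)+

sublocale unit_scale: cutoff_field \<mu> h 1 g R B
  by (rule cutoff_field) simp

text \<open>At scale \<open>n\<close> the mean under the tilted measure is the integral of the \<open>k\<close>-th power of the mollified \<open>u\<close>
  against \<open>g\<close>; it converges as the mollifier is removed.\<close>

lemma V_tilted_by_helmholtz:
  assumes range: "schwartz \<subseteq> helmholtz ` schwartz"
    and u: "u \<in> schwartz" "\<And>y. r < norm y \<Longrightarrow> u y = 0"
  shows "integrable \<mu> (\<lambda>\<phi>. V \<phi> * exp (\<phi> (helmholtz u)))"
    and "(LINT \<phi>|\<mu>. V \<phi> * exp (\<phi> (helmholtz u)))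
      = (LINT x|lebesgue. u x ^ k * g x) * exp (Cov (helmholtz u) (helmholtz u) / 2)"
proof -
  let ?E = "exp (Cov (helmholtz u) (helmholtz u) / 2)"
  have uc: "continuous_on UNIV u" by (rule schwartz_continuous_on[OF u(1)])
  obtain C where C: "\<And>x. \<bar>u x\<bar> \<le> C"
    using bounded_range_if_supported[OF uc u(2)] unfolding bounded_iff by auto
  note W = unit_scale.exp_weight_square_integrable[OF helmholtz_schwartz[OF u(1)]]
  have L: "in_Lp \<mu> 2 V" using V_lim by (simp add: Lp_tendsto_def)
  show "integrable \<mu> (\<lambda>\<phi>. V \<phi> * exp (\<phi> (helmholtz u)))"
    by (rule L2_weighted_bound(1)[OF L W zero_less_one])
  have sc: "continuous_on UNIV (smear h (Suc j) u)" for j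
    by (rule smear_continuous[OF _ uc C]) simp
  have "Lp_tendsto \<mu> 2 (\<lambda>j. interaction h g k (Suc j)) V"
    using V_lim LIMSEQ_Suc unfolding Lp_tendsto_def by auto
  from L2_tendsto_weighted[OF this W]
  have "(\<lambda>j. LINT \<phi>|\<mu>. interaction h g k (Suc j) \<phi> * exp (\<phi> (helmholtz u)))
    \<longlonglongrightarrow> (LINT \<phi>|\<mu>. V \<phi> * exp (\<phi> (helmholtz u)))" .
  moreover have "(LINT \<phi>|\<mu>. interaction h g k (Suc j) \<phi> * exp (\<phi> (helmholtz u)))
      = (LINT x|lebesgue. smear h (Suc j) u x ^ k * g x) * ?E" for j
    by (rule cutoff_field.interaction_tilted_by_helmholtz[OF cutoff_field u range sc]) simp
  moreover have "(\<lambda>j. LINT x|lebesgue. smear h (Suc j) u x ^ k * g x) \<longlonglongrightarrow> (LINT x|lebesgue. u x ^ k * g x)"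
  proof (rule integral_dominated_convergence[where w = "\<lambda>x. C ^ k * \<bar>g x\<bar>"])
    show "integrable lebesgue (\<lambda>x. C ^ k * \<bar>g x\<bar>)"
      using unit_scale.integrable_cutoff by simp
    show "(\<lambda>x. u x ^ k * g x) \<in> borel_measurable lebesgue"
      using unit_scale.integrable_continuous_times_cutoff[of "\<lambda>x. u x ^ k"] uc by (auto intro: continuous_intros)
    show "(\<lambda>x. smear h (Suc j) u x ^ k * g x) \<in> borel_measurable lebesgue" for j
      using unit_scale.integrable_continuous_times_cutoff[of "\<lambda>x. smear h (Suc j) u x ^ k"] sc by (auto intro: continuous_intros)
    show "AE x in lebesgue. (\<lambda>j. smear h (Suc j) u x ^ k * g x) \<longlonglongrightarrow> u x ^ k * g x"
      by (intro AE_I2 tendsto_intros smear_tendsto_id[OF uc C])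
    show "AE x in lebesgue. norm (smear h (Suc j) u x ^ k * g x) \<le> C ^ k * \<bar>g x\<bar>" for j
    proof (rule AE_I2)
      fix x
      have "\<bar>smear h (Suc j) u x\<bar> ^ k \<le> C ^ k"
        by (intro power_mono smear_bounded[OF _ uc C]) auto
      then show "norm (smear h (Suc j) u x ^ k * g x) \<le> C ^ k * \<bar>g x\<bar>"
        by (auto simp: abs_mult power_abs intro: mult_right_mono)
    qed
  qed
  then have "(\<lambda>j. (LINT x|lebesgue. smear h (Suc j) u x ^ k * g x) * ?E) \<longlonglongrightarrow> (LINT x|lebesgue. u x ^ k * g x) * ?E"
    by (rule tendsto_mult_right)
  ultimately show "(LINT \<phi>|\<mu>. V \<phi> * exp (\<phi> (helmholtz u))) = (LINT x|lebesgue. u x ^ k * g x) * ?E"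
    using LIMSEQ_unique by (simp only:)
qed

text \<open>Shifting the field by \<open>a * u\<close> costs an entropy of order \<open>a\<^sup>2\<close>, while it changes the mean of
  \<open>V\<close> by \<open>a ^ k\<close> times the integral of \<open>u ^ k * g\<close>.  If that integral were negative, \<open>exp (- q * V)\<close>
  would have infinite expectation for large \<open>q\<close>.\<close>

lemma cutoff_moment_nonneg:
  assumes k: "2 \<le> k" and range: "schwartz \<subseteq> helmholtz ` schwartz"
    and u: "u \<in> schwartz" "\<And>y. r < norm y \<Longrightarrow> u y = 0"
  shows "0 \<le> (LINT x|lebesgue. u x ^ k * g x)"
proof (rule ccontr)
  define J where "J = (LINT x|lebesgue. u x ^ k * g x)"
  define c where "c = Cov (helmholtz u) (helmholtz u)"
  assume "\<not> 0 \<le> (LINT x|lebesgue. u x ^ k * g x)"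
  then have J: "J < 0" by (simp add: J_def)
  have c: "0 \<le> c" unfolding c_def by (rule free_field_Cov_nonneg[OF mu helmholtz_schwartz[OF u(1)]])
  \<comment> \<open>Large enough for the gain \<open>- q * J\<close> to exceed the entropy \<open>c / 2\<close> by one, which leaves
    an exponent of at least \<open>a\<^sup>2\<close> after the shift by \<open>a * u\<close>.\<close>
  define q where "q = max 1 ((c / 2 + 1) / (- J))"
  have q1: "1 \<le> q" by (simp add: q_def)
  have qJ: "c / 2 + 1 \<le> q * (- J)"
  proof -
    have "(c / 2 + 1) / (- J) \<le> q" unfolding q_def by (rule max.cobounded2)
    moreover have "0 < - J" using J by simp
    ultimately show ?thesis using pos_divide_le_eq by blast
  qed
  have int: "integrable \<mu> (\<lambda>\<phi>. exp (- q * V \<phi>))"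
    using V_exp[OF q1] by (simp add: in_Lp_def exp_powr_real mult.commute)
  define M where "M = (LINT \<phi>|\<mu>. exp (- q * V \<phi>))"
  have le: "exp (a\<^sup>2) \<le> M" if a: "1 \<le> a" for a
  proof -
    let ?v = "\<lambda>x. a * u x"
    have v: "?v \<in> schwartz" "\<And>y. r < norm y \<Longrightarrow> ?v y = 0" using u by (auto intro: schwartz_scale)
    have hv: "helmholtz ?v = (\<lambda>x. a * helmholtz u x)"
      using helmholtz_linear[OF u(1) u(1), of a 0] by simp
    have "Cov (helmholtz ?v) (helmholtz ?v) = a\<^sup>2 * c"
      unfolding hv c_def by (rule Cov_scale_range) (use u in auto)
    moreover have "(LINT x|lebesgue. ?v x ^ k * g x) = a ^ k * J"
      by (simp add: J_def power_mult_distrib mult.assoc)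
    ultimately have "exp (- q * (a ^ k * J) - a\<^sup>2 * c / 2) \<le> M"
      using unit_scale.gibbs_lower_bound[OF helmholtz_schwartz[OF v(1)] int V_tilted_by_helmholtz[OF range v]]
      by (simp add: M_def)
    moreover have "a\<^sup>2 \<le> - q * (a ^ k * J) - a\<^sup>2 * c / 2"
    proof -
      have "a\<^sup>2 * (c / 2 + 1) \<le> a\<^sup>2 * (q * (- J))" by (intro mult_left_mono qJ) auto
      also have "\<dots> \<le> a ^ k * (q * (- J))"
        using a k J q1 by (intro mult_right_mono power_increasing) (auto simp: mult_nonneg_nonpos)
      finally show ?thesis by (simp add: algebra_simps)
    qed
    ultimately show ?thesis by (meson exp_le_cancel_iff order_trans)
  qed
  define a where "a = max 1 M"
  have "a \<le> a\<^sup>2" using self_le_power[of a 2] by (simp add: a_def)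
  also have "a\<^sup>2 < exp (a\<^sup>2)" using exp_ge_add_one_self[of "a\<^sup>2"] by linarith
  also have "exp (a\<^sup>2) \<le> M" by (rule le) (simp add: a_def)
  finally show False by (simp add: a_def)
qed

lemma mollifier_moment_nonneg:
  assumes k: "2 \<le> k" and range: "schwartz \<subseteq> helmholtz ` schwartz" and N: "1 \<le> N"
  shows "0 \<le> (LINT x|lebesgue. (s * mollifier h N x0 x) ^ k * g x)"
proof -
  obtain Rh where Rh: "\<And>y. Rh \<le> norm y \<Longrightarrow> h y = 0"
    using compactly_supportedD[OF h_supp] by metis
  show ?thesis
  proof (rule cutoff_moment_nonneg[OF k range])
    show "(\<lambda>x. s * mollifier h N x0 x) \<in> schwartz"
      by (intro schwartz_scale mollifier_schwartz h_smooth h_supp N)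
    fix y :: "real^2" assume "norm x0 + Rh < norm y"
    then have "Rh \<le> norm (real N *\<^sub>R (x0 - y))"
      using norm_le_of_scaled[OF N, of x0 y Rh] by argo
    then show "s * mollifier h N x0 y = 0" by (simp add: mollifier_def Rh)
  qed
qed

lemma AE_isCont: "AE x in lebesgue. isCont g x"
proof -
  have "{x. \<not> isCont g x} \<in> null_sets lebesgue"
    using riemann_integrable_continuous_AE[OF g_riemann] by (simp add: negligible_iff_null_sets)
  then show ?thesis by (rule AE_I') auto
qed

lemma integrable_mollifier_power_times_cutoff:
  assumes "1 \<le> N"
  shows "integrable lebesgue (\<lambda>x. mollifier h N x0 x ^ k * g x)"
  using schwartz_continuous_on[OF mollifier_schwartz[OF h_smooth h_supp assms]]
  by (intro unit_scale.integrable_continuous_times_cutoff continuous_intros)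

lemma cutoff_nonneg_AE:
  assumes k: "2 \<le> k" and range: "schwartz \<subseteq> helmholtz ` schwartz"
  shows "AE x in lebesgue. 0 \<le> g x"
  using AE_isCont
proof eventually_elim
  case (elim x0)
  show ?case
  proof (rule nonneg_at_continuity_point[where k = k])
    show "0 \<le> (LINT x|lebesgue. mollifier h N x0 x ^ k * g x)" if "1 \<le> N" for N
      using mollifier_moment_nonneg[OF k range that, of 1 x0] by simp
  qed (use k elim integrable_mollifier_power_times_cutoff in auto)
qed

text \<open>An odd power changes its sign with the test function, so both signs of the bump are available.\<close>

lemma cutoff_nonpos_AE:
  assumes k: "2 \<le> k" "odd k" and range: "schwartz \<subseteq> helmholtz ` schwartz"
  shows "AE x in lebesgue. g x \<le> 0"
  using AE_isCont
proof eventually_elim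
  case (elim x0)
  have "0 \<le> - g x0"
  proof (rule nonneg_at_continuity_point[where k = k and g = "\<lambda>x. - g x"])
    show "0 \<le> (LINT x|lebesgue. mollifier h N x0 x ^ k * - g x)" if "1 \<le> N" for N
      using mollifier_moment_nonneg[OF k(1) range that, of "-1" x0] k(2) by simp
    show "integrable lebesgue (\<lambda>x. mollifier h N x0 x ^ k * - g x)" if "1 \<le> N" for N
      using integrable_mollifier_power_times_cutoff[OF that] by simp
  qed (use k elim in \<open>auto intro: continuous_intros\<close>)
  then show ?case by simp
qed

text \<open>For \<open>k \<noteq> 1\<close> the lattice sums are bounded below almost surely, each case for its own reason: a
  constant Wick power, a field that vanishes, an even Wick polynomial with \<open>g \<ge> 0\<close>, or \<open>g = 0\<close>.\<close>

lemma exp_moments_bounded: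
  assumes sgn: "2 \<le> k \<longrightarrow> sign_normalized g" and n: "1 \<le> n" and q: "0 \<le> q"
  obtains D where
    "\<And>m. integrable \<mu> (\<lambda>\<phi>. exp (- q * lattice_interaction h g k n m (lattice_restrict h n m \<phi>)))"
    "\<And>m. (LINT \<phi>|\<mu>. exp (- q * lattice_interaction h g k n m (lattice_restrict h n m \<phi>))) \<le> D"
proof -
  interpret F: cutoff_field \<mu> h n g R B by (rule cutoff_field[OF n])
  obtain K where K: "0 \<le> K" "\<And>m. real (card {l \<in> grid m. norm l \<le> R}) / 2 ^ (2 * m) \<le> K"
    using F.point_count_bounded by blast
  show ?thesis
  proof (cases "k = Suc 0")
    case True
    show ?thesis
      by (rule F.exp_linear_moments_bounded[of q]) (use that True in blast)
  next
    case False
    have "\<exists>W\<ge>0. \<forall>l. norm l \<le> R \<longrightarrow> (AE \<phi> in \<mu>. - W \<le> wick k (F.variance_at l) (\<phi> (mollifier h n l)) * g l)"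
    proof (cases "k = 0")
      case True
      have "- B \<le> g l" for l using g_bd[of l] by linarith
      then show ?thesis using F.B_nonneg by (intro exI[of _ B]) (simp add: True wick_0)
    next
      case False
      then have k: "2 \<le> k" using \<open>k \<noteq> Suc 0\<close> by linarith
      show ?thesis
      proof (cases "schwartz \<subseteq> helmholtz ` schwartz")
        case False
        \<comment> \<open>The degenerate case: the field vanishes almost surely, and so do its Wick powers.\<close>
        then obtain f0 where f0: "f0 \<in> schwartz" "f0 \<notin> helmholtz ` schwartz" by blast
        have v0: "F.variance_at l = 0" for l
          unfolding F.variance_at_def by (rule free_field_degenerate[OF mu f0 F.\<delta>_schwartz])
        have "AE \<phi> in \<mu>. - 0 \<le> wick k (F.variance_at l) (\<phi> (mollifier h n l)) * g l" for l
          using F.\<delta>_AE_0[OF v0[of l]] by eventually_elim (use k in \<open>simp add: v0 wick_at_0_0\<close>)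
        then show ?thesis by (intro exI[of _ 0]) simp
      next
        case range: True
        have sn: "sign_normalized g" using sgn k by blast
        have nonneg: "0 \<le> g x" for x
          using cutoff_nonneg_AE[OF k range] sn unfolding sign_normalized_def by blast
        show ?thesis
        proof (cases "even k")
          case True
          obtain C where C: "0 \<le> C" "\<And>x. norm x \<le> R \<Longrightarrow> F.variance_at x \<le> C"
            using F.variance_bounded by blast
          obtain W where W: "0 \<le> W" "\<And>c t. 0 \<le> c \<Longrightarrow> c \<le> C \<Longrightarrow> - W \<le> wick k c t"
            using wick_even_bounded_below[OF True k, of C] by blast
          have "- (W * B) \<le> wick k (F.variance_at l) t * g l" if l: "norm l \<le> R" for l t
          proof -
            have "- (W * B) \<le> - W * g l"
              using W(1) g_bd[of l] nonneg[of l] by (simp add: mult_left_mono)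
            also have "\<dots> \<le> wick k (F.variance_at l) t * g l"
              using W(2)[OF F.variance_at_nonneg C(2)[OF l]] nonneg by (intro mult_right_mono) auto
            finally show ?thesis .
          qed
          then show ?thesis using W F.B_nonneg by (intro exI[of _ "W * B"]) auto
        next
          case False
          have "g x \<le> 0" for x
            using cutoff_nonpos_AE[OF k False range] sn unfolding sign_normalized_def by blast
          then have "g x = 0" for x using nonneg[of x] by (simp add: antisym)
          then show ?thesis by (intro exI[of _ 0]) simp
        qed
      qed
    qed
    then obtain W where W: "0 \<le> W"
      "\<And>l. norm l \<le> R \<Longrightarrow> AE \<phi> in \<mu>. - W \<le> wick k (F.variance_at l) (\<phi> (mollifier h n l)) * g l"
      by blast
    have "AE \<phi> in \<mu>. - (K * W) \<le> lattice_interaction h g k n m (lattice_restrict h n m \<phi>)" for m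
      by (rule F.pulled_back_bounded_below[OF K(2) W])
    from F.exp_pulled_back_bounded_if_bounded_below[OF q this]
    show ?thesis by (rule that)
  qed
qed

end

theorem theorem5p2:
  fixes \<mu> :: "((real^2 \<Rightarrow> real) \<Rightarrow> real) measure"
    and h g :: "real^2 \<Rightarrow> real"
    and V :: "((real^2 \<Rightarrow> real) \<Rightarrow> real) \<Rightarrow> real"
    and k n :: nat
    and p s :: real
  assumes mu: "free_field_measure \<mu>"
    and h_smooth: "smooth_fun h"
    and h_supp: "compactly_supported h"
    and h_nonneg: "\<forall>x. 0 \<le> h x"
    and h_int: "(LINT x|lborel. h x) = 1"
    and h_fourier: "\<forall>\<xi>. fourier h \<xi> \<noteq> 0"
    and g_supp: "compactly_supported g"
    and s: "1 < s"
    and g_Ls: "in_Lp lebesgue s g"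
    and V_lim: "Lp_tendsto \<mu> 2 (interaction h g k) V"
    and V_exp: "\<forall>q\<ge>1. in_Lp \<mu> q (\<lambda>\<phi>. exp (- V \<phi>))"
    and n: "1 \<le> n"
    and p: "1 \<le> p"
    and g_riemann: "riemann_integrable g"
  shows "lattice_co_Cauchy \<mu> h n p (lattice_interaction h g k n)
    \<and> Lp_eq \<mu> p (colimit_map \<mu> h n p (lattice_interaction h g k n)) (interaction h g k n)
    \<and> ((2 \<le> k \<longrightarrow> sign_normalized g) \<longrightarrow>
         lattice_co_Cauchy \<mu> h n p (\<lambda>m z. exp (- lattice_interaction h g k n m z))
       \<and> Lp_eq \<mu> p (colimit_map \<mu> h n p (\<lambda>m z. exp (- lattice_interaction h g k n m z)))
            (\<lambda>\<phi>. exp (- interaction h g k n \<phi>)))"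
proof -
  obtain R where R: "\<And>x. R < norm x \<Longrightarrow> g x = 0"
    using compactly_supportedD[OF g_supp] by (metis less_imp_le)
  obtain B where B: "\<And>x. \<bar>g x\<bar> \<le> B"
    using riemann_integrable_bounded[OF g_riemann] by metis
  have g_meas: "g \<in> borel_measurable lebesgue"
    using g_Ls by (simp add: in_Lp_def)
  interpret X: exponentiable_interaction h \<mu> g R B k V
    by unfold_locales
      (rule mu h_smooth h_supp h_nonneg[rule_format] h_int g_riemann g_meas B V_lim
        | rule R, assumption | rule V_exp[rule_format], assumption)+
  interpret F: cutoff_field \<mu> h n g R B
    by (rule X.cutoff_field[OF n])
  have p0: "0 < p" using p by simp
  have "lattice_co_Cauchy \<mu> h n p (\<lambda>m z. exp (- lattice_interaction h g k n m z))
      \<and> Lp_eq \<mu> p (colimit_map \<mu> h n p (\<lambda>m z. exp (- lattice_interaction h g k n m z)))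
          (\<lambda>\<phi>. exp (- interaction h g k n \<phi>))" if sgn: "2 \<le> k \<longrightarrow> sign_normalized g"
  proof -
    have q: "0 \<le> 2 * p" using p0 by simp
    obtain D where D:
      "\<And>m. integrable \<mu> (\<lambda>\<phi>. exp (- (2 * p) * F.pulled_back k m \<phi>))"
      "\<And>m. (LINT \<phi>|\<mu>. exp (- (2 * p) * F.pulled_back k m \<phi>)) \<le> D"
      using X.exp_moments_bounded[OF sgn n q] by blast
    show ?thesis using F.exp_interaction_colimit[OF p0 D] by blast
  qed
  then show ?thesis using F.interaction_colimit[OF p0] by blast
qed

end
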